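(* Let $F$ be a field of positive characteristic with at least three elements, and let $R$ be a commutative $F$-algebra. Then, for every positive integer $n$, the matrix ring $\mathbb{M}_n(R)$ is generalized quasi $t$-fine if and only if $R$ is generalized quasi $t$-fine.
   Context: Rings and algebras are associative with identity $1$. For a ring $S$: $\mathrm{J}(S)$ is the Jacobson radical, $\mathcal{U}(S)$ the group of units, $\mathcal{T}(S)$ the set of torsion units, i.e. units $u$ with $u^m=1$ for some $m\ge 1$, and $\mathcal{Q}(S)=\{q\in S : 1-xq\in \mathcal{U}(S)\text{ for every } x\in S \text{ with } xq=qx\}$ the set of quasinilpotent elements. $S$ is generalized quasi $t$-fine if $S\setminus \mathrm{J}(S)=\mathcal{T}(S)+\mathcal{Q}(S)$. $\mathbb{M}_n(R)$ is the ring of $n\times n$ matrices over $R$. *)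

theory Defs
  imports "HOL-Algebra.Algebra" "Jordan_Normal_Form.Matrix"
begin

definition left_ideal :: "'a set \<Rightarrow> ('a, 'm) ring_scheme \<Rightarrow> bool" where
  "left_ideal I S \<longleftrightarrow> additive_subgroup I S \<and> (\<forall>x \<in> carrier S. \<forall>a \<in> I. x \<otimes>\<^bsub>S\<^esub> a \<in> I)"

definition maximal_left_ideal :: "'a set \<Rightarrow> ('a, 'm) ring_scheme \<Rightarrow> bool" where
  "maximal_left_ideal I S \<longleftrightarrow> left_ideal I S \<and> I \<noteq> carrier S \<and>
     (\<forall>K. left_ideal K S \<and> I \<subseteq> K \<longrightarrow> K = I \<or> K = carrier S)"

text \<open>The meet with the carrier only matters for the zero ring: it has no maximal left ideals,
  and its radical is the whole ring.\<close>

definition jacobson_radical :: "('a, 'm) ring_scheme \<Rightarrow> 'a set" where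
  "jacobson_radical S = carrier S \<inter> \<Inter> {I. maximal_left_ideal I S}"

definition torsion_units :: "('a, 'm) ring_scheme \<Rightarrow> 'a set" where
  "torsion_units S = {u \<in> Units S. \<exists>m::nat. m \<ge> 1 \<and> u [^]\<^bsub>S\<^esub> m = \<one>\<^bsub>S\<^esub>}"

definition quasinilpotents :: "('a, 'm) ring_scheme \<Rightarrow> 'a set" where
  "quasinilpotents S = {q \<in> carrier S.
     \<forall>x \<in> carrier S. x \<otimes>\<^bsub>S\<^esub> q = q \<otimes>\<^bsub>S\<^esub> x \<longrightarrow> \<one>\<^bsub>S\<^esub> \<ominus>\<^bsub>S\<^esub> (x \<otimes>\<^bsub>S\<^esub> q) \<in> Units S}"

definition generalized_quasi_t_fine :: "('a, 'm) ring_scheme \<Rightarrow> bool" where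
  "generalized_quasi_t_fine S \<longleftrightarrow>
     carrier S - jacobson_radical S = torsion_units S <+>\<^bsub>S\<^esub> quasinilpotents S"

text \<open>The ring of \<open>n \<times> n\<close> matrices over a ring given by a carrier. In contrast to
  \<^const>\<open>ring_mat\<close>, the operations on the entries are those of the record \<open>R\<close>, not
  type class operations. Matrix indices start at 0.\<close>

definition matrix_ring :: "nat \<Rightarrow> ('a, 'm) ring_scheme \<Rightarrow> 'a mat ring" where
  "matrix_ring n R = \<lparr>
     carrier = {A \<in> carrier_mat n n. elements_mat A \<subseteq> carrier R},
     monoid.mult = (\<lambda>A B. mat n n (\<lambda>(i, j). \<Oplus>\<^bsub>R\<^esub>k\<in>{..<n}. A $$ (i, k) \<otimes>\<^bsub>R\<^esub> B $$ (k, j))),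
     one = mat n n (\<lambda>(i, j). if i = j then \<one>\<^bsub>R\<^esub> else \<zero>\<^bsub>R\<^esub>),
     ring.zero = mat n n (\<lambda>_. \<zero>\<^bsub>R\<^esub>),
     ring.add = (\<lambda>A B. mat n n (\<lambda>(i, j). A $$ (i, j) \<oplus>\<^bsub>R\<^esub> B $$ (i, j)))\<rparr>"

end

theory Submission
  imports Defs
begin

text \<open>
  If \<open>R\<close> or the matrix ring \<open>S\<close> is generalized quasi \<open>t\<close>-fine, then \<open>R\<close> is local, because a
  torsion unit plus a commuting quasinilpotent element is a unit. Let \<open>M\<close> be the maximal ideal. Then
  \<open>J(S)\<close> consists of the matrices over \<open>M\<close>, and \<open>R\<close> is generalized quasi \<open>t\<close>-fine iff
  every unit is congruent modulo \<open>M\<close> to a torsion unit.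

  Assume this for \<open>R\<close>. A matrix outside \<open>J(S)\<close> can be conjugated by transvections until its
  diagonal consists of units; this needs a residue field with at least three elements. Replacing
  the units among the entries by torsion lifts and the other entries by \<open>0\<close> changes it by a matrix
  over \<open>M\<close>. The upper triangular part of the result is invertible with entries in a finite subring,
  hence torsion, and the remainder is nilpotent modulo \<open>J(S)\<close>, hence quasinilpotent.

  Conversely let \<open>a\<close> be a unit of \<open>R\<close> and write the scalar matrix \<open>a\<close> as \<open>U + N\<close>. A suitable
  \<open>p\<close>-power \<open>U'\<close> of \<open>U\<close> has order prime to \<open>p\<close> and is congruent to a scalar modulo \<open>J(S)\<close>. For any
  matrix \<open>V\<close>, expanding \<open>[U'\<^sup>m, V] = 0\<close> and Nakayama's lemma give \<open>[U', V] = 0\<close>. So \<open>U'\<close> is a scalar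
  torsion unit, and a power of it is congruent to \<open>a\<close>.
\<close>

text \<open>The quasinilpotent condition tests only elements commuting with \<open>q\<close>, so it
  does not visibly pass to the quotient by J(S), and the converse cannot simply be read over the
  residue field. It is therefore exploited inside S: the scalar matrix of \<open>a\<close> is
  central, so \<open>U\<close> and \<open>N\<close> commute, and every cofactor that arises when
  powers of \<open>a\<close> and \<open>U\<close> are compared commutes with \<open>N\<close> as
  well. Such a comparison divides by the derivative m x^(m-1), which is why the p-part of the order
  of \<open>U\<close> has to go first; the p-power costs nothing modulo M, where the Frobenius map
  is injective. The factor m returns in [U'^m, V], which to first order is m times a unit scalar
  times [U', V]. In the other direction the residue field may be infinite; positive characteristic
  enters because finitely many torsion units then generate a finite subring. The three residue
  classes serve to choose a unit e that is moved from one diagonal position to another: e must be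
  nonzero and differ from the entry it is subtracted from.\<close>

lemma (in abelian_monoid) finsum_swap:
  assumes "finite A" "finite B" "\<And>i j. i \<in> A \<Longrightarrow> j \<in> B \<Longrightarrow> f i j \<in> carrier G"
  shows "(\<Oplus>i\<in>A. \<Oplus>j\<in>B. f i j) = (\<Oplus>j\<in>B. \<Oplus>i\<in>A. f i j)"
  using assms(1,3)
proof (induction A rule: finite_induct)
  case empty
  then show ?case by simp
next
  case (insert a A)
  have "(\<Oplus>i\<in>insert a A. \<Oplus>j\<in>B. f i j) = (\<Oplus>j\<in>B. f a j) \<oplus> (\<Oplus>i\<in>A. \<Oplus>j\<in>B. f i j)"
    using insert by (intro finsum_insert) auto
  also have "\<dots> = (\<Oplus>j\<in>B. f a j) \<oplus> (\<Oplus>j\<in>B. \<Oplus>i\<in>A. f i j)"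
    using insert by auto
  also have "\<dots> = (\<Oplus>j\<in>B. f a j \<oplus> (\<Oplus>i\<in>A. f i j))"
    using insert by (intro finsum_addf [symmetric]) auto
  also have "\<dots> = (\<Oplus>j\<in>B. \<Oplus>i\<in>insert a A. f i j)"
    using insert by (intro finsum_cong') auto
  finally show ?case .
qed

lemma (in abelian_monoid) finsum_delta:
  assumes "finite A" "i \<in> A" "f i \<in> carrier G" "\<And>j. j \<in> A \<Longrightarrow> j \<noteq> i \<Longrightarrow> f j = \<zero>"
  shows "(\<Oplus>j\<in>A. f j) = f i"
proof -
  have "(\<Oplus>j\<in>A. f j) = (\<Oplus>j\<in>A. if i = j then f j else \<zero>)"
    using assms by (intro finsum_cong') auto
  also have "\<dots> = (\<Oplus>j\<in>A. if i = j then f i else \<zero>)"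
    using assms by (intro finsum_cong') auto
  also have "\<dots> = f i"
    using finsum_singleton [of i A "\<lambda>_. f i"] assms by simp
  finally show ?thesis .
qed

lemma (in ideal) finsum_mem:
  assumes "finite A" "\<And>k. k \<in> A \<Longrightarrow> f k \<in> I"
  shows "(\<Oplus>k\<in>A. f k) \<in> I"
  using assms
proof (induction A rule: finite_induct)
  case (insert a A)
  then show ?case
    by (subst finsum_insert) (auto intro: Icarr a_closed)
qed simp

lemma (in monoid) UnitsI:
  assumes "x \<in> carrier G" "y \<in> carrier G" "x \<otimes> y = \<one>" "y \<otimes> x = \<one>"
  shows "x \<in> Units G"
  using assms by (auto simp: Units_def)

section \<open>Square matrices over a ring record: ring structure, scalar matrices, ideals\<close>

locale matrices = ring R for R (structure) +
  fixes n :: nat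
begin

abbreviation S where "S \<equiv> matrix_ring n R"

lemma carrier_iff:
  "A \<in> carrier S \<longleftrightarrow> A \<in> carrier_mat n n \<and> (\<forall>i<n. \<forall>j<n. A $$ (i, j) \<in> carrier R)"
  by (fastforce simp: matrix_ring_def elements_mat_def)

lemma entry_closed [simp]: "A \<in> carrier S \<Longrightarrow> i < n \<Longrightarrow> j < n \<Longrightarrow> A $$ (i, j) \<in> carrier R"
  by (simp add: carrier_iff)

lemma mat_closed:
  "(\<And>i j. i < n \<Longrightarrow> j < n \<Longrightarrow> f (i, j) \<in> carrier R) \<Longrightarrow> mat n n f \<in> carrier S"
  by (simp add: carrier_iff)

lemma mat_eqI:
  assumes "A \<in> carrier S" "B \<in> carrier S" "\<And>i j. i < n \<Longrightarrow> j < n \<Longrightarrow> A $$ (i, j) = B $$ (i, j)"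
  shows "A = B"
  using assms by (intro eq_matI) (auto simp: carrier_iff)

lemma zero_entry [simp]: "i < n \<Longrightarrow> j < n \<Longrightarrow> \<zero>\<^bsub>S\<^esub> $$ (i, j) = \<zero>"
  by (simp add: matrix_ring_def)

lemma one_entry [simp]: "i < n \<Longrightarrow> j < n \<Longrightarrow> \<one>\<^bsub>S\<^esub> $$ (i, j) = (if i = j then \<one> else \<zero>)"
  by (simp add: matrix_ring_def)

lemma add_entry [simp]:
  "i < n \<Longrightarrow> j < n \<Longrightarrow> (A \<oplus>\<^bsub>S\<^esub> B) $$ (i, j) = A $$ (i, j) \<oplus> B $$ (i, j)"
  by (simp add: matrix_ring_def)

lemma mult_entry:
  "i < n \<Longrightarrow> j < n \<Longrightarrow> (A \<otimes>\<^bsub>S\<^esub> B) $$ (i, j) = (\<Oplus>k\<in>{..<n}. A $$ (i, k) \<otimes> B $$ (k, j))"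
  by (simp add: matrix_ring_def)

lemma mat_mult_closed: "A \<in> carrier S \<Longrightarrow> B \<in> carrier S \<Longrightarrow> A \<otimes>\<^bsub>S\<^esub> B \<in> carrier S"
  by (auto simp: carrier_iff mult_entry) (auto simp: matrix_ring_def)

lemma mat_add_closed: "A \<in> carrier S \<Longrightarrow> B \<in> carrier S \<Longrightarrow> A \<oplus>\<^bsub>S\<^esub> B \<in> carrier S"
  by (auto simp: carrier_iff) (auto simp: matrix_ring_def)

lemma mat_one_closed: "\<one>\<^bsub>S\<^esub> \<in> carrier S"
  by (auto simp: carrier_iff) (auto simp: matrix_ring_def)

lemma mat_zero_closed: "\<zero>\<^bsub>S\<^esub> \<in> carrier S"
  by (auto simp: carrier_iff) (auto simp: matrix_ring_def)

lemma mat_mult_assoc: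
  assumes "A \<in> carrier S" "B \<in> carrier S" "C \<in> carrier S"
  shows "(A \<otimes>\<^bsub>S\<^esub> B) \<otimes>\<^bsub>S\<^esub> C = A \<otimes>\<^bsub>S\<^esub> (B \<otimes>\<^bsub>S\<^esub> C)"
proof (rule mat_eqI)
  fix i j assume ij: "i < n" "j < n"
  have "((A \<otimes>\<^bsub>S\<^esub> B) \<otimes>\<^bsub>S\<^esub> C) $$ (i, j)
      = (\<Oplus>k\<in>{..<n}. (\<Oplus>l\<in>{..<n}. A $$ (i, l) \<otimes> B $$ (l, k)) \<otimes> C $$ (k, j))"
    unfolding mult_entry [OF ij] using ij assms by (intro finsum_cong') (auto simp: mult_entry)
  also have "\<dots> = (\<Oplus>k\<in>{..<n}. \<Oplus>l\<in>{..<n}. A $$ (i, l) \<otimes> B $$ (l, k) \<otimes> C $$ (k, j))"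
    using ij assms by (intro finsum_cong' finsum_ldistr) auto
  also have "\<dots> = (\<Oplus>l\<in>{..<n}. \<Oplus>k\<in>{..<n}. A $$ (i, l) \<otimes> B $$ (l, k) \<otimes> C $$ (k, j))"
    using ij assms by (intro finsum_swap) auto
  also have "\<dots> = (\<Oplus>l\<in>{..<n}. A $$ (i, l) \<otimes> (\<Oplus>k\<in>{..<n}. B $$ (l, k) \<otimes> C $$ (k, j)))"
  proof (intro finsum_cong')
    fix l assume l: "l \<in> {..<n}"
    have "A $$ (i, l) \<otimes> (\<Oplus>k\<in>{..<n}. B $$ (l, k) \<otimes> C $$ (k, j))
        = (\<Oplus>k\<in>{..<n}. A $$ (i, l) \<otimes> (B $$ (l, k) \<otimes> C $$ (k, j)))"
      using ij l assms by (intro finsum_rdistr) auto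
    also have "\<dots> = (\<Oplus>k\<in>{..<n}. A $$ (i, l) \<otimes> B $$ (l, k) \<otimes> C $$ (k, j))"
      using ij l assms by (intro finsum_cong') (auto simp: m_assoc)
    finally show "(\<Oplus>k\<in>{..<n}. A $$ (i, l) \<otimes> B $$ (l, k) \<otimes> C $$ (k, j))
        = A $$ (i, l) \<otimes> (\<Oplus>k\<in>{..<n}. B $$ (l, k) \<otimes> C $$ (k, j))" ..
  qed (use ij assms in auto)
  also have "\<dots> = (A \<otimes>\<^bsub>S\<^esub> (B \<otimes>\<^bsub>S\<^esub> C)) $$ (i, j)"
    unfolding mult_entry [OF ij] using ij assms by (intro finsum_cong') (auto simp: mult_entry)
  finally show "((A \<otimes>\<^bsub>S\<^esub> B) \<otimes>\<^bsub>S\<^esub> C) $$ (i, j) = (A \<otimes>\<^bsub>S\<^esub> (B \<otimes>\<^bsub>S\<^esub> C)) $$ (i, j)" .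
qed (intro mat_mult_closed assms)+

lemma ring_matrix_ring: "ring S"
proof (intro ringI abelian_groupI monoidI)
  fix A B C assume ABC: "A \<in> carrier S" "B \<in> carrier S" "C \<in> carrier S"
  note closed = mat_mult_closed mat_add_closed ABC
  show "(A \<oplus>\<^bsub>S\<^esub> B) \<otimes>\<^bsub>S\<^esub> C = A \<otimes>\<^bsub>S\<^esub> C \<oplus>\<^bsub>S\<^esub> B \<otimes>\<^bsub>S\<^esub> C"
  proof (rule mat_eqI)
    fix i j assume ij: "i < n" "j < n"
    show "((A \<oplus>\<^bsub>S\<^esub> B) \<otimes>\<^bsub>S\<^esub> C) $$ (i, j) = (A \<otimes>\<^bsub>S\<^esub> C \<oplus>\<^bsub>S\<^esub> B \<otimes>\<^bsub>S\<^esub> C) $$ (i, j)"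
    proof -
      have "(\<Oplus>k\<in>{..<n}. (A \<oplus>\<^bsub>S\<^esub> B) $$ (i, k) \<otimes> C $$ (k, j))
          = (\<Oplus>k\<in>{..<n}. A $$ (i, k) \<otimes> C $$ (k, j) \<oplus> B $$ (i, k) \<otimes> C $$ (k, j))"
        using ij ABC by (intro finsum_cong') (auto simp: l_distr)
      also have "\<dots> = (\<Oplus>k\<in>{..<n}. A $$ (i, k) \<otimes> C $$ (k, j)) \<oplus> (\<Oplus>k\<in>{..<n}. B $$ (i, k) \<otimes> C $$ (k, j))"
        using ij ABC by (intro finsum_addf) auto
      finally show ?thesis
        by (simp only: add_entry [OF ij] mult_entry [OF ij])
    qed
  qed (intro closed)+
  show "C \<otimes>\<^bsub>S\<^esub> (A \<oplus>\<^bsub>S\<^esub> B) = C \<otimes>\<^bsub>S\<^esub> A \<oplus>\<^bsub>S\<^esub> C \<otimes>\<^bsub>S\<^esub> B"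
  proof (rule mat_eqI)
    fix i j assume ij: "i < n" "j < n"
    show "(C \<otimes>\<^bsub>S\<^esub> (A \<oplus>\<^bsub>S\<^esub> B)) $$ (i, j) = (C \<otimes>\<^bsub>S\<^esub> A \<oplus>\<^bsub>S\<^esub> C \<otimes>\<^bsub>S\<^esub> B) $$ (i, j)"
    proof -
      have "(\<Oplus>k\<in>{..<n}. C $$ (i, k) \<otimes> (A \<oplus>\<^bsub>S\<^esub> B) $$ (k, j))
          = (\<Oplus>k\<in>{..<n}. C $$ (i, k) \<otimes> A $$ (k, j) \<oplus> C $$ (i, k) \<otimes> B $$ (k, j))"
        using ij ABC by (intro finsum_cong') (auto simp: r_distr)
      also have "\<dots> = (\<Oplus>k\<in>{..<n}. C $$ (i, k) \<otimes> A $$ (k, j)) \<oplus> (\<Oplus>k\<in>{..<n}. C $$ (i, k) \<otimes> B $$ (k, j))"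
        using ij ABC by (intro finsum_addf) auto
      finally show ?thesis
        by (simp only: add_entry [OF ij] mult_entry [OF ij])
    qed
  qed (intro closed)+
  show "A \<oplus>\<^bsub>S\<^esub> B \<oplus>\<^bsub>S\<^esub> C = A \<oplus>\<^bsub>S\<^esub> (B \<oplus>\<^bsub>S\<^esub> C)"
    using ABC mat_add_closed by (intro mat_eqI) (auto simp: a_assoc)
next
  fix A assume A: "A \<in> carrier S"
  show "\<one>\<^bsub>S\<^esub> \<otimes>\<^bsub>S\<^esub> A = A"
  proof (rule mat_eqI)
    fix i j assume ij: "i < n" "j < n"
    then show "(\<one>\<^bsub>S\<^esub> \<otimes>\<^bsub>S\<^esub> A) $$ (i, j) = A $$ (i, j)"
      unfolding mult_entry [OF ij]
      using A by (subst finsum_delta [where i = i]) auto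
  qed (intro mat_mult_closed mat_one_closed A)+
  show "A \<otimes>\<^bsub>S\<^esub> \<one>\<^bsub>S\<^esub> = A"
  proof (rule mat_eqI)
    fix i j assume ij: "i < n" "j < n"
    then show "(A \<otimes>\<^bsub>S\<^esub> \<one>\<^bsub>S\<^esub>) $$ (i, j) = A $$ (i, j)"
      unfolding mult_entry [OF ij]
      using A by (subst finsum_delta [where i = j]) auto
  qed (intro mat_mult_closed mat_one_closed A)+
  show "\<exists>B\<in>carrier S. B \<oplus>\<^bsub>S\<^esub> A = \<zero>\<^bsub>S\<^esub>"
  proof
    show B: "mat n n (\<lambda>ij. \<ominus> (A $$ ij)) \<in> carrier S"
      using A by (intro mat_closed) auto
    show "mat n n (\<lambda>ij. \<ominus> (A $$ ij)) \<oplus>\<^bsub>S\<^esub> A = \<zero>\<^bsub>S\<^esub>"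
      using A B mat_add_closed mat_zero_closed by (intro mat_eqI) (auto simp: l_neg)
  qed
qed (auto intro!: mat_mult_closed mat_add_closed mat_zero_closed mat_one_closed mat_eqI
      simp: mat_mult_assoc a_comm)

end

sublocale matrices \<subseteq> mat: ring "matrix_ring n R"
  by (rule ring_matrix_ring)

context matrices
begin

lemma neg_entry [simp]:
  assumes "A \<in> carrier S" "i < n" "j < n"
  shows "(\<ominus>\<^bsub>S\<^esub> A) $$ (i, j) = \<ominus> (A $$ (i, j))"
proof -
  have "(A \<oplus>\<^bsub>S\<^esub> \<ominus>\<^bsub>S\<^esub> A) $$ (i, j) = \<zero>"
    using assms by (simp only: mat.r_neg zero_entry)
  then show ?thesis
    using assms minus_equality [of "(\<ominus>\<^bsub>S\<^esub> A) $$ (i, j)" "A $$ (i, j)"] by (simp add: a_comm)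
qed

lemma minus_entry [simp]:
  "A \<in> carrier S \<Longrightarrow> B \<in> carrier S \<Longrightarrow> i < n \<Longrightarrow> j < n \<Longrightarrow>
    (A \<ominus>\<^bsub>S\<^esub> B) $$ (i, j) = A $$ (i, j) \<ominus> B $$ (i, j)"
  by (simp add: a_minus_def)

definition scal :: "'a \<Rightarrow> 'a mat" where
  "scal c = mat n n (\<lambda>(i, j). if i = j then c else \<zero>)"

definition elem :: "nat \<Rightarrow> nat \<Rightarrow> 'a \<Rightarrow> 'a mat" where
  "elem i j c = mat n n (\<lambda>(k, l). if k = i \<and> l = j then c else \<zero>)"

definition matset :: "'a set \<Rightarrow> 'a mat set" where
  "matset K = {A \<in> carrier S. \<forall>i<n. \<forall>j<n. A $$ (i, j) \<in> K}"

lemma scal_closed [simp]: "c \<in> carrier R \<Longrightarrow> scal c \<in> carrier S"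
  unfolding scal_def by (rule mat_closed) auto

lemma elem_closed [simp]: "c \<in> carrier R \<Longrightarrow> elem i j c \<in> carrier S"
  unfolding elem_def by (rule mat_closed) auto

lemma scal_entry [simp]: "i < n \<Longrightarrow> j < n \<Longrightarrow> scal c $$ (i, j) = (if i = j then c else \<zero>)"
  by (simp add: scal_def)

lemma elem_entry [simp]:
  "k < n \<Longrightarrow> l < n \<Longrightarrow> elem i j c $$ (k, l) = (if k = i \<and> l = j then c else \<zero>)"
  by (simp add: elem_def)

lemma scal_mult_entry [simp]:
  assumes "c \<in> carrier R" "A \<in> carrier S" "i < n" "j < n"
  shows "(scal c \<otimes>\<^bsub>S\<^esub> A) $$ (i, j) = c \<otimes> A $$ (i, j)"
  unfolding mult_entry [OF assms(3,4)]
  using assms by (subst finsum_delta [where i = i]) auto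

lemma mult_scal_entry [simp]:
  assumes "c \<in> carrier R" "A \<in> carrier S" "i < n" "j < n"
  shows "(A \<otimes>\<^bsub>S\<^esub> scal c) $$ (i, j) = A $$ (i, j) \<otimes> c"
  unfolding mult_entry [OF assms(3,4)]
  using assms by (subst finsum_delta [where i = j]) auto

lemma elem_mult_entry [simp]:
  assumes "c \<in> carrier R" "A \<in> carrier S" "k < n" "l < n" "j < n"
  shows "(elem i j c \<otimes>\<^bsub>S\<^esub> A) $$ (k, l) = (if k = i then c \<otimes> A $$ (j, l) else \<zero>)"
  unfolding mult_entry [OF assms(3,4)]
  using assms by (subst finsum_delta [where i = j]) auto

lemma mult_elem_entry [simp]:
  assumes "c \<in> carrier R" "A \<in> carrier S" "k < n" "l < n" "i < n"
  shows "(A \<otimes>\<^bsub>S\<^esub> elem i j c) $$ (k, l) = (if l = j then A $$ (k, i) \<otimes> c else \<zero>)"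
  unfolding mult_entry [OF assms(3,4)]
  using assms by (subst finsum_delta [where i = i]) auto

lemma scal_one: "scal \<one> = \<one>\<^bsub>S\<^esub>"
  by (rule mat_eqI) auto

lemma scal_zero: "scal \<zero> = \<zero>\<^bsub>S\<^esub>"
  by (rule mat_eqI) auto

lemma scal_add:
  "c \<in> carrier R \<Longrightarrow> d \<in> carrier R \<Longrightarrow> scal (c \<oplus> d) = scal c \<oplus>\<^bsub>S\<^esub> scal d"
  by (rule mat_eqI) auto

lemma scal_minus:
  "c \<in> carrier R \<Longrightarrow> d \<in> carrier R \<Longrightarrow> scal (c \<ominus> d) = scal c \<ominus>\<^bsub>S\<^esub> scal d"
  by (rule mat_eqI) (auto simp: a_minus_def)

lemma scal_mult:
  "c \<in> carrier R \<Longrightarrow> d \<in> carrier R \<Longrightarrow> scal (c \<otimes> d) = scal c \<otimes>\<^bsub>S\<^esub> scal d"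
  by (rule mat_eqI) auto

lemma scal_pow: "c \<in> carrier R \<Longrightarrow> scal (c [^] k) = scal c [^]\<^bsub>S\<^esub> (k::nat)"
  by (induction k) (auto simp: scal_one scal_mult)

lemma scal_add_pow: "c \<in> carrier R \<Longrightarrow> scal ([k] \<cdot> c) = [(k::nat)] \<cdot>\<^bsub>S\<^esub> scal c"
  by (induction k) (auto simp: scal_zero scal_add)

lemma scal_unit:
  assumes "c \<in> Units R"
  shows "scal c \<in> Units S"
proof -
  have c: "c \<in> carrier R" "inv c \<in> carrier R"
    using assms by (simp_all add: Units_closed)
  have "scal c \<otimes>\<^bsub>S\<^esub> scal (inv c) = scal (c \<otimes> inv c)"
    "scal (inv c) \<otimes>\<^bsub>S\<^esub> scal c = scal (inv c \<otimes> c)"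
    by (rule scal_mult [OF c, symmetric], rule scal_mult [OF c(2,1), symmetric])
  then show ?thesis
    by (intro mat.UnitsI [OF scal_closed [OF c(1)] scal_closed [OF c(2)]])
      (simp_all only: Units_r_inv [OF assms] Units_l_inv [OF assms] scal_one)
qed

lemma scal_inj:
  assumes "n > 0" "scal c = scal d"
  shows "c = d"
  using assms by (metis scal_entry)

lemma matset_iff: "A \<in> matset K \<longleftrightarrow> A \<in> carrier S \<and> (\<forall>i<n. \<forall>j<n. A $$ (i, j) \<in> K)"
  by (simp add: matset_def)

lemma matset_ideal:
  assumes "ideal K R"
  shows "ideal (matset K) S"
proof -
  interpret K: ideal K R by fact
  show ?thesis
  proof (rule idealI [OF ring_matrix_ring])
    show "subgroup (matset K) (add_monoid S)"
    proof (rule mat.add.subgroupI)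
      fix A assume A: "A \<in> matset K"
      then show "\<ominus>\<^bsub>S\<^esub> A \<in> matset K"
        by (auto simp: matset_iff)
      fix B assume "B \<in> matset K"
      with A show "A \<oplus>\<^bsub>S\<^esub> B \<in> matset K"
        by (auto simp: matset_iff)
    next
      have "\<zero>\<^bsub>S\<^esub> \<in> matset K" by (auto simp: matset_iff)
      then show "matset K \<noteq> {}" by blast
    qed (auto simp: matset_iff)
  next
    fix A Y assume AY: "A \<in> matset K" "Y \<in> carrier S"
    then show "Y \<otimes>\<^bsub>S\<^esub> A \<in> matset K"
      by (auto simp: matset_iff mult_entry intro!: K.finsum_mem K.I_l_closed)
    show "A \<otimes>\<^bsub>S\<^esub> Y \<in> matset K"
      using AY by (auto simp: matset_iff mult_entry intro!: K.finsum_mem K.I_r_closed)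
  qed
qed

end

section \<open>The Jacobson radical of a local ring and of its matrix ring\<close>

lemma (in ring) quasiregular_ideal_subset_jacobson:
  assumes "ideal I R" and unit: "\<And>x. x \<in> I \<Longrightarrow> \<one> \<ominus> x \<in> Units R"
  shows "I \<subseteq> jacobson_radical R"
proof -
  interpret I: ideal I R by fact
  have "x \<in> K" if x: "x \<in> I" and K: "maximal_left_ideal K R" for x K
  proof (rule ccontr)
    assume "x \<notin> K"
    have addK: "additive_subgroup K R"
      and multK: "\<And>y a. y \<in> carrier R \<Longrightarrow> a \<in> K \<Longrightarrow> y \<otimes> a \<in> K"
      and neqK: "K \<noteq> carrier R"
      and maxK: "\<And>L. left_ideal L R \<Longrightarrow> K \<subseteq> L \<Longrightarrow> L = K \<or> L = carrier R"
      using K by (auto simp: maximal_left_ideal_def left_ideal_def)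
    interpret K: additive_subgroup K R by fact
    have K_sub: "K \<subseteq> carrier R" by (rule K.a_subset)
    have mem: "y \<in> K <+>\<^bsub>R\<^esub> I \<longleftrightarrow> (\<exists>k\<in>K. \<exists>i\<in>I. y = k \<oplus> i)" for y
      by (simp add: set_add_def')
    \<comment> \<open>With x outside K, maximality forces K + I to be the whole ring; writing 1 = k
      + i exhibits a unit k = 1 - i inside K.\<close>
    have "left_ideal (K <+>\<^bsub>R\<^esub> I) R"
      unfolding left_ideal_def
    proof (intro conjI ballI)
      show "additive_subgroup (K <+>\<^bsub>R\<^esub> I) R"
        by (intro add_additive_subgroups addK I.additive_subgroup_axioms)
      fix y a assume y: "y \<in> carrier R" and "a \<in> K <+>\<^bsub>R\<^esub> I"
      then obtain k i where "k \<in> K" "i \<in> I" "a = k \<oplus> i"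
        using mem by blast
      then have "y \<otimes> a = y \<otimes> k \<oplus> y \<otimes> i" "y \<otimes> k \<in> K" "y \<otimes> i \<in> I"
        using y K_sub I.Icarr by (auto simp: r_distr intro: multK I.I_l_closed)
      then show "y \<otimes> a \<in> K <+>\<^bsub>R\<^esub> I"
        unfolding mem by blast
    qed
    moreover have "K \<subseteq> K <+>\<^bsub>R\<^esub> I"
    proof
      fix k assume "k \<in> K"
      then show "k \<in> K <+>\<^bsub>R\<^esub> I"
        unfolding mem using K_sub I.zero_closed by (metis r_zero subsetD)
    qed
    moreover have "x \<in> K <+>\<^bsub>R\<^esub> I"
      unfolding mem using x I.Icarr K.zero_closed by (metis l_zero)
    ultimately have "\<one> \<in> K <+>\<^bsub>R\<^esub> I"
      using maxK [of "K <+>\<^bsub>R\<^esub> I"] \<open>x \<notin> K\<close> by auto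
    then obtain k i where ki: "k \<in> K" "i \<in> I" "\<one> = k \<oplus> i"
      using mem by blast
    have kc: "k \<in> carrier R" and ic: "i \<in> carrier R"
      using ki K_sub I.Icarr by auto
    have "k = \<one> \<ominus> i"
      using kc ic by (subst ki(3)) (simp add: a_minus_def a_assoc r_neg)
    then have k: "k \<in> Units R"
      using unit ki(2) by simp
    have "y \<in> K" if y: "y \<in> carrier R" for y
      using multK [of "y \<otimes> inv k" k] y k ki(1) kc by (simp add: m_assoc)
    then show False
      using neqK K_sub by auto
  qed
  then show ?thesis
    using I.Icarr by (auto simp: jacobson_radical_def)
qed

lemma (in cring) ideal_left_ideal: "ideal I R \<Longrightarrow> left_ideal I R"
  by (auto simp: left_ideal_def ideal.axioms intro: ideal.I_l_closed)

text \<open>Requiring the nonunits to form an ideal also excludes the zero ring: there the set of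
  nonunits is empty, hence not an ideal.\<close>

locale local_ring = cring +
  assumes nonunits: "ideal (carrier R - Units R) R"
begin

abbreviation M where "M \<equiv> carrier R - Units R"

sublocale M: ideal M R
  by (rule nonunits)

text \<open>As a simplification rule, membership in the carrier would loop through \<open>M = carrier R - Units R\<close>.\<close>

declare M.a_Hcarr [simp del]

lemma one_minus_unit:
  assumes "x \<in> M"
  shows "\<one> \<ominus> x \<in> Units R"
proof (rule ccontr)
  assume "\<one> \<ominus> x \<notin> Units R"
  with assms have "(\<one> \<ominus> x) \<oplus> x \<in> M"
    by (intro M.a_closed) auto
  moreover have "(\<one> \<ominus> x) \<oplus> x = \<one>"
    using assms by (simp add: a_minus_def a_assoc l_neg)
  ultimately show False by simp
qed

lemma unit_cong:
  assumes "u \<in> Units R" "v \<in> carrier R" "u \<ominus> v \<in> M"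
  shows "v \<in> Units R"
proof (rule ccontr)
  assume "v \<notin> Units R"
  with assms have "(u \<ominus> v) \<oplus> v \<in> M"
    by (intro M.a_closed) auto
  moreover have "(u \<ominus> v) \<oplus> v = u"
    using assms by (simp add: a_minus_def a_assoc l_neg Units_closed)
  ultimately show False using assms by simp
qed

lemma jacobson_radical_eq: "jacobson_radical R = M"
proof
  show "M \<subseteq> jacobson_radical R"
    by (intro quasiregular_ideal_subset_jacobson nonunits one_minus_unit)
  have "maximal_left_ideal M R"
    unfolding maximal_left_ideal_def
  proof (intro conjI allI impI)
    show "left_ideal M R"
      by (rule ideal_left_ideal [OF nonunits])
    show "M \<noteq> carrier R"
      by (metis DiffD2 Units_one_closed one_closed)
    fix K assume "left_ideal K R \<and> M \<subseteq> K"
    then have K: "additive_subgroup K R" "\<And>y a. y \<in> carrier R \<Longrightarrow> a \<in> K \<Longrightarrow> y \<otimes> a \<in> K" "M \<subseteq> K"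
      by (auto simp: left_ideal_def)
    have K_sub: "K \<subseteq> carrier R"
      by (rule additive_subgroup.a_subset [OF K(1)])
    show "K = M \<or> K = carrier R"
    proof (cases "K \<subseteq> M")
      case False
      then obtain k where k: "k \<in> K" "k \<in> Units R"
        using K_sub by auto
      have "y \<in> K" if y: "y \<in> carrier R" for y
        using K(2) [of "y \<otimes> inv k" k] y k by (simp add: m_assoc Units_closed)
      then show ?thesis using K_sub by auto
    qed (use K in auto)
  qed
  then show "jacobson_radical R \<subseteq> M"
    by (auto simp: jacobson_radical_def)
qed

end

locale comm_matrices = cring R + matrices R n for R (structure) and n
begin

lemma scal_comm:
  "c \<in> carrier R \<Longrightarrow> A \<in> carrier S \<Longrightarrow> scal c \<otimes>\<^bsub>S\<^esub> A = A \<otimes>\<^bsub>S\<^esub> scal c"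
  by (rule mat_eqI) (auto simp: m_comm)

text \<open>A matrix \<open>Y\<close> supported on one column satisfies \<open>Y\<^sup>2 = y Y\<close> with \<open>y\<close> its diagonal entry.\<close>

lemma one_minus_column_unit:
  assumes Y: "Y \<in> carrier S" and k: "k < n"
    and col: "\<And>i j. i < n \<Longrightarrow> j < n \<Longrightarrow> j \<noteq> k \<Longrightarrow> Y $$ (i, j) = \<zero>"
    and unit: "\<one> \<ominus> Y $$ (k, k) \<in> Units R"
  shows "\<one>\<^bsub>S\<^esub> \<ominus>\<^bsub>S\<^esub> Y \<in> Units S"
proof -
  define y where "y = Y $$ (k, k)"
  \<comment> \<open>Since Y^2 = y Y, the product (1 - Y)(1 + c Y) is 1 + (c - 1 - c y) Y, so the
    inverse requires c (1 - y) = 1.\<close>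
  define c where "c = inv (\<one> \<ominus> y)"
  define W where "W = scal c \<otimes>\<^bsub>S\<^esub> Y"
  have y: "y \<in> carrier R" and c: "c \<in> carrier R"
    using Y k unit by (auto simp: y_def c_def)
  have W: "W \<in> carrier S"
    using Y c by (simp add: W_def)
  have cy: "c \<ominus> c \<otimes> y = \<one>"
  proof -
    have "c \<otimes> (\<one> \<ominus> y) = \<one>"
      using unit by (simp add: c_def y_def)
    then show ?thesis
      using c y by (simp add: a_minus_def r_distr r_minus)
  qed
  have YY: "(Y \<otimes>\<^bsub>S\<^esub> Y) $$ (i, j) = y \<otimes> Y $$ (i, j)" if ij: "i < n" "j < n" for i j
  proof -
    have "(Y \<otimes>\<^bsub>S\<^esub> Y) $$ (i, j) = Y $$ (i, k) \<otimes> Y $$ (k, j)"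
      unfolding mult_entry [OF ij] using ij k Y col
      by (subst finsum_delta [where i = k]) auto
    then show ?thesis
      using ij k Y col [OF ij] col [OF k, of j] by (cases "j = k") (auto simp: y_def m_comm)
  qed
  have YW: "Y \<otimes>\<^bsub>S\<^esub> W = W \<ominus>\<^bsub>S\<^esub> Y"
  proof (rule mat_eqI)
    fix i j assume ij: "i < n" "j < n"
    define z where "z = Y $$ (i, j)"
    have z: "z \<in> carrier R" using ij Y by (simp add: z_def)
    have "Y \<otimes>\<^bsub>S\<^esub> W = scal c \<otimes>\<^bsub>S\<^esub> (Y \<otimes>\<^bsub>S\<^esub> Y)"
      using c Y by (simp only: W_def scal_closed mat.m_assoc [of Y "scal c" Y, symmetric]
        scal_comm [of c Y, symmetric] mat.m_assoc [of "scal c" Y Y])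
    then have "(Y \<otimes>\<^bsub>S\<^esub> W) $$ (i, j) = c \<otimes> (y \<otimes> z)"
      using ij Y c YY by (simp add: z_def)
    also have "\<dots> = (c \<ominus> \<one>) \<otimes> z"
    proof -
      have "c \<otimes> y = c \<ominus> (c \<ominus> c \<otimes> y)"
        using c y by algebra
      then show ?thesis
        using c y z by (simp add: cy m_assoc [symmetric])
    qed
    also have "\<dots> = (W \<ominus>\<^bsub>S\<^esub> Y) $$ (i, j)"
      using ij Y W c z by (simp add: W_def z_def [symmetric] a_minus_def l_distr l_minus)
    finally show "(Y \<otimes>\<^bsub>S\<^esub> W) $$ (i, j) = (W \<ominus>\<^bsub>S\<^esub> Y) $$ (i, j)" .
  qed (use Y W in simp_all)
  have WY: "W \<otimes>\<^bsub>S\<^esub> Y = W \<ominus>\<^bsub>S\<^esub> Y"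
    using c Y unfolding YW [symmetric]
    by (simp only: W_def scal_closed mat.m_assoc [of Y "scal c" Y, symmetric]
        scal_comm [of c Y, symmetric])
  have cancel: "\<one>\<^bsub>S\<^esub> \<oplus>\<^bsub>S\<^esub> Z \<ominus>\<^bsub>S\<^esub> Z = \<one>\<^bsub>S\<^esub>" if "Z \<in> carrier S" for Z
    using that by (simp add: mat.minus_eq mat.a_assoc mat.r_neg)
  show ?thesis
  proof (rule mat.UnitsI)
    show "(\<one>\<^bsub>S\<^esub> \<ominus>\<^bsub>S\<^esub> Y) \<otimes>\<^bsub>S\<^esub> (\<one>\<^bsub>S\<^esub> \<oplus>\<^bsub>S\<^esub> W) = \<one>\<^bsub>S\<^esub>"
    proof -
      have "(\<one>\<^bsub>S\<^esub> \<ominus>\<^bsub>S\<^esub> Y) \<otimes>\<^bsub>S\<^esub> (\<one>\<^bsub>S\<^esub> \<oplus>\<^bsub>S\<^esub> W) = \<one>\<^bsub>S\<^esub> \<oplus>\<^bsub>S\<^esub> (W \<ominus>\<^bsub>S\<^esub> Y) \<ominus>\<^bsub>S\<^esub> Y \<otimes>\<^bsub>S\<^esub> W"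
        using Y W by (simp add: mat.ring_simprules)
      then show ?thesis
        using Y W cancel [of "W \<ominus>\<^bsub>S\<^esub> Y"] by (simp only: YW mat.minus_closed)
    qed
    show "(\<one>\<^bsub>S\<^esub> \<oplus>\<^bsub>S\<^esub> W) \<otimes>\<^bsub>S\<^esub> (\<one>\<^bsub>S\<^esub> \<ominus>\<^bsub>S\<^esub> Y) = \<one>\<^bsub>S\<^esub>"
    proof -
      have "(\<one>\<^bsub>S\<^esub> \<oplus>\<^bsub>S\<^esub> W) \<otimes>\<^bsub>S\<^esub> (\<one>\<^bsub>S\<^esub> \<ominus>\<^bsub>S\<^esub> Y) = \<one>\<^bsub>S\<^esub> \<oplus>\<^bsub>S\<^esub> (W \<ominus>\<^bsub>S\<^esub> Y) \<ominus>\<^bsub>S\<^esub> W \<otimes>\<^bsub>S\<^esub> Y"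
        using Y W by (simp add: mat.ring_simprules)
      then show ?thesis
        using Y W cancel [of "W \<ominus>\<^bsub>S\<^esub> Y"] by (simp only: WY mat.minus_closed)
    qed
  qed (use Y W in simp_all)
qed

text \<open>Column elimination instead of determinants, by induction on the number of leading
  columns of V that may be nonzero. If column k is split off as X2 and U is 1 minus the columns
  before it, then 1 - V = U (1 - Y) with Y = U^(-1) X2, which still has entries in K and is
  supported on column k alone.\<close>

lemma one_minus_matset_unit:
  assumes K: "ideal K R" and unit: "\<And>x. x \<in> K \<Longrightarrow> \<one> \<ominus> x \<in> Units R"
    and V: "V \<in> matset K"
  shows "\<one>\<^bsub>S\<^esub> \<ominus>\<^bsub>S\<^esub> V \<in> Units S"
proof -
  interpret K: ideal K R by fact
  interpret MK: ideal "matset K" S by (rule matset_ideal [OF K])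
  have "\<one>\<^bsub>S\<^esub> \<ominus>\<^bsub>S\<^esub> V \<in> Units S"
    if "k \<le> n" "V \<in> matset K" "\<And>i j. i < n \<Longrightarrow> j < n \<Longrightarrow> k \<le> j \<Longrightarrow> V $$ (i, j) = \<zero>" for k V
    using that
  proof (induction k arbitrary: V)
    case 0
    then have "V = \<zero>\<^bsub>S\<^esub>"
      by (intro mat_eqI) (auto simp: matset_iff)
    then show ?case
      by (simp add: mat.minus_eq)
  next
    case (Suc k)
    define X1 where "X1 = mat n n (\<lambda>(i, j). if j = k then \<zero> else V $$ (i, j))"
    define X2 where "X2 = mat n n (\<lambda>(i, j). if j = k then V $$ (i, j) else \<zero>)"
    have V: "V \<in> carrier S" and VK: "\<And>i j. i < n \<Longrightarrow> j < n \<Longrightarrow> V $$ (i, j) \<in> K" and k: "k < n"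
      using Suc.prems(1,2) by (auto simp: matset_iff)
    have X1c: "X1 \<in> carrier S" and X2c: "X2 \<in> carrier S"
      unfolding X1_def X2_def using V by (auto intro!: mat_closed)
    have X1: "X1 \<in> matset K"
      unfolding matset_iff using X1c VK K.zero_closed by (simp add: X1_def)
    have X2: "X2 \<in> matset K"
      unfolding matset_iff using X2c VK K.zero_closed by (simp add: X2_def)
    define U where "U = \<one>\<^bsub>S\<^esub> \<ominus>\<^bsub>S\<^esub> X1"
    have U: "U \<in> Units S"
      unfolding U_def
    proof (rule Suc.IH)
      fix i j assume "i < n" "j < n" "k \<le> j"
      then show "X1 $$ (i, j) = \<zero>"
        using Suc.prems(3) [of i j] by (auto simp: X1_def)
    qed (use k X1 in auto)
    define Y where "Y = inv\<^bsub>S\<^esub> U \<otimes>\<^bsub>S\<^esub> X2"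
    have Y: "Y \<in> matset K"
      unfolding Y_def using U X2 by (intro MK.I_l_closed) auto
    then have Yc: "Y \<in> carrier S"
      by (simp add: matset_iff)
    have invU: "inv\<^bsub>S\<^esub> U \<in> carrier S"
      using U by simp
    have "\<one>\<^bsub>S\<^esub> \<ominus>\<^bsub>S\<^esub> Y \<in> Units S"
    proof (rule one_minus_column_unit [OF Yc k])
      fix i j assume ij: "i < n" "j < n" "j \<noteq> k"
      show "Y $$ (i, j) = \<zero>"
        unfolding Y_def mult_entry [OF ij(1,2)] using ij invU
        by (intro add.finprod_one_eqI) (auto simp: X2_def)
    next
      show "\<one> \<ominus> Y $$ (k, k) \<in> Units R"
        using Y k by (intro unit) (auto simp: matset_iff)
    qed
    then have "U \<otimes>\<^bsub>S\<^esub> (\<one>\<^bsub>S\<^esub> \<ominus>\<^bsub>S\<^esub> Y) \<in> Units S"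
      using U by (rule mat.Units_m_closed [rotated])
    moreover have "U \<otimes>\<^bsub>S\<^esub> (\<one>\<^bsub>S\<^esub> \<ominus>\<^bsub>S\<^esub> Y) = U \<ominus>\<^bsub>S\<^esub> X2"
    proof -
      have Uc: "U \<in> carrier S" using U by (rule mat.Units_closed)
      have "U \<otimes>\<^bsub>S\<^esub> Y = X2"
        unfolding Y_def using U Uc invU X2c by (simp add: mat.m_assoc [symmetric])
      moreover have "U \<otimes>\<^bsub>S\<^esub> (\<one>\<^bsub>S\<^esub> \<ominus>\<^bsub>S\<^esub> Y) = U \<ominus>\<^bsub>S\<^esub> U \<otimes>\<^bsub>S\<^esub> Y"
        using Uc Yc by (simp add: mat.minus_eq mat.r_distr mat.r_minus)
      ultimately show ?thesis by simp
    qed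
    moreover have "U \<ominus>\<^bsub>S\<^esub> X2 = \<one>\<^bsub>S\<^esub> \<ominus>\<^bsub>S\<^esub> V"
      unfolding U_def
    proof (rule mat_eqI)
      fix i j assume ij: "i < n" "j < n"
      then show "(\<one>\<^bsub>S\<^esub> \<ominus>\<^bsub>S\<^esub> X1 \<ominus>\<^bsub>S\<^esub> X2) $$ (i, j) = (\<one>\<^bsub>S\<^esub> \<ominus>\<^bsub>S\<^esub> V) $$ (i, j)"
        using V X1c X2c entry_closed [OF V ij] by (auto simp: X1_def X2_def a_minus_def)
    qed (use V X1c X2c in simp_all)
    ultimately show ?case by simp
  qed
  from this [of n V] show ?thesis
    using V by auto
qed

end

locale local_matrices = local_ring R + comm_matrices R n for R (structure) and n
begin

sublocale MS: ideal "matset M" "matrix_ring n R"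
  by (rule matset_ideal [OF nonunits])

lemma mat_one_minus_unit: "V \<in> matset M \<Longrightarrow> \<one>\<^bsub>S\<^esub> \<ominus>\<^bsub>S\<^esub> V \<in> Units S"
  by (rule one_minus_matset_unit [OF nonunits one_minus_unit])

text \<open>A matrix outside this ideal has a unit at some position (i, j), so its left multiples
  realize every possible column j; what remains of a given V has zero column j and lies in the
  ideal. Intersecting over all j leaves exactly the matrices over \<open>M\<close>.\<close>

lemma maximal_left_ideal_column:
  assumes j: "j < n"
  shows "maximal_left_ideal {V \<in> carrier S. \<forall>i<n. V $$ (i, j) \<in> M} S" (is "maximal_left_ideal ?L S")
  unfolding maximal_left_ideal_def
proof (intro conjI allI impI)
  show "left_ideal ?L S"
    unfolding left_ideal_def
  proof (intro conjI ballI)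
    show "additive_subgroup ?L S"
    proof (rule additive_subgroup.intro, rule mat.add.subgroupI)
      have "\<zero>\<^bsub>S\<^esub> \<in> ?L"
        using j M.zero_closed by auto
      then show "?L \<noteq> {}" by blast
    next
      fix A assume A: "A \<in> ?L"
      then show "\<ominus>\<^bsub>S\<^esub> A \<in> ?L"
        using j M.a_inv_closed by auto
      fix B assume "B \<in> ?L"
      then show "A \<oplus>\<^bsub>S\<^esub> B \<in> ?L"
        using A j M.a_closed by auto
    qed auto
    fix V A assume XA: "(V :: 'a mat) \<in> carrier S" "A \<in> ?L"
    have "(V \<otimes>\<^bsub>S\<^esub> A) $$ (i, j) \<in> M" if i: "i < n" for i
      unfolding mult_entry [OF i j] using XA i j by (intro M.finsum_mem M.I_l_closed) auto
    then show "V \<otimes>\<^bsub>S\<^esub> A \<in> ?L"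
      using XA by auto
  qed
  have "\<one>\<^bsub>S\<^esub> \<notin> ?L"
    using j by auto
  then show "?L \<noteq> carrier S" by blast
next
  fix K assume "left_ideal K S \<and> ?L \<subseteq> K"
  then have "additive_subgroup K S" and multK: "\<And>Y A. Y \<in> carrier S \<Longrightarrow> A \<in> K \<Longrightarrow> Y \<otimes>\<^bsub>S\<^esub> A \<in> K"
    and LK: "?L \<subseteq> K"
    by (auto simp: left_ideal_def)
  then interpret K: additive_subgroup K S by simp
  show "K = ?L \<or> K = carrier S"
  proof (cases "K \<subseteq> ?L")
    case False
    then obtain Y i where Y: "Y \<in> K" "i < n" "Y $$ (i, j) \<in> Units R" "Y \<in> carrier S"
      using K.a_subset j by fastforce
    define y where "y = inv (Y $$ (i, j))"
    have y: "y \<in> carrier R" "y \<otimes> Y $$ (i, j) = \<one>"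
      using Y by (auto simp: y_def)
    have "V \<in> K" if V: "V \<in> carrier S" for V
    proof -
      \<comment> \<open>Column i of C is column j of V divided by the unit Y_ij, so C Y and V agree
        in column j.\<close>
      define C where "C = mat n n (\<lambda>(k, l). if l = i then V $$ (k, j) \<otimes> y else \<zero>)"
      have C: "C \<in> carrier S"
        unfolding C_def using V y j by (intro mat_closed) auto
      have CY: "(C \<otimes>\<^bsub>S\<^esub> Y) $$ (k, j) = V $$ (k, j)" if k: "k < n" for k
        unfolding mult_entry [OF k j] using V Y y k j
        by (subst finsum_delta [where i = i]) (auto simp: C_def m_assoc)
      have "C \<otimes>\<^bsub>S\<^esub> Y \<in> K"
        using C Y by (intro multK)
      moreover have "V \<ominus>\<^bsub>S\<^esub> C \<otimes>\<^bsub>S\<^esub> Y \<in> K"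
      proof (rule subsetD [OF LK])
        show "V \<ominus>\<^bsub>S\<^esub> C \<otimes>\<^bsub>S\<^esub> Y \<in> ?L"
          using V C Y j CY M.zero_closed by (auto simp: a_minus_def r_neg)
      qed
      ultimately have "(V \<ominus>\<^bsub>S\<^esub> C \<otimes>\<^bsub>S\<^esub> Y) \<oplus>\<^bsub>S\<^esub> C \<otimes>\<^bsub>S\<^esub> Y \<in> K"
        by (rule K.a_closed [rotated])
      also have "(V \<ominus>\<^bsub>S\<^esub> C \<otimes>\<^bsub>S\<^esub> Y) \<oplus>\<^bsub>S\<^esub> C \<otimes>\<^bsub>S\<^esub> Y = V"
        using V C Y by (simp add: mat.minus_eq mat.a_assoc mat.l_neg)
      finally show ?thesis .
    qed
    then show ?thesis using K.a_subset by auto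
  qed (use LK in auto)
qed

lemma jacobson_radical_mat_eq: "jacobson_radical S = matset M"
proof
  show "matset M \<subseteq> jacobson_radical S"
    by (intro mat.quasiregular_ideal_subset_jacobson MS.ideal_axioms mat_one_minus_unit)
  show "jacobson_radical S \<subseteq> matset M"
    using maximal_left_ideal_column unfolding jacobson_radical_def matset_def by blast
qed

end

section \<open>Quasinilpotent elements: geometric sums, units and conjugation\<close>

lemma (in monoid) unit_factor:
  assumes a: "a \<in> carrier G" and w: "w \<in> carrier G"
    and u: "a \<otimes> w \<in> Units G" and comm: "w \<otimes> a = a \<otimes> w"
  shows "a \<in> Units G"
proof -
  define v where "v = inv (a \<otimes> w)"
  have v: "v \<in> carrier G" and uv: "(a \<otimes> w) \<otimes> v = \<one>" and vu: "v \<otimes> (a \<otimes> w) = \<one>"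
    using u by (simp_all add: v_def)
  have r: "a \<otimes> (w \<otimes> v) = \<one>"
    using uv a w v by (simp add: m_assoc)
  have l: "(v \<otimes> w) \<otimes> a = \<one>"
    using vu a w v comm by (simp add: m_assoc)
  have "v \<otimes> w = (v \<otimes> w) \<otimes> (a \<otimes> (w \<otimes> v))"
    using r a w v by simp
  also have "\<dots> = ((v \<otimes> w) \<otimes> a) \<otimes> (w \<otimes> v)"
    using a w v by (intro m_assoc [symmetric]) auto
  also have "\<dots> = w \<otimes> v"
    using l a w v by simp
  finally show ?thesis
    using l r a w v by (intro UnitsI [of a "w \<otimes> v"]) auto
qed

context ring
begin

text \<open>The cofactor is the geometric sum 1 + y + ... + y^(k-1), built recursively as 1 + y w.
  Both orders are recorded because \<open>unit_factor\<close> asks for commuting factors.\<close>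

lemma one_minus_pow_factor:
  assumes y: "y \<in> carrier R"
  shows "\<exists>w\<in>carrier R. (\<one> \<ominus> y) \<otimes> w = \<one> \<ominus> y [^] (k::nat) \<and> w \<otimes> (\<one> \<ominus> y) = \<one> \<ominus> y [^] k"
proof (induction k)
  case 0
  show ?case
    using y by (intro bexI [of _ \<zero>]) (auto simp: minus_eq r_neg)
next
  case (Suc k)
  then obtain w where w: "w \<in> carrier R" "(\<one> \<ominus> y) \<otimes> w = \<one> \<ominus> y [^] k" "w \<otimes> (\<one> \<ominus> y) = \<one> \<ominus> y [^] k"
    by blast
  have eq: "(\<one> \<ominus> y) \<oplus> y \<otimes> (\<one> \<ominus> y [^] k) = \<one> \<ominus> y [^] Suc k"
  proof -
    have "(\<one> \<ominus> y) \<oplus> (y \<ominus> y \<otimes> y [^] k) = \<one> \<ominus> y \<otimes> y [^] k"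
      using y by (simp add: minus_eq a_assoc r_neg1)
    then show ?thesis
      unfolding nat_pow_Suc2 [OF y] using y by (simp add: minus_eq r_distr r_minus)
  qed
  show ?case
  proof (intro bexI conjI)
    have "(\<one> \<ominus> y) \<otimes> (\<one> \<oplus> y \<otimes> w) = (\<one> \<ominus> y) \<oplus> y \<otimes> ((\<one> \<ominus> y) \<otimes> w)"
    proof -
      have "(\<one> \<ominus> y) \<otimes> y = y \<otimes> (\<one> \<ominus> y)"
        using y by (simp add: minus_eq r_distr l_distr r_minus l_minus)
      then show ?thesis
        using y w(1) by (simp add: r_distr m_assoc [symmetric])
    qed
    then show "(\<one> \<ominus> y) \<otimes> (\<one> \<oplus> y \<otimes> w) = \<one> \<ominus> y [^] Suc k"
      by (simp only: w(2) eq)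
    have "(\<one> \<oplus> y \<otimes> w) \<otimes> (\<one> \<ominus> y) = (\<one> \<ominus> y) \<oplus> y \<otimes> (w \<otimes> (\<one> \<ominus> y))"
      using y w(1) by (simp add: l_distr m_assoc)
    then show "(\<one> \<oplus> y \<otimes> w) \<otimes> (\<one> \<ominus> y) = \<one> \<ominus> y [^] Suc k"
      by (simp only: w(3) eq)
    show "\<one> \<oplus> y \<otimes> w \<in> carrier R"
      using y w by simp
  qed
qed

lemma one_minus_unit_of_pow:
  assumes "y \<in> carrier R" "\<one> \<ominus> y [^] (k::nat) \<in> Units R"
  shows "\<one> \<ominus> y \<in> Units R"
  using one_minus_pow_factor [of y k] unit_factor [of "\<one> \<ominus> y"] assms by force

text \<open>For x commuting with q, (x q)^k = x^k q^k lies in I, so 1 - (x q)^k is a unit, and with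
  it its factor 1 - x q.\<close>

lemma quasinilpotentI:
  assumes unit: "\<And>x. x \<in> I \<Longrightarrow> \<one> \<ominus> x \<in> Units R"
    and I: "ideal I R" and q: "q \<in> carrier R" "q [^] (k::nat) \<in> I"
  shows "q \<in> quasinilpotents R"
  unfolding quasinilpotents_def
proof (intro CollectI conjI ballI impI)
  fix x assume x: "x \<in> carrier R" "x \<otimes> q = q \<otimes> x"
  have "(x \<otimes> q) [^] k = x [^] k \<otimes> q [^] k"
    using x q by (intro pow_mult_distrib) auto
  then have "(x \<otimes> q) [^] k \<in> I"
    using x(1) q ideal.I_l_closed [OF I] by simp
  then have "\<one> \<ominus> (x \<otimes> q) [^] k \<in> Units R"
    by (rule unit)
  with m_closed [OF x(1) q(1)] show "\<one> \<ominus> x \<otimes> q \<in> Units R"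
    by (rule one_minus_unit_of_pow)
qed (use q in auto)

text \<open>The inverse of q commutes with q, and taking it for x gives 1 - x q = 0.\<close>

lemma quasinilpotent_not_unit:
  assumes "q \<in> quasinilpotents R" "q \<in> Units R"
  shows "\<one> = \<zero>"
proof -
  have "inv q \<otimes> q = q \<otimes> inv q" "inv q \<in> carrier R"
    using assms by simp_all
  then have "\<one> \<ominus> inv q \<otimes> q \<in> Units R"
    using assms unfolding quasinilpotents_def by blast
  then have "\<zero> \<in> Units R"
    using assms by (simp add: minus_eq r_neg)
  then show ?thesis
    by (metis Units_closed Units_inv_closed Units_l_inv r_null)
qed

lemma conj_minus:
  assumes "P \<in> carrier R" "Q \<in> carrier R" "x \<in> carrier R" "y \<in> carrier R"
  shows "P \<otimes> (x \<ominus> y) \<otimes> Q = P \<otimes> x \<otimes> Q \<ominus> P \<otimes> y \<otimes> Q"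
  using assms by (simp add: minus_eq r_distr l_distr r_minus l_minus)

lemma conj_mult:
  assumes P: "P \<in> Units R" and xy: "x \<in> carrier R" "y \<in> carrier R"
  shows "P \<otimes> x \<otimes> inv P \<otimes> (P \<otimes> y \<otimes> inv P) = P \<otimes> (x \<otimes> y) \<otimes> inv P"
proof -
  have c: "P \<in> carrier R" "inv P \<in> carrier R"
    using P by auto
  have "P \<otimes> x \<otimes> inv P \<otimes> (P \<otimes> y \<otimes> inv P) = P \<otimes> x \<otimes> ((inv P \<otimes> P) \<otimes> (y \<otimes> inv P))"
    using c xy by (simp only: m_assoc m_closed)
  then show ?thesis
    using c xy P by (simp add: m_assoc)
qed

lemma conj_inv_conj:
  assumes P: "P \<in> Units R" and x: "x \<in> carrier R"
  shows "inv P \<otimes> (P \<otimes> x \<otimes> inv P) \<otimes> P = x"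
proof -
  have c: "P \<in> carrier R" "inv P \<in> carrier R"
    using P by auto
  have "inv P \<otimes> (P \<otimes> x \<otimes> inv P) \<otimes> P = (inv P \<otimes> P) \<otimes> (x \<otimes> (inv P \<otimes> P))"
    using c x by (simp only: m_assoc m_closed)
  then show ?thesis
    using P x by simp
qed

lemma conj_unit:
  assumes "P \<in> Units R" "u \<in> Units R"
  shows "P \<otimes> u \<otimes> inv P \<in> Units R"
  using assms by simp

lemma conj_torsion:
  assumes P: "P \<in> Units R" and u: "u \<in> torsion_units R"
  shows "P \<otimes> u \<otimes> inv P \<in> torsion_units R"
proof -
  obtain m :: nat where m: "m \<ge> 1" "u [^] m = \<one>" and uU: "u \<in> Units R"
    using u by (auto simp: torsion_units_def)
  have "(P \<otimes> u \<otimes> inv P) [^] k = P \<otimes> u [^] k \<otimes> inv P" for k :: nat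
    using P uU by (induction k) (auto simp: conj_mult Units_closed)
  then have "(P \<otimes> u \<otimes> inv P) [^] m = \<one>"
    using m P by (simp add: Units_closed)
  then show ?thesis
    using m P uU conj_unit unfolding torsion_units_def by blast
qed

lemma conj_quasinilpotent:
  assumes P: "P \<in> Units R" and q: "q \<in> quasinilpotents R"
  shows "P \<otimes> q \<otimes> inv P \<in> quasinilpotents R"
  unfolding quasinilpotents_def
proof (intro CollectI conjI ballI impI)
  have qc: "q \<in> carrier R"
    using q by (simp add: quasinilpotents_def)
  have c: "P \<in> carrier R" "inv P \<in> carrier R"
    using P by auto
  show "P \<otimes> q \<otimes> inv P \<in> carrier R"
    using c qc by simp
  fix x assume x: "x \<in> carrier R" and comm: "x \<otimes> (P \<otimes> q \<otimes> inv P) = P \<otimes> q \<otimes> inv P \<otimes> x"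
  define y where "y = inv P \<otimes> x \<otimes> P"
  have y: "y \<in> carrier R"
    using c x by (simp add: y_def)
  have x_eq: "x = P \<otimes> y \<otimes> inv P"
    using conj_inv_conj [of "inv P" x] P x by (simp add: y_def)
  have "inv P \<otimes> (P \<otimes> (y \<otimes> q) \<otimes> inv P) \<otimes> P = inv P \<otimes> (P \<otimes> (q \<otimes> y) \<otimes> inv P) \<otimes> P"
    using comm P y qc by (simp add: x_eq conj_mult)
  then have "y \<otimes> q = q \<otimes> y"
    using P y qc by (simp only: conj_inv_conj m_closed)
  then have "\<one> \<ominus> y \<otimes> q \<in> Units R"
    using q y by (simp add: quasinilpotents_def)
  then have "P \<otimes> (\<one> \<ominus> y \<otimes> q) \<otimes> inv P \<in> Units R"
    using P by simp
  then show "\<one> \<ominus> x \<otimes> (P \<otimes> q \<otimes> inv P) \<in> Units R"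
    using P y qc c by (simp add: conj_minus conj_mult x_eq)
qed

end

section \<open>Torsion matrices: finite subrings and triangular matrices\<close>

lemma (in comm_monoid) finite_submonoid:
  assumes "finite B" "B \<subseteq> carrier G" "\<And>b. b \<in> B \<Longrightarrow> \<exists>m::nat. m \<ge> 1 \<and> b [^] m = \<one>"
  shows "\<exists>H. finite H \<and> submonoid H G \<and> B \<subseteq> H \<and> (\<forall>K. submonoid K G \<longrightarrow> B \<subseteq> K \<longrightarrow> H \<subseteq> K)"
  using assms
proof (induction B rule: finite_induct)
  case empty
  have "submonoid {\<one>} G"
    by unfold_locales auto
  then show ?case
    by (intro exI [of _ "{\<one>}"]) (auto dest: submonoid.one_closed)
next
  case (insert b B)
  then obtain H where H: "finite H" "submonoid H G" "B \<subseteq> H"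
    "\<And>K. submonoid K G \<Longrightarrow> B \<subseteq> K \<Longrightarrow> H \<subseteq> K"
    by (metis insertCI insert_subset)
  obtain m :: nat where m: "m \<ge> 1" "b [^] m = \<one>"
    using insert.prems by blast
  have b: "b \<in> carrier G"
    using insert.prems by simp
  interpret H: submonoid H G by fact
  have pow: "b [^] k = b [^] (k mod m)" for k
  proof -
    have "b [^] k = (b [^] m) [^] (k div m) \<otimes> b [^] (k mod m)"
      using b by (simp add: nat_pow_pow nat_pow_mult)
    then show ?thesis
      using b m by simp
  qed
  \<comment> \<open>L is H with b adjoined; since b^m = 1, exponents below m suffice and finiteness
    survives.\<close>
  define L where "L = (\<lambda>(h, k). h \<otimes> b [^] k) ` (H \<times> {..<m})"
  have L: "h \<otimes> b [^] k \<in> L" if "h \<in> H" for h and k :: nat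
    unfolding L_def using that m pow [of k] by (intro image_eqI [of _ _ "(h, k mod m)"]) auto
  have "submonoid L G"
  proof
    show "L \<subseteq> carrier G"
      using b H.mem_carrier by (auto simp: L_def)
    show "\<one> \<in> L"
      using L [of \<one> 0] H.one_closed by simp
    fix x y assume "x \<in> L" "y \<in> L"
    then obtain h h' and k k' :: nat
      where hk: "h \<in> H" "h' \<in> H" "x = h \<otimes> b [^] k" "y = h' \<otimes> b [^] k'"
      by (auto simp: L_def)
    then have "x \<otimes> y = (h \<otimes> h') \<otimes> b [^] (k + k')"
      using b H.mem_carrier by (simp add: nat_pow_mult [symmetric] m_ac)
    then show "x \<otimes> y \<in> L"
      using L hk by auto
  qed
  moreover have "finite L"
    using H by (simp add: L_def)
  moreover have "insert b B \<subseteq> L"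
  proof -
    have "x \<in> L" if "x \<in> B" for x
      using L [of x 0] that H(3) H.mem_carrier by auto
    then show ?thesis
      using L [of \<one> 1] b H.one_closed by auto
  qed
  moreover have "L \<subseteq> K" if K: "submonoid K G" "insert b B \<subseteq> K" for K
  proof -
    interpret K: submonoid K G by fact
    have "b [^] k \<in> K" for k :: nat
      using K by (induction k) auto
    moreover have "H \<subseteq> K"
      using K H by auto
    ultimately show ?thesis
      by (auto simp: L_def)
  qed
  ultimately show ?case by blast
qed

text \<open>Two applications of \<open>finite_submonoid\<close>: the multiplicative monoid G
  generated by B is finite, and so is the additive monoid H generated by G, because p kills every
  element. Closure of H under products is not visible from this; it comes from the minimality of H
  among additive submonoids containing G.\<close>

lemma (in cring) finite_subring_of_torsion:
  assumes char: "p > 0" "[(p::nat)] \<cdot> \<one> = \<zero>"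
    and B: "finite B" "B \<subseteq> carrier R" "\<And>b. b \<in> B \<Longrightarrow> \<exists>m::nat. m \<ge> 1 \<and> b [^] m = \<one>"
  shows "\<exists>H. finite H \<and> H \<subseteq> carrier R \<and> B \<subseteq> H \<and> \<zero> \<in> H \<and> \<one> \<in> H \<and>
    (\<forall>x\<in>H. \<forall>y\<in>H. x \<oplus> y \<in> H \<and> x \<otimes> y \<in> H)"
proof -
  obtain G where G: "finite G" "submonoid G R" "B \<subseteq> G"
    using finite_submonoid [OF B] by blast
  interpret G: submonoid G R by fact
  have "\<exists>m::nat. m \<ge> 1 \<and> [m] \<cdot> g = \<zero>" if "g \<in> G" for g
  proof -
    have "[p] \<cdot> g = ([p] \<cdot> \<one>) \<otimes> g"
      using that G.mem_carrier add_pow_ldistr [of \<one> g p] by simp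
    then show ?thesis
      using char that G.mem_carrier by (intro exI [of _ p]) simp
  qed
  then obtain H where H: "finite H" "submonoid H (add_monoid R)" "G \<subseteq> H"
    "\<And>K. submonoid K (add_monoid R) \<Longrightarrow> G \<subseteq> K \<Longrightarrow> H \<subseteq> K"
    using add.finite_submonoid [OF G(1) G.subset] by auto
  have H_sub: "H \<subseteq> carrier R" and H_add: "\<And>x y. x \<in> H \<Longrightarrow> y \<in> H \<Longrightarrow> x \<oplus> y \<in> H" and H_zero: "\<zero> \<in> H"
    using submonoid.subset [OF H(2)] submonoid.m_closed [OF H(2)] submonoid.one_closed [OF H(2)]
    by auto
  \<comment> \<open>Minimality of H is applied to these additive submonoids twice: for y in G it
    shows that H y stays inside H, and this in turn yields the same for y in H.\<close>
  have sub: "submonoid {x \<in> carrier R. x \<otimes> y \<in> H} (add_monoid R)" if "y \<in> carrier R" for y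
    using that H_zero H_add by unfold_locales (auto simp: l_distr)
  have hg: "h \<otimes> g \<in> H" if "h \<in> H" "g \<in> G" for h g
    using H(4) [OF sub [of g]] that G.subset H(3) G.m_closed by blast
  have HG: "H \<subseteq> {x \<in> carrier R. x \<otimes> h \<in> H}" if "h \<in> H" for h
  proof (rule H(4) [OF sub])
    show "h \<in> carrier R"
      using that H_sub by blast
    then show "G \<subseteq> {x \<in> carrier R. x \<otimes> h \<in> H}"
      using hg [OF that] G.subset m_comm by auto
  qed
  have H_mult: "x \<otimes> y \<in> H" if "x \<in> H" "y \<in> H" for x y
    using HG [OF that(2)] that(1) by blast
  have "B \<subseteq> H" "\<one> \<in> H"
    using G(3) H(3) G.one_closed by auto
  then show ?thesis
    using H(1) H_sub H_zero H_add H_mult by (intro exI [of _ H] conjI ballI)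
qed

context matrices
begin

text \<open>All powers of U have entries in H, so there are finitely many of them; two coincide, and
  the smaller power cancels because U is a unit.\<close>

lemma torsion_of_finite_entries:
  assumes H: "finite H" "H \<subseteq> carrier R" "\<zero> \<in> H" "\<one> \<in> H"
    "\<And>x y. x \<in> H \<Longrightarrow> y \<in> H \<Longrightarrow> x \<oplus> y \<in> H" "\<And>x y. x \<in> H \<Longrightarrow> y \<in> H \<Longrightarrow> x \<otimes> y \<in> H"
    and U: "U \<in> Units S" "\<And>i j. i < n \<Longrightarrow> j < n \<Longrightarrow> U $$ (i, j) \<in> H"
  shows "U \<in> torsion_units S"
proof -
  have sum: "(\<Oplus>k\<in>A. f k) \<in> H" if "finite A" "\<And>k. k \<in> A \<Longrightarrow> f k \<in> H" for f and A :: "nat set"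
    using that
  proof (induction A rule: finite_induct)
    case (insert a A)
    then show ?case
      using H by (subst finsum_insert) auto
  qed (use H in auto)
  have Uc: "U \<in> carrier S"
    using U by auto
  have entries: "(U [^]\<^bsub>S\<^esub> k) $$ (i, j) \<in> H" if "i < n" "j < n" for i j and k :: nat
    using that
  proof (induction k arbitrary: i j)
    case (Suc k)
    have "(\<Oplus>l\<in>{..<n}. (U [^]\<^bsub>S\<^esub> k) $$ (i, l) \<otimes> U $$ (l, j)) \<in> H"
      using Suc U H by (intro sum) auto
    then show ?case
      using Suc.prems by (simp add: mult_entry)
  qed (use H in auto)
  have "range (\<lambda>k::nat. U [^]\<^bsub>S\<^esub> k) \<subseteq> mat n n ` (({..<n} \<times> {..<n}) \<rightarrow>\<^sub>E H)"
  proof clarify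
    fix k :: nat
    define f where "f = restrict (\<lambda>ij. (U [^]\<^bsub>S\<^esub> k) $$ ij) ({..<n} \<times> {..<n})"
    have "f \<in> ({..<n} \<times> {..<n}) \<rightarrow>\<^sub>E H"
      using entries by (auto simp: f_def)
    moreover have "U [^]\<^bsub>S\<^esub> k = mat n n f"
    proof (rule mat_eqI)
      show "mat n n f \<in> carrier S"
        using Uc by (intro mat_closed) (simp add: f_def)
    qed (use Uc in \<open>auto simp: f_def\<close>)
    ultimately show "U [^]\<^bsub>S\<^esub> k \<in> mat n n ` (({..<n} \<times> {..<n}) \<rightarrow>\<^sub>E H)"
      by blast
  qed
  then have "finite (range (\<lambda>k::nat. U [^]\<^bsub>S\<^esub> k))"
    by (rule finite_subset) (intro finite_imageI finite_PiE finite_cartesian_product finite_lessThan H)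
  then have "\<not> inj (\<lambda>k::nat. U [^]\<^bsub>S\<^esub> k)"
    using finite_imageD infinite_UNIV_nat by blast
  then obtain i j :: nat where ij: "i < j" "U [^]\<^bsub>S\<^esub> i = U [^]\<^bsub>S\<^esub> j"
    unfolding inj_def by (metis linorder_neqE_nat)
  have "U [^]\<^bsub>S\<^esub> i \<otimes>\<^bsub>S\<^esub> U [^]\<^bsub>S\<^esub> (j - i) = U [^]\<^bsub>S\<^esub> i \<otimes>\<^bsub>S\<^esub> \<one>\<^bsub>S\<^esub>"
    using ij Uc mat.nat_pow_mult [OF Uc, of i "j - i"] by simp
  then have "U [^]\<^bsub>S\<^esub> (j - i) = \<one>\<^bsub>S\<^esub>"
    using mat.Units_l_cancel [OF mat.Units_pow_closed [OF U(1)]] Uc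
      mat.nat_pow_closed [OF Uc] mat.one_closed by blast
  then show ?thesis
    using ij U(1) unfolding torsion_units_def by (intro CollectI conjI exI [of _ "j - i"]) auto
qed

text \<open>The level function \<open>f\<close> allows lower as well as upper triangular matrices.\<close>

lemma triangular_pow_mem:
  assumes K: "ideal K R" and V: "V \<in> carrier S" and f: "\<And>i. i < n \<Longrightarrow> f i < n"
    and tri: "\<And>i j. i < n \<Longrightarrow> j < n \<Longrightarrow> \<not> f j < f i \<Longrightarrow> V $$ (i, j) \<in> K"
  shows "V [^]\<^bsub>S\<^esub> n \<in> matset K"
proof -
  interpret K: ideal K R by fact
  \<comment> \<open>Modulo K each factor V lowers the level \<open>f\<close> by at least 1, so entry
    (i, j) of V^k can survive only if f j + k <= f i. For k = n this is excluded by f i < n.\<close>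
  have "(V [^]\<^bsub>S\<^esub> k) $$ (i, j) \<in> K" if "i < n" "j < n" "\<not> f j + k \<le> f i" for i j k
    using that
  proof (induction k arbitrary: i j)
    case 0
    then show ?case using K.zero_closed by auto
  next
    case (Suc k)
    have "(\<Oplus>l\<in>{..<n}. (V [^]\<^bsub>S\<^esub> k) $$ (i, l) \<otimes> V $$ (l, j)) \<in> K"
    proof (rule K.finsum_mem)
      fix l assume l: "l \<in> {..<n}"
      show "(V [^]\<^bsub>S\<^esub> k) $$ (i, l) \<otimes> V $$ (l, j) \<in> K"
      proof (cases "f l + k \<le> f i")
        case True
        then have "V $$ (l, j) \<in> K"
          using Suc.prems l by (intro tri) auto
        then show ?thesis
          using V l Suc.prems by (intro K.I_l_closed) auto
      next
        case False
        then have "(V [^]\<^bsub>S\<^esub> k) $$ (i, l) \<in> K"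
          using Suc.prems l by (intro Suc.IH) auto
        then show ?thesis
          using V l Suc.prems by (intro K.I_r_closed) auto
      qed
    qed simp
    then show ?case
      using Suc.prems by (simp add: mult_entry)
  qed
  moreover have "\<not> f j + n \<le> f i" if "i < n" for i j
    using f [OF that] by simp
  ultimately show ?thesis
    using V by (auto simp: matset_iff)
qed

text \<open>With D the diagonal of U and E its inverse, E U = 1 - N where N is strictly upper
  triangular, hence nilpotent, so 1 - N is a unit by the geometric sum.\<close>

lemma upper_triangular_unit:
  assumes U: "U \<in> carrier S" and tri: "\<And>i j. i < n \<Longrightarrow> j < n \<Longrightarrow> j < i \<Longrightarrow> U $$ (i, j) = \<zero>"
    and diag: "\<And>i. i < n \<Longrightarrow> U $$ (i, i) \<in> Units R"
  shows "U \<in> Units S"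
proof -
  define D where "D = mat n n (\<lambda>(i, j). if i = j then U $$ (i, i) else \<zero>)"
  define E where "E = mat n n (\<lambda>(i, j). if i = j then inv (U $$ (i, i)) else \<zero>)"
  have D: "D \<in> carrier S" and E: "E \<in> carrier S"
    unfolding D_def E_def using U diag by (auto intro!: mat_closed)
  have D_mult: "(D \<otimes>\<^bsub>S\<^esub> V) $$ (i, j) = U $$ (i, i) \<otimes> V $$ (i, j)"
    if "V \<in> carrier S" and ij: "i < n" "j < n" for V i j
    unfolding mult_entry [OF ij] using that U by (subst finsum_delta [where i = i]) (auto simp: D_def)
  have E_mult: "(E \<otimes>\<^bsub>S\<^esub> V) $$ (i, j) = inv (U $$ (i, i)) \<otimes> V $$ (i, j)"
    if "V \<in> carrier S" and ij: "i < n" "j < n" for V i j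
    unfolding mult_entry [OF ij] using that diag by (subst finsum_delta [where i = i]) (auto simp: E_def)
  have DE: "D \<otimes>\<^bsub>S\<^esub> E = \<one>\<^bsub>S\<^esub>"
    using D E U diag by (intro mat_eqI) (auto simp: D_mult, auto simp: E_def)
  have ED: "E \<otimes>\<^bsub>S\<^esub> D = \<one>\<^bsub>S\<^esub>"
    using D E U diag by (intro mat_eqI) (auto simp: E_mult, auto simp: D_def)
  have DU: "D \<in> Units S"
    using D E DE ED by (rule mat.UnitsI)
  define N where "N = \<one>\<^bsub>S\<^esub> \<ominus>\<^bsub>S\<^esub> E \<otimes>\<^bsub>S\<^esub> U"
  have N: "N \<in> carrier S"
    using E U by (simp add: N_def)
  have "N [^]\<^bsub>S\<^esub> n \<in> matset {\<zero>}"
  \<comment> \<open>Reversing the indices turns a strictly upper triangular matrix into one with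
    falling levels; over the zero ideal this is genuine nilpotence.\<close>
  proof (rule triangular_pow_mem [OF zeroideal N, where f = "\<lambda>i. n - 1 - i"])
    fix i j assume ij: "i < n" "j < n" "\<not> n - 1 - j < n - 1 - i"
    then have "j \<le> i" by auto
    then show "N $$ (i, j) \<in> {\<zero>}"
      using ij U E diag tri [of i j] by (cases "i = j") (auto simp: N_def E_mult minus_eq r_neg)
  qed auto
  then have "N [^]\<^bsub>S\<^esub> n = \<zero>\<^bsub>S\<^esub>"
    using N by (intro mat_eqI) (auto simp: matset_iff)
  then have "\<one>\<^bsub>S\<^esub> \<ominus>\<^bsub>S\<^esub> N \<in> Units S"
    using N by (intro mat.one_minus_unit_of_pow [of N n]) (auto simp: mat.minus_eq)
  moreover have "\<one>\<^bsub>S\<^esub> \<ominus>\<^bsub>S\<^esub> N = E \<otimes>\<^bsub>S\<^esub> U"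
    unfolding N_def using E U by (simp add: mat.minus_eq mat.minus_add mat.r_neg2 mat.a_assoc [symmetric] mat.r_neg)
  ultimately have "D \<otimes>\<^bsub>S\<^esub> (E \<otimes>\<^bsub>S\<^esub> U) \<in> Units S"
    using DU by simp
  then show ?thesis
    using D E U DE by (simp add: mat.m_assoc [symmetric])
qed

end

section \<open>Conjugating a matrix to one with units on the diagonal\<close>

lemma (in monoid) inv_mult_Units:
  assumes x: "x \<in> Units G" and y: "y \<in> Units G"
  shows "inv (x \<otimes> y) = inv y \<otimes> inv x"
proof (rule inv_char)
  have c: "x \<in> carrier G" "y \<in> carrier G" "inv x \<in> carrier G" "inv y \<in> carrier G"
    using x y by auto
  have "x \<otimes> y \<otimes> (inv y \<otimes> inv x) = x \<otimes> ((y \<otimes> inv y) \<otimes> inv x)"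
    using c by (simp only: m_assoc m_closed)
  then show "x \<otimes> y \<otimes> (inv y \<otimes> inv x) = \<one>"
    using c x y by simp
  have "inv y \<otimes> inv x \<otimes> (x \<otimes> y) = inv y \<otimes> ((inv x \<otimes> x) \<otimes> y)"
    using c by (simp only: m_assoc m_closed)
  then show "inv y \<otimes> inv x \<otimes> (x \<otimes> y) = \<one>"
    using c x y by simp
qed (use x y in auto)

text \<open>Here P = 1 + t E_ij: on the left it adds t times row j to row i, and on the right its
  inverse 1 - t E_ij then subtracts (column i) t from column j. The inner conditional is the already
  modified entry of column i.\<close>

lemma (in comm_matrices) transvection_conj:
  assumes A: "A \<in> carrier S" and ij: "i < n" "j < n" "i \<noteq> j" and t: "t \<in> carrier R"
  obtains P where "P \<in> Units S"
    "\<And>k l. k < n \<Longrightarrow> l < n \<Longrightarrow> (P \<otimes>\<^bsub>S\<^esub> A \<otimes>\<^bsub>S\<^esub> inv\<^bsub>S\<^esub> P) $$ (k, l) =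
      (A $$ (k, l) \<oplus> (if k = i then t \<otimes> A $$ (j, l) else \<zero>)) \<ominus>
      (if l = j then (A $$ (k, i) \<oplus> (if k = i then t \<otimes> A $$ (j, i) else \<zero>)) \<otimes> t else \<zero>)"
proof -
  define E where "E = elem i j t"
  define P where "P = \<one>\<^bsub>S\<^esub> \<oplus>\<^bsub>S\<^esub> E"
  define Q where "Q = \<one>\<^bsub>S\<^esub> \<ominus>\<^bsub>S\<^esub> E"
  have E: "E \<in> carrier S"
    using t by (simp add: E_def)
  have P: "P \<in> carrier S" and Q: "Q \<in> carrier S"
    using E by (simp_all add: P_def Q_def)
  have "E \<otimes>\<^bsub>S\<^esub> E = \<zero>\<^bsub>S\<^esub>"
  proof (rule mat_eqI)
    fix k l assume kl: "k < n" "l < n"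
    show "(E \<otimes>\<^bsub>S\<^esub> E) $$ (k, l) = \<zero>\<^bsub>S\<^esub> $$ (k, l)"
      unfolding E_def using kl ij t by (subst elem_mult_entry) auto
  qed (use E in auto)
  moreover have "P \<otimes>\<^bsub>S\<^esub> Q = \<one>\<^bsub>S\<^esub> \<ominus>\<^bsub>S\<^esub> E \<otimes>\<^bsub>S\<^esub> E" "Q \<otimes>\<^bsub>S\<^esub> P = \<one>\<^bsub>S\<^esub> \<ominus>\<^bsub>S\<^esub> E \<otimes>\<^bsub>S\<^esub> E"
    using E by (simp_all add: P_def Q_def mat.minus_eq mat.l_distr mat.r_distr mat.r_minus mat.l_minus
        mat.a_assoc mat.minus_add mat.r_neg1 mat.r_neg2)
  ultimately have PQ: "P \<otimes>\<^bsub>S\<^esub> Q = \<one>\<^bsub>S\<^esub>" "Q \<otimes>\<^bsub>S\<^esub> P = \<one>\<^bsub>S\<^esub>"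
    by (simp_all add: mat.minus_eq)
  have "inv\<^bsub>S\<^esub> P = Q"
    using P Q PQ by (rule mat.inv_char)
  moreover define B where "B = A \<oplus>\<^bsub>S\<^esub> E \<otimes>\<^bsub>S\<^esub> A"
  have B: "B \<in> carrier S"
    using A E by (simp add: B_def)
  have "P \<otimes>\<^bsub>S\<^esub> A = B"
    using A E by (simp add: P_def B_def mat.l_distr)
  moreover have "B \<otimes>\<^bsub>S\<^esub> Q = B \<ominus>\<^bsub>S\<^esub> B \<otimes>\<^bsub>S\<^esub> E"
    using B E by (simp add: Q_def mat.minus_eq mat.r_distr mat.r_minus)
  ultimately have conj: "P \<otimes>\<^bsub>S\<^esub> A \<otimes>\<^bsub>S\<^esub> inv\<^bsub>S\<^esub> P = B \<ominus>\<^bsub>S\<^esub> B \<otimes>\<^bsub>S\<^esub> E"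
    by simp
  have B_entry: "B $$ (k, l) = A $$ (k, l) \<oplus> (if k = i then t \<otimes> A $$ (j, l) else \<zero>)"
    if "k < n" "l < n" for k l
    unfolding B_def add_entry [OF that] E_def using that ij t A by (subst elem_mult_entry) auto
  show ?thesis
  proof (rule that)
    show "P \<in> Units S"
      using P Q PQ by (rule mat.UnitsI)
    fix k l assume kl: "k < n" "l < n"
    have "(B \<otimes>\<^bsub>S\<^esub> E) $$ (k, l) = (if l = j then B $$ (k, i) \<otimes> t else \<zero>)"
      unfolding E_def using kl ij t B by (intro mult_elem_entry)
    then show "(P \<otimes>\<^bsub>S\<^esub> A \<otimes>\<^bsub>S\<^esub> inv\<^bsub>S\<^esub> P) $$ (k, l) =
      (A $$ (k, l) \<oplus> (if k = i then t \<otimes> A $$ (j, l) else \<zero>)) \<ominus>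
      (if l = j then (A $$ (k, i) \<oplus> (if k = i then t \<otimes> A $$ (j, i) else \<zero>)) \<otimes> t else \<zero>)"
      unfolding conj using kl ij B E by (simp only: minus_entry mat.m_closed B_entry)
  qed
qed

context local_ring
begin

lemma unit_add:
  assumes "m \<in> M" "u \<in> Units R"
  shows "m \<oplus> u \<in> Units R"
proof (rule unit_cong [OF assms(2)])
  have c: "m \<in> carrier R" "u \<in> carrier R"
    using assms by auto
  then show "m \<oplus> u \<in> carrier R" by simp
  have "u \<ominus> (m \<oplus> u) = \<ominus> m"
    using c by (simp add: minus_eq minus_add a_comm [of m u] r_neg2 a_assoc [symmetric] r_neg)
  then show "u \<ominus> (m \<oplus> u) \<in> M"
    using M.a_inv_closed [OF assms(1)] by simp
qed

text \<open>x - 1 and x - l cannot both be nonunits, as their difference l - 1 is a unit. The size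
  of the field is used through this choice: 0, 1 and l are distinct modulo \<open>M\<close>.\<close>

lemma exists_unit_diff:
  assumes "x \<in> carrier R" "l \<in> Units R" "l \<ominus> \<one> \<in> Units R"
  shows "\<exists>s\<in>Units R. x \<ominus> s \<in> Units R"
proof (rule ccontr)
  assume "\<not> ?thesis"
  then have "x \<ominus> \<one> \<in> M" "x \<ominus> l \<in> M"
    using assms by auto
  then have "(x \<ominus> \<one>) \<oplus> \<ominus> (x \<ominus> l) \<in> M"
    by (intro M.a_closed M.a_inv_closed)
  moreover have "(x \<ominus> \<one>) \<oplus> \<ominus> (x \<ominus> l) = l \<ominus> \<one>"
    using assms(1) Units_closed [OF assms(2)] by algebra
  ultimately show False using assms by simp
qed

end

context local_matrices
begin

definition nonunit_diag :: "'a mat \<Rightarrow> nat set" where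
  "nonunit_diag A = {i. i < n \<and> A $$ (i, i) \<notin> Units R}"

lemma finite_nonunit_diag: "finite (nonunit_diag A)"
  by (simp add: nonunit_diag_def)

text \<open>A transvection moves a unit e along the diagonal: a_ii becomes a_ii + e, a unit since
  a_ii lies in \<open>M\<close>, and a_jj becomes a_jj - e, a unit by the choice of e. The other
  diagonal entries do not change.\<close>

lemma nonunit_diag_decrease_off_diag:
  assumes A: "A \<in> carrier S" and ij: "i < n" "j < n" "i \<noteq> j"
    and Aii: "A $$ (i, i) \<notin> Units R" and off: "A $$ (i, j) \<in> Units R \<or> A $$ (j, i) \<in> Units R"
    and l: "l \<in> Units R" "l \<ominus> \<one> \<in> Units R"
  shows "\<exists>P\<in>Units S. nonunit_diag (P \<otimes>\<^bsub>S\<^esub> A \<otimes>\<^bsub>S\<^esub> inv\<^bsub>S\<^esub> P) \<subset> nonunit_diag A"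
proof -
  have c: "A $$ (i, i) \<in> carrier R" "A $$ (i, j) \<in> carrier R" "A $$ (j, i) \<in> carrier R" "A $$ (j, j) \<in> carrier R"
    using A ij by auto
  obtain e where e: "e \<in> Units R" "A $$ (j, j) \<ominus> e \<in> Units R"
    using exists_unit_diff [OF c(4) l] by blast
  have ec: "e \<in> carrier R" using e by auto
  have "\<exists>P\<in>Units S. \<forall>k<n. (P \<otimes>\<^bsub>S\<^esub> A \<otimes>\<^bsub>S\<^esub> inv\<^bsub>S\<^esub> P) $$ (k, k) =
    (if k = i then A $$ (i, i) \<oplus> e else if k = j then A $$ (j, j) \<ominus> e else A $$ (k, k))"
    using off
  proof
    assume v: "A $$ (j, i) \<in> Units R"
    \<comment> \<open>Conjugation by 1 + t E_ij adds t a_ji to a_ii and subtracts a_ji t from a_jj;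
      t makes this product equal to e.\<close>
    define t where "t = e \<otimes> inv (A $$ (j, i))"
    have t: "t \<in> carrier R" "t \<otimes> A $$ (j, i) = e" "A $$ (j, i) \<otimes> t = e"
      using v ec c by (auto simp: t_def m_assoc m_lcomm)
    obtain P where "P \<in> Units S" and P:
      "\<And>k l. k < n \<Longrightarrow> l < n \<Longrightarrow> (P \<otimes>\<^bsub>S\<^esub> A \<otimes>\<^bsub>S\<^esub> inv\<^bsub>S\<^esub> P) $$ (k, l) =
      (A $$ (k, l) \<oplus> (if k = i then t \<otimes> A $$ (j, l) else \<zero>)) \<ominus>
      (if l = j then (A $$ (k, i) \<oplus> (if k = i then t \<otimes> A $$ (j, i) else \<zero>)) \<otimes> t else \<zero>)"
      using transvection_conj [OF A ij t(1)] by blast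
    moreover have "(P \<otimes>\<^bsub>S\<^esub> A \<otimes>\<^bsub>S\<^esub> inv\<^bsub>S\<^esub> P) $$ (k, k) =
      (if k = i then A $$ (i, i) \<oplus> e else if k = j then A $$ (j, j) \<ominus> e else A $$ (k, k))"
      if k: "k < n" for k
      unfolding P [OF k k] using ij(3) t c ec entry_closed [OF A k k]
      by (cases "k = i"; cases "k = j") (simp_all add: minus_eq)
    ultimately show ?thesis by blast
  next
    assume v: "A $$ (i, j) \<in> Units R"
    \<comment> \<open>The transvection is now 1 + t E_ji, which changes the two diagonal entries
      with opposite signs; hence the minus.\<close>
    define t where "t = \<ominus> (e \<otimes> inv (A $$ (i, j)))"
    have t: "t \<in> carrier R" "t \<otimes> A $$ (i, j) = \<ominus> e" "A $$ (i, j) \<otimes> t = \<ominus> e"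
      using v ec c by (auto simp: t_def m_assoc m_lcomm l_minus r_minus)
    obtain P where "P \<in> Units S" and P:
      "\<And>k l. k < n \<Longrightarrow> l < n \<Longrightarrow> (P \<otimes>\<^bsub>S\<^esub> A \<otimes>\<^bsub>S\<^esub> inv\<^bsub>S\<^esub> P) $$ (k, l) =
      (A $$ (k, l) \<oplus> (if k = j then t \<otimes> A $$ (i, l) else \<zero>)) \<ominus>
      (if l = i then (A $$ (k, j) \<oplus> (if k = j then t \<otimes> A $$ (i, j) else \<zero>)) \<otimes> t else \<zero>)"
      using transvection_conj [OF A ij(2,1) ij(3) [symmetric] t(1)] by blast
    moreover have "(P \<otimes>\<^bsub>S\<^esub> A \<otimes>\<^bsub>S\<^esub> inv\<^bsub>S\<^esub> P) $$ (k, k) =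
      (if k = i then A $$ (i, i) \<oplus> e else if k = j then A $$ (j, j) \<ominus> e else A $$ (k, k))"
      if k: "k < n" for k
      unfolding P [OF k k] using ij(3) t c ec entry_closed [OF A k k]
      by (cases "k = i"; cases "k = j") (simp_all add: minus_eq)
    ultimately show ?thesis by blast
  qed
  then obtain P where P: "P \<in> Units S" "\<And>k. k < n \<Longrightarrow> (P \<otimes>\<^bsub>S\<^esub> A \<otimes>\<^bsub>S\<^esub> inv\<^bsub>S\<^esub> P) $$ (k, k) =
    (if k = i then A $$ (i, i) \<oplus> e else if k = j then A $$ (j, j) \<ominus> e else A $$ (k, k))"
    by blast
  have "A $$ (i, i) \<oplus> e \<in> Units R"
    using Aii c e by (intro unit_add) auto
  then have "k \<noteq> i \<and> A $$ (k, k) \<notin> Units R"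
    if "k < n" "(P \<otimes>\<^bsub>S\<^esub> A \<otimes>\<^bsub>S\<^esub> inv\<^bsub>S\<^esub> P) $$ (k, k) \<notin> Units R" for k
    using P(2) [OF that(1)] that(2) e(2) by (cases "k = i"; cases "k = j") simp_all
  then have "nonunit_diag (P \<otimes>\<^bsub>S\<^esub> A \<otimes>\<^bsub>S\<^esub> inv\<^bsub>S\<^esub> P) \<subseteq> nonunit_diag A - {i}"
    unfolding nonunit_diag_def by blast
  moreover have "i \<in> nonunit_diag A"
    using ij Aii by (simp add: nonunit_diag_def)
  ultimately have "nonunit_diag (P \<otimes>\<^bsub>S\<^esub> A \<otimes>\<^bsub>S\<^esub> inv\<^bsub>S\<^esub> P) \<subset> nonunit_diag A"
    by blast
  then show ?thesis
    using P(1) by blast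
qed

lemma mat_conj_conj:
  assumes "P \<in> Units S" "Q \<in> Units S" "A \<in> carrier S"
  shows "Q \<otimes>\<^bsub>S\<^esub> (P \<otimes>\<^bsub>S\<^esub> A \<otimes>\<^bsub>S\<^esub> inv\<^bsub>S\<^esub> P) \<otimes>\<^bsub>S\<^esub> inv\<^bsub>S\<^esub> Q = (Q \<otimes>\<^bsub>S\<^esub> P) \<otimes>\<^bsub>S\<^esub> A \<otimes>\<^bsub>S\<^esub> inv\<^bsub>S\<^esub> (Q \<otimes>\<^bsub>S\<^esub> P)"
  using assms mat.Units_closed by (simp add: mat.inv_mult_Units mat.m_assoc)

lemma nonunit_diag_decrease:
  assumes A: "A \<in> carrier S" "A \<notin> matset M" and ne: "nonunit_diag A \<noteq> {}"
    and l: "l \<in> Units R" "l \<ominus> \<one> \<in> Units R"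
  shows "\<exists>P\<in>Units S. nonunit_diag (P \<otimes>\<^bsub>S\<^esub> A \<otimes>\<^bsub>S\<^esub> inv\<^bsub>S\<^esub> P) \<subset> nonunit_diag A"
proof -
  obtain i where i: "i < n" "A $$ (i, i) \<notin> Units R"
    using ne by (auto simp: nonunit_diag_def)
  \<comment> \<open>A unit elsewhere in row or column i can be used at once. Otherwise either
    another diagonal entry is a unit, or none is, and then a unit entry (k, j) lies off the diagonal
    and k takes the place of i.\<close>
  consider (off) j where "j < n" "i \<noteq> j" "A $$ (i, j) \<in> Units R \<or> A $$ (j, i) \<in> Units R"
    | (diag) k where "k < n" "A $$ (k, k) \<in> Units R"
        "\<And>j. j < n \<Longrightarrow> i \<noteq> j \<Longrightarrow> A $$ (i, j) \<notin> Units R \<and> A $$ (j, i) \<notin> Units R"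
    | (none) "\<And>k. k < n \<Longrightarrow> A $$ (k, k) \<notin> Units R"
    by blast
  then show ?thesis
  proof cases
    case off
    then show ?thesis
      using nonunit_diag_decrease_off_diag A(1) i l by blast
  next
    case none
    obtain k j where kj: "k < n" "j < n" "A $$ (k, j) \<notin> M"
      using A unfolding matset_iff by blast
    then have "A $$ (k, j) \<in> Units R"
      using entry_closed [OF A(1)] by blast
    then show ?thesis
      using none nonunit_diag_decrease_off_diag [OF A(1) kj(1,2)] kj l by metis
  next
    case diag
    have ik: "i \<noteq> k" using i diag by auto
    have c: "A $$ (i, i) \<in> carrier R" "A $$ (i, k) \<in> carrier R" "A $$ (k, i) \<in> carrier R" "A $$ (k, k) \<in> carrier R"
      using A i diag by auto
    have m: "A $$ (i, i) \<in> M" "A $$ (i, k) \<in> M" "A $$ (k, i) \<in> M"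
      using c i diag ik by auto
    \<comment> \<open>A preliminary transvection with t = 1 creates a unit at (i, k): the new entry
      is a_kk plus elements of \<open>M\<close>. Position i stays a nonunit and position k a unit,
      so the set of bad positions does not grow and the off-diagonal case applies to
      \<open>B\<close>.\<close>
    obtain P where PU: "P \<in> Units S" and P:
      "\<And>a b. a < n \<Longrightarrow> b < n \<Longrightarrow> (P \<otimes>\<^bsub>S\<^esub> A \<otimes>\<^bsub>S\<^esub> inv\<^bsub>S\<^esub> P) $$ (a, b) =
      (A $$ (a, b) \<oplus> (if a = i then \<one> \<otimes> A $$ (k, b) else \<zero>)) \<ominus>
      (if b = k then (A $$ (a, i) \<oplus> (if a = i then \<one> \<otimes> A $$ (k, i) else \<zero>)) \<otimes> \<one> else \<zero>)"
      using transvection_conj [OF A(1) i(1) diag(1) ik one_closed] by blast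
    define B where "B = P \<otimes>\<^bsub>S\<^esub> A \<otimes>\<^bsub>S\<^esub> inv\<^bsub>S\<^esub> P"
    have B: "B \<in> carrier S"
      using A PU by (simp add: B_def mat.Units_closed)
    have "B $$ (i, i) = A $$ (i, i) \<oplus> A $$ (k, i)"
      unfolding B_def P [OF i(1) i(1)] using ik c by (simp add: minus_eq)
    then have Bii: "B $$ (i, i) \<notin> Units R"
      using M.a_closed [OF m(1,3)] by auto
    have "B $$ (i, k) = (A $$ (i, k) \<oplus> \<ominus> (A $$ (i, i) \<oplus> A $$ (k, i))) \<oplus> A $$ (k, k)"
      unfolding B_def P [OF i(1) diag(1)] using ik c by (simp add: minus_eq a_ac)
    then have Bik: "B $$ (i, k) \<in> Units R"
      using m diag by (simp only:) (intro unit_add M.a_closed M.a_inv_closed)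
    have "B $$ (k, k) = \<ominus> A $$ (k, i) \<oplus> A $$ (k, k)"
      unfolding B_def P [OF diag(1) diag(1)] using ik c by (simp add: minus_eq a_comm)
    then have Bkk: "B $$ (k, k) \<in> Units R"
      using m diag by (simp only:) (intro unit_add M.a_inv_closed)
    have Baa: "B $$ (a, a) = A $$ (a, a)" if "a < n" "a \<noteq> i" "a \<noteq> k" for a
      unfolding B_def P [OF that(1) that(1)] using that(2,3) entry_closed [OF A(1) that(1) that(1)]
      by (simp add: minus_eq)
    have "nonunit_diag B \<subseteq> nonunit_diag A"
    proof
      fix a assume "a \<in> nonunit_diag B"
      then have "a < n" "B $$ (a, a) \<notin> Units R" by (auto simp: nonunit_diag_def)
      then show "a \<in> nonunit_diag A"
        using Bkk Baa [of a] i by (cases "a = i"; cases "a = k") (auto simp: nonunit_diag_def)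
    qed
    moreover obtain Q where Q: "Q \<in> Units S" "nonunit_diag (Q \<otimes>\<^bsub>S\<^esub> B \<otimes>\<^bsub>S\<^esub> inv\<^bsub>S\<^esub> Q) \<subset> nonunit_diag B"
      using nonunit_diag_decrease_off_diag [OF B i(1) diag(1) ik Bii _ l] Bik by blast
    moreover have "Q \<otimes>\<^bsub>S\<^esub> B \<otimes>\<^bsub>S\<^esub> inv\<^bsub>S\<^esub> Q = (Q \<otimes>\<^bsub>S\<^esub> P) \<otimes>\<^bsub>S\<^esub> A \<otimes>\<^bsub>S\<^esub> inv\<^bsub>S\<^esub> (Q \<otimes>\<^bsub>S\<^esub> P)"
      unfolding B_def using PU Q(1) A(1) by (rule mat_conj_conj)
    ultimately show ?thesis
      using PU by (intro bexI [of _ "Q \<otimes>\<^bsub>S\<^esub> P"]) auto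
  qed
qed

lemma conj_unit_diag:
  assumes A: "A \<in> carrier S" "A \<notin> matset M"
    and l: "l \<in> Units R" "l \<ominus> \<one> \<in> Units R"
  shows "\<exists>P\<in>Units S. nonunit_diag (P \<otimes>\<^bsub>S\<^esub> A \<otimes>\<^bsub>S\<^esub> inv\<^bsub>S\<^esub> P) = {}"
  using A
proof (induction "card (nonunit_diag A)" arbitrary: A rule: less_induct)
  case less
  show ?case
  proof (cases "nonunit_diag A = {}")
    case True
    then show ?thesis
      using less.prems by (intro bexI [of _ "\<one>\<^bsub>S\<^esub>"]) (simp_all add: mat.inv_char [of "\<one>\<^bsub>S\<^esub>" "\<one>\<^bsub>S\<^esub>"])
  next
    case False
    obtain P where P: "P \<in> Units S" "nonunit_diag (P \<otimes>\<^bsub>S\<^esub> A \<otimes>\<^bsub>S\<^esub> inv\<^bsub>S\<^esub> P) \<subset> nonunit_diag A"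
      using nonunit_diag_decrease [OF less.prems False l] by blast
    define B where "B = P \<otimes>\<^bsub>S\<^esub> A \<otimes>\<^bsub>S\<^esub> inv\<^bsub>S\<^esub> P"
    have Pc: "P \<in> carrier S" "inv\<^bsub>S\<^esub> P \<in> carrier S"
      using P by auto
    have B: "B \<in> carrier S"
      using less.prems Pc by (simp add: B_def)
    have "B \<notin> matset M"
    proof
      assume "B \<in> matset M"
      then have "inv\<^bsub>S\<^esub> P \<otimes>\<^bsub>S\<^esub> B \<otimes>\<^bsub>S\<^esub> P \<in> matset M"
        using Pc by (intro MS.I_l_closed MS.I_r_closed)
      then show False
        using less.prems P by (simp add: B_def mat.conj_inv_conj)
    qed
    moreover have "card (nonunit_diag B) < card (nonunit_diag A)"
      unfolding B_def using P(2) by (intro psubset_card_mono finite_nonunit_diag)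
    ultimately obtain Q where Q: "Q \<in> Units S" "nonunit_diag (Q \<otimes>\<^bsub>S\<^esub> B \<otimes>\<^bsub>S\<^esub> inv\<^bsub>S\<^esub> Q) = {}"
      using less.hyps B by blast
    moreover have "Q \<otimes>\<^bsub>S\<^esub> B \<otimes>\<^bsub>S\<^esub> inv\<^bsub>S\<^esub> Q = (Q \<otimes>\<^bsub>S\<^esub> P) \<otimes>\<^bsub>S\<^esub> A \<otimes>\<^bsub>S\<^esub> inv\<^bsub>S\<^esub> (Q \<otimes>\<^bsub>S\<^esub> P)"
      unfolding B_def using P(1) Q(1) less.prems(1) by (rule mat_conj_conj)
    ultimately show ?thesis
      using P by (intro bexI [of _ "Q \<otimes>\<^bsub>S\<^esub> P"]) auto
  qed
qed

section \<open>Decomposition of the matrices outside the radical\<close>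

lemma unit_diag_decomposition:
  assumes B: "B \<in> carrier S" "nonunit_diag B = {}"
    and char: "p > 0" "[(p::nat)] \<cdot> \<one> = \<zero>"
    and lift: "\<And>u. u \<in> Units R \<Longrightarrow> \<exists>t\<in>torsion_units R. u \<ominus> t \<in> M"
  shows "\<exists>U\<in>torsion_units S. \<exists>N\<in>quasinilpotents S. B = U \<oplus>\<^bsub>S\<^esub> N"
proof -
  have "\<exists>t. if u \<in> Units R then t \<in> torsion_units R \<and> u \<ominus> t \<in> M else t = \<zero>" for u
    using lift by auto
  then obtain \<tau> where \<tau>: "\<And>u. if u \<in> Units R then \<tau> u \<in> torsion_units R \<and> u \<ominus> \<tau> u \<in> M else \<tau> u = \<zero>"
    by metis
  have tor: "t \<in> Units R" "t \<in> carrier R" if "t \<in> torsion_units R" for t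
    using that by (auto simp: torsion_units_def)
  have \<tau>c: "\<tau> u \<in> carrier R" for u
    using \<tau> [of u] tor by (auto split: if_splits)
  have \<tau>M: "u \<ominus> \<tau> u \<in> M" if "u \<in> carrier R" for u
    using \<tau> [of u] that by (auto split: if_splits simp: minus_eq)
  have \<tau>U: "\<tau> u \<in> Units R" if "u \<in> Units R" for u
    using \<tau> [of u] that tor by auto
  \<comment> \<open>Only the upper triangle, diagonal included, is replaced; the strict lower
    triangle of B goes to N untouched, so N is strictly lower triangular modulo
    \<open>M\<close>.\<close>
  define U where "U = mat n n (\<lambda>(i, j). if i \<le> j then \<tau> (B $$ (i, j)) else \<zero>)"
  have U: "U \<in> carrier S"
    unfolding U_def using \<tau>c by (intro mat_closed) auto
  have U_unit: "U \<in> Units S"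
  proof (rule upper_triangular_unit [OF U])
    fix i assume "i < n"
    then show "U $$ (i, i) \<in> Units R"
      using B(2) by (auto simp: U_def nonunit_diag_def intro: \<tau>U)
  qed (auto simp: U_def)
  \<comment> \<open>The intersection drops the value 0 that \<tau> takes at nonunits and that is not
    torsion; H contains 0 anyway.\<close>
  define T where "T = (\<lambda>(i, j). \<tau> (B $$ (i, j))) ` ({..<n} \<times> {..<n}) \<inter> torsion_units R"
  have "finite T"
    by (simp add: T_def)
  moreover have "T \<subseteq> carrier R"
    using tor by (auto simp only: T_def)
  moreover have "\<exists>m::nat. m \<ge> 1 \<and> b [^] m = \<one>" if "b \<in> T" for b
    using that by (simp add: T_def torsion_units_def)
  ultimately obtain H where H_conj: "finite H \<and> H \<subseteq> carrier R \<and> T \<subseteq> H \<and> \<zero> \<in> H \<and> \<one> \<in> H \<and>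
    (\<forall>x\<in>H. \<forall>y\<in>H. x \<oplus> y \<in> H \<and> x \<otimes> y \<in> H)"
    using finite_subring_of_torsion [OF char] by metis
  then have H: "finite H" "H \<subseteq> carrier R" "T \<subseteq> H" "\<zero> \<in> H" "\<one> \<in> H"
    and H_add: "\<And>x y. x \<in> H \<Longrightarrow> y \<in> H \<Longrightarrow> x \<oplus> y \<in> H"
    and H_mult: "\<And>x y. x \<in> H \<Longrightarrow> y \<in> H \<Longrightarrow> x \<otimes> y \<in> H"
    by simp_all
  have "\<tau> (B $$ (i, j)) \<in> H" if "i < n" "j < n" for i j
  proof (cases "B $$ (i, j) \<in> Units R")
    case True
    then have "\<tau> (B $$ (i, j)) \<in> T"
      unfolding T_def using that \<tau> [of "B $$ (i, j)"]
      by (intro IntI image_eqI [of _ _ "(i, j)"]) simp_all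
    then show ?thesis using H by auto
  qed (use \<tau> [of "B $$ (i, j)"] H in auto)
  then have "U \<in> torsion_units S"
    using H U_unit by (intro torsion_of_finite_entries [of H] H_add H_mult) (simp_all add: U_def)
  moreover define N where "N = B \<ominus>\<^bsub>S\<^esub> U"
  have N: "N \<in> carrier S"
    using B U by (simp add: N_def)
  have "N [^]\<^bsub>S\<^esub> n \<in> matset M"
  proof (rule triangular_pow_mem [OF nonunits N, where f = "\<lambda>i. i"])
    fix i j assume ij: "i < n" "j < n" "\<not> j < i"
    then have "N $$ (i, j) = B $$ (i, j) \<ominus> \<tau> (B $$ (i, j))"
      unfolding N_def using B U by (subst minus_entry) (auto simp: U_def)
    then show "N $$ (i, j) \<in> M"
      using \<tau>M ij B by simp
  qed auto
  then have "N \<in> quasinilpotents S"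
    using N mat_one_minus_unit MS.ideal_axioms by (intro mat.quasinilpotentI [of "matset M" N n])
  moreover have "B = U \<oplus>\<^bsub>S\<^esub> N"
    using B U by (simp add: N_def mat.minus_eq mat.a_lcomm mat.r_neg)
  ultimately show ?thesis by blast
qed

text \<open>With u + q in the radical, 1 - u^(-1) (u + q) = - u^(-1) q would be a unit, hence so
  would q. The argument works although u and q may fail to commute.\<close>

lemma torsion_plus_quasinilpotent_not_matset:
  assumes n: "n > 0" and u: "u \<in> torsion_units S" and q: "q \<in> quasinilpotents S"
  shows "u \<oplus>\<^bsub>S\<^esub> q \<notin> matset M"
proof
  assume j: "u \<oplus>\<^bsub>S\<^esub> q \<in> matset M"
  have uU: "u \<in> Units S" and uc: "u \<in> carrier S" and qc: "q \<in> carrier S"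
    using u q by (auto simp: torsion_units_def quasinilpotents_def)
  have "inv\<^bsub>S\<^esub> u \<otimes>\<^bsub>S\<^esub> (u \<oplus>\<^bsub>S\<^esub> q) \<in> matset M"
    using j uU by (intro MS.I_l_closed) auto
  then have "\<one>\<^bsub>S\<^esub> \<ominus>\<^bsub>S\<^esub> inv\<^bsub>S\<^esub> u \<otimes>\<^bsub>S\<^esub> (u \<oplus>\<^bsub>S\<^esub> q) \<in> Units S"
    by (rule mat_one_minus_unit)
  moreover have "\<one>\<^bsub>S\<^esub> \<ominus>\<^bsub>S\<^esub> inv\<^bsub>S\<^esub> u \<otimes>\<^bsub>S\<^esub> (u \<oplus>\<^bsub>S\<^esub> q) = \<ominus>\<^bsub>S\<^esub> \<one>\<^bsub>S\<^esub> \<otimes>\<^bsub>S\<^esub> (inv\<^bsub>S\<^esub> u \<otimes>\<^bsub>S\<^esub> q)"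
    using uU uc qc by (simp add: mat.minus_eq mat.r_distr mat.minus_add mat.l_minus mat.r_neg2)
  ultimately have neg: "\<ominus>\<^bsub>S\<^esub> \<one>\<^bsub>S\<^esub> \<otimes>\<^bsub>S\<^esub> (inv\<^bsub>S\<^esub> u \<otimes>\<^bsub>S\<^esub> q) \<in> Units S"
    by (simp only:)
  have "u \<otimes>\<^bsub>S\<^esub> (\<ominus>\<^bsub>S\<^esub> \<one>\<^bsub>S\<^esub> \<otimes>\<^bsub>S\<^esub> (\<ominus>\<^bsub>S\<^esub> \<one>\<^bsub>S\<^esub> \<otimes>\<^bsub>S\<^esub> (inv\<^bsub>S\<^esub> u \<otimes>\<^bsub>S\<^esub> q))) \<in> Units S"
    by (intro mat.Units_m_closed mat.Units_minus_one_closed neg uU)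
  also have "u \<otimes>\<^bsub>S\<^esub> (\<ominus>\<^bsub>S\<^esub> \<one>\<^bsub>S\<^esub> \<otimes>\<^bsub>S\<^esub> (\<ominus>\<^bsub>S\<^esub> \<one>\<^bsub>S\<^esub> \<otimes>\<^bsub>S\<^esub> (inv\<^bsub>S\<^esub> u \<otimes>\<^bsub>S\<^esub> q))) = q"
    using uU uc qc by (simp add: mat.l_minus mat.m_assoc [symmetric])
  finally have "\<one>\<^bsub>S\<^esub> = \<zero>\<^bsub>S\<^esub>"
    using q by (intro mat.quasinilpotent_not_unit)
  then have "\<one>\<^bsub>S\<^esub> $$ (0, 0) = \<zero>\<^bsub>S\<^esub> $$ (0, 0)"
    by simp
  then have "\<one> \<in> M"
    using n M.zero_closed by simp
  then show False by simp
qed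

lemma generalized_quasi_t_fine_mat:
  assumes n: "n > 0"
    and char: "p > 0" "[(p::nat)] \<cdot> \<one> = \<zero>"
    and lift: "\<And>u. u \<in> Units R \<Longrightarrow> \<exists>t\<in>torsion_units R. u \<ominus> t \<in> M"
    and l: "l \<in> Units R" "l \<ominus> \<one> \<in> Units R"
  shows "generalized_quasi_t_fine S"
  unfolding generalized_quasi_t_fine_def jacobson_radical_mat_eq
proof (intro equalityI subsetI)
  fix A assume A: "A \<in> carrier S - matset M"
  then obtain P where P: "P \<in> Units S" "nonunit_diag (P \<otimes>\<^bsub>S\<^esub> A \<otimes>\<^bsub>S\<^esub> inv\<^bsub>S\<^esub> P) = {}"
    using conj_unit_diag [OF _ _ l] by blast
  have Pc: "P \<in> carrier S" "inv\<^bsub>S\<^esub> P \<in> carrier S" and invP: "inv\<^bsub>S\<^esub> P \<in> Units S"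
    using P by auto
  have "P \<otimes>\<^bsub>S\<^esub> A \<otimes>\<^bsub>S\<^esub> inv\<^bsub>S\<^esub> P \<in> carrier S"
    using A Pc by simp
  then obtain U N where UN: "U \<in> torsion_units S" "N \<in> quasinilpotents S"
    "P \<otimes>\<^bsub>S\<^esub> A \<otimes>\<^bsub>S\<^esub> inv\<^bsub>S\<^esub> P = U \<oplus>\<^bsub>S\<^esub> N"
    using unit_diag_decomposition [OF _ P(2) char lift] by blast
  have c: "U \<in> carrier S" "N \<in> carrier S"
    using UN by (auto simp: torsion_units_def quasinilpotents_def)
  have "A = inv\<^bsub>S\<^esub> P \<otimes>\<^bsub>S\<^esub> (U \<oplus>\<^bsub>S\<^esub> N) \<otimes>\<^bsub>S\<^esub> P"
    using mat.conj_inv_conj [OF P(1), of A] A UN(3) by simp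
  also have "\<dots> = inv\<^bsub>S\<^esub> P \<otimes>\<^bsub>S\<^esub> U \<otimes>\<^bsub>S\<^esub> P \<oplus>\<^bsub>S\<^esub> inv\<^bsub>S\<^esub> P \<otimes>\<^bsub>S\<^esub> N \<otimes>\<^bsub>S\<^esub> P"
    using c Pc by (simp add: mat.r_distr mat.l_distr)
  finally have "A = inv\<^bsub>S\<^esub> P \<otimes>\<^bsub>S\<^esub> U \<otimes>\<^bsub>S\<^esub> P \<oplus>\<^bsub>S\<^esub> inv\<^bsub>S\<^esub> P \<otimes>\<^bsub>S\<^esub> N \<otimes>\<^bsub>S\<^esub> P" .
  moreover have "inv\<^bsub>S\<^esub> P \<otimes>\<^bsub>S\<^esub> U \<otimes>\<^bsub>S\<^esub> P \<in> torsion_units S"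
    using mat.conj_torsion [OF invP UN(1)] P by simp
  moreover have "inv\<^bsub>S\<^esub> P \<otimes>\<^bsub>S\<^esub> N \<otimes>\<^bsub>S\<^esub> P \<in> quasinilpotents S"
    using mat.conj_quasinilpotent [OF invP UN(2)] P by simp
  ultimately show "A \<in> torsion_units S <+>\<^bsub>S\<^esub> quasinilpotents S"
    by (auto simp: set_add_def')
next
  fix A assume "A \<in> torsion_units S <+>\<^bsub>S\<^esub> quasinilpotents S"
  then obtain U N where UN: "U \<in> torsion_units S" "N \<in> quasinilpotents S" "A = U \<oplus>\<^bsub>S\<^esub> N"
    by (auto simp: set_add_def')
  moreover have "U \<in> carrier S" "N \<in> carrier S"
    using UN by (auto simp: torsion_units_def quasinilpotents_def)
  ultimately show "A \<in> carrier S - matset M"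
    using torsion_plus_quasinilpotent_not_matset [OF n] by auto
qed

end

section \<open>Differences and commutators of powers in a noncommutative ring\<close>

lemma (in monoid) Units_inv_commute:
  assumes c: "c \<in> Units G" and g: "g \<in> carrier G" and comm: "g \<otimes> c = c \<otimes> g"
  shows "g \<otimes> inv c = inv c \<otimes> g"
proof -
  have cc: "c \<in> carrier G" "inv c \<in> carrier G"
    using c by auto
  have "g \<otimes> inv c = inv c \<otimes> (c \<otimes> g) \<otimes> inv c"
    using c cc g by (simp add: m_assoc [symmetric])
  also have "\<dots> = inv c \<otimes> (g \<otimes> (c \<otimes> inv c))"
    using cc g by (simp only: comm [symmetric] m_assoc m_closed)
  finally show ?thesis
    using c cc g by simp
qed

lemma (in monoid) pow_commute:
  assumes "g \<in> carrier G" "x \<in> carrier G" "g \<otimes> x = x \<otimes> g"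
  shows "g \<otimes> x [^] (k::nat) = x [^] k \<otimes> g"
proof (induction k)
  case (Suc k)
  have "g \<otimes> (x [^] k \<otimes> x) = x [^] k \<otimes> (g \<otimes> x)"
    using assms(1,2) Suc by (simp add: m_assoc [symmetric])
  then show ?case
    using assms by (simp add: m_assoc [symmetric])
qed (use assms in simp)

context ring
begin

text \<open>The cofactor is the sum of all x^i y^(k-1-i). The last conjunct, that it commutes with
  whatever commutes with x and y, stands in for working in the commutative subring generated by x
  and y.\<close>

lemma pow_diff_factor:
  assumes x: "x \<in> carrier R" and y: "y \<in> carrier R" and xy: "x \<otimes> y = y \<otimes> x"
  shows "\<exists>w\<in>carrier R. x [^] (k::nat) \<ominus> y [^] k = (x \<ominus> y) \<otimes> w \<and>
    (\<forall>g\<in>carrier R. g \<otimes> x = x \<otimes> g \<longrightarrow> g \<otimes> y = y \<otimes> g \<longrightarrow> g \<otimes> w = w \<otimes> g)"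
proof (induction k)
  case 0
  show ?case
    using x y by (intro bexI [of _ \<zero>]) (auto simp: minus_eq r_neg)
next
  case (Suc k)
  then obtain w where w: "w \<in> carrier R" "x [^] k \<ominus> y [^] k = (x \<ominus> y) \<otimes> w"
    "\<And>g. g \<in> carrier R \<Longrightarrow> g \<otimes> x = x \<otimes> g \<Longrightarrow> g \<otimes> y = y \<otimes> g \<Longrightarrow> g \<otimes> w = w \<otimes> g"
    by blast
  have "x [^] Suc k \<ominus> y [^] Suc k = (x [^] k \<ominus> y [^] k) \<otimes> x \<oplus> y [^] k \<otimes> (x \<ominus> y)"
    using x y by (simp add: minus_eq l_distr r_distr l_minus r_minus a_assoc r_neg1)
  also have "y [^] k \<otimes> (x \<ominus> y) = (x \<ominus> y) \<otimes> y [^] k"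
    using x y pow_commute [OF x y xy, of k] pow_commute [OF y y refl, of k]
    by (simp add: minus_eq l_distr r_distr l_minus r_minus)
  also have "(x [^] k \<ominus> y [^] k) \<otimes> x \<oplus> (x \<ominus> y) \<otimes> y [^] k = (x \<ominus> y) \<otimes> (w \<otimes> x \<oplus> y [^] k)"
    unfolding w(2) using x y w(1) by (simp add: r_distr m_assoc)
  finally have "x [^] Suc k \<ominus> y [^] Suc k = (x \<ominus> y) \<otimes> (w \<otimes> x \<oplus> y [^] k)" .
  moreover have "g \<otimes> (w \<otimes> x \<oplus> y [^] k) = (w \<otimes> x \<oplus> y [^] k) \<otimes> g"
    if g: "g \<in> carrier R" "g \<otimes> x = x \<otimes> g" "g \<otimes> y = y \<otimes> g" for g
  proof -
    have "g \<otimes> (w \<otimes> x) = w \<otimes> (g \<otimes> x)"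
      using w(3) [OF g] g(1) w(1) x by (simp add: m_assoc [symmetric])
    then have "g \<otimes> (w \<otimes> x) = (w \<otimes> x) \<otimes> g"
      using g(1,2) w(1) x by (simp add: m_assoc)
    then show ?thesis
      using g(1) w(1) x y pow_commute [OF g(1) y g(3), of k] by (simp add: r_distr l_distr)
  qed
  ultimately show ?case
    using w(1) x y by (intro bexI [of _ "w \<otimes> x \<oplus> y [^] k"]) auto
qed

text \<open>This is the Taylor expansion of y^(k+1) around x: (k+1) x^k is the derivative, and z
  collects the terms of second order in x - y.\<close>

lemma pow_diff_factor_second_order:
  assumes x: "x \<in> carrier R" and y: "y \<in> carrier R" and xy: "x \<otimes> y = y \<otimes> x"
  shows "\<exists>z\<in>carrier R. x [^] Suc k \<ominus> y [^] Suc k = (x \<ominus> y) \<otimes> ([Suc k] \<cdot> (x [^] k) \<ominus> (x \<ominus> y) \<otimes> z) \<and>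
    (\<forall>g\<in>carrier R. g \<otimes> x = x \<otimes> g \<longrightarrow> g \<otimes> y = y \<otimes> g \<longrightarrow> g \<otimes> z = z \<otimes> g)"
proof (induction k)
  case 0
  show ?case
    using x y by (intro bexI [of _ \<zero>]) (auto simp: minus_eq)
next
  case (Suc k)
  define d where "d = x \<ominus> y"
  have d: "d \<in> carrier R"
    using x y by (simp add: d_def)
  obtain z where z: "z \<in> carrier R"
    "x [^] Suc k \<ominus> y [^] Suc k = d \<otimes> ([Suc k] \<cdot> (x [^] k) \<ominus> d \<otimes> z)"
    "\<And>g. g \<in> carrier R \<Longrightarrow> g \<otimes> x = x \<otimes> g \<Longrightarrow> g \<otimes> y = y \<otimes> g \<Longrightarrow> g \<otimes> z = z \<otimes> g"
    using Suc unfolding d_def by blast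
  obtain w where w: "w \<in> carrier R" "x [^] Suc k \<ominus> y [^] Suc k = d \<otimes> w"
    "\<And>g. g \<in> carrier R \<Longrightarrow> g \<otimes> x = x \<otimes> g \<Longrightarrow> g \<otimes> y = y \<otimes> g \<Longrightarrow> g \<otimes> w = w \<otimes> g"
    using pow_diff_factor [OF x y xy, of "Suc k"] unfolding d_def by blast
  define X' where "X' = x [^] Suc k"
  define Y' where "Y' = y [^] Suc k"
  define e where "e = [Suc k] \<cdot> (x [^] k)"
  have c: "X' \<in> carrier R" "Y' \<in> carrier R" "e \<in> carrier R"
    using x y by (simp_all add: X'_def Y'_def e_def)
  have ex: "e \<otimes> x = [Suc k] \<cdot> X'"
    using x add_pow_ldistr [of "x [^] k" x "Suc k"] by (simp add: e_def X'_def)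
  have Y'_eq: "Y' = X' \<ominus> d \<otimes> w"
  proof -
    have "X' \<ominus> (X' \<ominus> Y') = Y'"
      using c(1,2) by (simp add: minus_eq minus_add r_neg2 a_assoc [symmetric] r_neg)
    then show ?thesis
      using w(2) by (simp add: X'_def Y'_def)
  qed
  \<comment> \<open>A product rule: the induction hypothesis expands X' - Y' to second order, while
    the remaining Y' is expanded to first order by \<open>Y'_eq\<close>. Its leading term X' raises
    the coefficient of the derivative by 1.\<close>
  have "X' \<otimes> x \<ominus> Y' \<otimes> y = (X' \<ominus> Y') \<otimes> x \<oplus> Y' \<otimes> d"
    unfolding d_def using x y c by (simp add: minus_eq l_distr r_distr l_minus r_minus a_assoc r_neg1)
  also have "Y' \<otimes> d = d \<otimes> Y'"
    unfolding Y'_def d_def using x y pow_commute [OF x y xy, of "Suc k"] pow_commute [OF y y refl, of "Suc k"]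
    by (simp only: minus_eq l_distr r_distr l_minus r_minus a_inv_closed nat_pow_closed)
  also have "(X' \<ominus> Y') \<otimes> x \<oplus> d \<otimes> Y' = d \<otimes> ((e \<ominus> d \<otimes> z) \<otimes> x) \<oplus> d \<otimes> (X' \<ominus> d \<otimes> w)"
  proof -
    have "(X' \<ominus> Y') \<otimes> x = d \<otimes> (e \<ominus> d \<otimes> z) \<otimes> x"
      using z(2) by (simp only: X'_def Y'_def e_def)
    also have "\<dots> = d \<otimes> ((e \<ominus> d \<otimes> z) \<otimes> x)"
      using z(1) x c d by (intro m_assoc) auto
    finally show ?thesis by (simp only: Y'_eq)
  qed
  also have "\<dots> = d \<otimes> ((e \<otimes> x \<oplus> X') \<ominus> d \<otimes> (z \<otimes> x \<oplus> w))"
    using x c d z(1) w(1)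
    by (simp add: minus_eq l_distr r_distr l_minus r_minus minus_add m_assoc a_ac)
  also have "e \<otimes> x \<oplus> X' = [Suc (Suc k)] \<cdot> X'"
    by (simp add: ex)
  finally have "x [^] Suc (Suc k) \<ominus> y [^] Suc (Suc k)
      = d \<otimes> ([Suc (Suc k)] \<cdot> (x [^] Suc k) \<ominus> d \<otimes> (z \<otimes> x \<oplus> w))"
    unfolding X'_def Y'_def nat_pow_Suc .
  moreover have "g \<otimes> (z \<otimes> x \<oplus> w) = (z \<otimes> x \<oplus> w) \<otimes> g"
    if g: "g \<in> carrier R" "g \<otimes> x = x \<otimes> g" "g \<otimes> y = y \<otimes> g" for g
  proof -
    have "g \<otimes> (z \<otimes> x) = z \<otimes> (g \<otimes> x)"
      using z(3) [OF g] g(1) z(1) x by (simp add: m_assoc [symmetric])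
    then have "g \<otimes> (z \<otimes> x) = (z \<otimes> x) \<otimes> g"
      using g(1,2) z(1) x by (simp add: m_assoc)
    then show ?thesis
      using g(1) w(1) z(1) x w(3) [OF g] by (simp add: r_distr l_distr)
  qed
  ultimately show ?case
    unfolding d_def using w(1) z(1) x by (intro bexI [of _ "z \<otimes> x \<oplus> w"]) auto
qed

text \<open>The derivative \<open>m x\<^sup>m\<^sup>-\<^sup>1\<close> of \<open>x\<^sup>m\<close> stays a unit after a quasinilpotent perturbation, so
  \<open>x - u\<close> divides \<open>x\<^sup>m - u\<^sup>m\<close> up to a unit.\<close>

lemma quasinilpotent_pow_diff:
  assumes x: "x \<in> Units R" and u: "u \<in> carrier R" and xu: "x \<otimes> u = u \<otimes> x"
    and q: "x \<ominus> u \<in> quasinilpotents R"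
    and m: "m > 0" "[(m::nat)] \<cdot> \<one> \<in> Units R"
  shows "\<exists>W\<in>Units R. (x [^] (k::nat) \<ominus> u [^] k) \<otimes> W = x [^] (k * m) \<ominus> u [^] (k * m)"
    and "x [^] k \<ominus> u [^] k \<in> Units R \<Longrightarrow> \<one> = \<zero>"
proof -
  have xc: "x \<in> carrier R" using x by auto
  define N where "N = x \<ominus> u"
  have N: "N \<in> carrier R" using xc u by (simp add: N_def)
  have N_comm: "g \<otimes> N = N \<otimes> g" if "g \<in> carrier R" "x \<otimes> g = g \<otimes> x" "u \<otimes> g = g \<otimes> u" for g
    using that xc u by (simp add: N_def minus_eq l_distr r_distr l_minus r_minus)
  obtain w where w: "w \<in> carrier R" "x [^] k \<ominus> u [^] k = N \<otimes> w"
    "\<And>g. g \<in> carrier R \<Longrightarrow> g \<otimes> x = x \<otimes> g \<Longrightarrow> g \<otimes> u = u \<otimes> g \<Longrightarrow> g \<otimes> w = w \<otimes> g"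
    using pow_diff_factor [OF xc u xu, of k] unfolding N_def by blast
  have wN: "w \<otimes> N = N \<otimes> w"
    using w xc u xu by (intro N_comm) auto
  show "\<one> = \<zero>" if "x [^] k \<ominus> u [^] k \<in> Units R"
  proof -
    \<comment> \<open>N divides x^k - u^k with a commuting cofactor, so it would be a quasinilpotent
      unit.\<close>
    have "N \<in> Units R"
      using that w wN N by (intro unit_factor [of N w]) auto
    then show ?thesis
      using q by (intro quasinilpotent_not_unit) (simp_all add: N_def)
  qed
  define b where "b = x [^] k"
  define v where "v = u [^] k"
  have b: "b \<in> carrier R" "b \<in> Units R" and v: "v \<in> carrier R"
    using x xc u by (auto simp: b_def v_def intro: Units_pow_closed)
  have xb: "x \<otimes> b = b \<otimes> x" "u \<otimes> b = b \<otimes> u" and xv: "x \<otimes> v = v \<otimes> x" "u \<otimes> v = v \<otimes> u"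
    using xc u xu pow_commute by (auto simp: b_def v_def)
  have bv: "b \<otimes> v = v \<otimes> b"
    unfolding v_def using b u xb by (intro pow_commute) auto
  obtain m' where m': "m = Suc m'"
    using m by (cases m) auto
  obtain z where z: "z \<in> carrier R" "b [^] m \<ominus> v [^] m = (b \<ominus> v) \<otimes> ([m] \<cdot> (b [^] m') \<ominus> (b \<ominus> v) \<otimes> z)"
    "\<And>g. g \<in> carrier R \<Longrightarrow> g \<otimes> b = b \<otimes> g \<Longrightarrow> g \<otimes> v = v \<otimes> g \<Longrightarrow> g \<otimes> z = z \<otimes> g"
    using pow_diff_factor_second_order [OF b(1) v bv, of m'] unfolding m' by blast
  define c where "c = [m] \<cdot> (b [^] m')"
  have "c = ([m] \<cdot> \<one>) \<otimes> b [^] m'"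
    using b add_pow_ldistr [of \<one> "b [^] m'" m] by (simp add: c_def)
  then have c: "c \<in> Units R" "c \<in> carrier R"
    using m b by (auto intro!: Units_m_closed Units_pow_closed)
  have gc: "g \<otimes> c = c \<otimes> g" if g: "g \<in> carrier R" "g \<otimes> b = b \<otimes> g" for g
    unfolding c_def using add_pow_ldistr [of "b [^] m'" g m] add_pow_rdistr [of g "b [^] m'" m]
      pow_commute [OF g(1) b(1) g(2), of m'] g b by simp
  have Nc: "N \<otimes> c = c \<otimes> N"
    using N_comm [OF b(1)] xb N by (intro gc) auto
  \<comment> \<open>Since b - v = N w, the cofactor c - (b - v) z of b^m - v^m equals c (1 - y N);
    all parts of y commute with N, so quasinilpotence applies.\<close>
  define y where "y = inv c \<otimes> (w \<otimes> z)"
  have y: "y \<in> carrier R"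
    using c w z by (simp add: y_def)
  have zN: "z \<otimes> N = N \<otimes> z"
    using z xc u xb xv by (intro N_comm) auto
  have wzN: "(w \<otimes> z) \<otimes> N = N \<otimes> (w \<otimes> z)"
  proof -
    have "(w \<otimes> z) \<otimes> N = (w \<otimes> N) \<otimes> z"
      using w(1) z(1) N zN by (simp add: m_assoc)
    then show ?thesis
      using w(1) z(1) N wN by (simp add: m_assoc)
  qed
  have "N \<otimes> inv c = inv c \<otimes> N"
    using Units_inv_commute [OF c(1) N Nc] .
  then have "y \<otimes> N = N \<otimes> y"
  proof -
    have ic: "inv c \<in> carrier R" and wz: "w \<otimes> z \<in> carrier R"
      using c w(1) z(1) by auto
    have "y \<otimes> N = (inv c \<otimes> N) \<otimes> (w \<otimes> z)"
      unfolding y_def m_assoc [OF ic wz N] wzN using ic N wz by (intro m_assoc [symmetric])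
    also have "\<dots> = N \<otimes> y"
      unfolding y_def \<open>N \<otimes> inv c = inv c \<otimes> N\<close> [symmetric] using N ic wz by (rule m_assoc)
    finally show ?thesis .
  qed
  then have "\<one> \<ominus> y \<otimes> N \<in> Units R"
    using q y by (simp add: quasinilpotents_def N_def)
  then have "c \<otimes> (\<one> \<ominus> y \<otimes> N) \<in> Units R"
    using c by simp
  moreover have "c \<otimes> (\<one> \<ominus> y \<otimes> N) = c \<ominus> (b \<ominus> v) \<otimes> z"
  proof -
    have "c \<otimes> (y \<otimes> N) = (c \<otimes> inv c) \<otimes> ((w \<otimes> z) \<otimes> N)"
      using c(2) Units_inv_closed [OF c(1)] w(1) z(1) N by (simp only: y_def m_assoc m_closed)
    also have "\<dots> = (b \<ominus> v) \<otimes> z"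
      using c w(1,2) z(1) N wzN by (simp add: b_def v_def m_assoc)
    finally have "c \<otimes> (y \<otimes> N) = (b \<ominus> v) \<otimes> z" .
    then show ?thesis
      using c(2) y N by (simp add: minus_eq r_distr r_minus)
  qed
  ultimately have "c \<ominus> (b \<ominus> v) \<otimes> z \<in> Units R"
    by simp
  moreover have "(b \<ominus> v) \<otimes> (c \<ominus> (b \<ominus> v) \<otimes> z) = x [^] (k * m) \<ominus> u [^] (k * m)"
    using z(2) xc u by (simp add: c_def b_def v_def nat_pow_pow)
  ultimately show "\<exists>W\<in>Units R. (x [^] k \<ominus> u [^] k) \<otimes> W = x [^] (k * m) \<ominus> u [^] (k * m)"
    unfolding b_def v_def by blast
qed

text \<open>From both sides u acts on D like b, so formally [u^k, V] = k b^(k-1) D. The extra factor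
  b avoids the exponent k - 1, also at k = 0. If u^k = 1, the left side vanishes and k b^k D = 0
  remains.\<close>

lemma commutator_pow:
  assumes c: "b \<in> carrier R" "u \<in> carrier R" "V \<in> carrier R"
    and b: "b \<otimes> u = u \<otimes> b" "b \<otimes> V = V \<otimes> b"
    and D_def: "D = u \<otimes> V \<ominus> V \<otimes> u" and bD: "b \<otimes> D = u \<otimes> D" and Db: "D \<otimes> b = D \<otimes> u"
  shows "b \<otimes> (u [^] (k::nat) \<otimes> V \<ominus> V \<otimes> u [^] k) = [k] \<cdot> (b [^] k \<otimes> D)"
proof -
  have D: "D \<in> carrier R"
    using c by (simp add: D_def)
  have bD_comm: "b \<otimes> D = D \<otimes> b"
  proof -
    have "b \<otimes> (u \<otimes> V) = (u \<otimes> V) \<otimes> b" "b \<otimes> (V \<otimes> u) = (V \<otimes> u) \<otimes> b"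
      using c b by (metis m_assoc)+
    then show ?thesis
      using c by (simp add: D_def minus_eq r_distr l_distr r_minus l_minus)
  qed
  have uD: "u [^] k \<otimes> D = b [^] k \<otimes> D" for k :: nat
  proof (induction k)
    case (Suc k)
    have "u [^] Suc k \<otimes> D = u [^] k \<otimes> (D \<otimes> b)"
      using c D bD bD_comm by (simp add: m_assoc)
    also have "\<dots> = b [^] k \<otimes> D \<otimes> b"
      using c D Suc by (simp add: m_assoc [symmetric])
    also have "\<dots> = b [^] Suc k \<otimes> D"
      using c D bD_comm by (simp add: m_assoc)
    finally show ?case .
  qed (use D in simp)
  show ?thesis
  proof (induction k)
    case 0
    then show ?case using c by (simp add: minus_eq r_neg)
  next
    case (Suc k)
    define E where "E = u [^] k \<otimes> V \<ominus> V \<otimes> u [^] k"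
    have E: "E \<in> carrier R"
      using c by (simp add: E_def)
    have "u [^] Suc k \<otimes> V \<ominus> V \<otimes> u [^] Suc k = u [^] k \<otimes> D \<oplus> E \<otimes> u"
      using c unfolding E_def D_def
      by (simp add: minus_eq r_distr l_distr r_minus l_minus m_assoc a_assoc r_neg1)
    then have "b \<otimes> (u [^] Suc k \<otimes> V \<ominus> V \<otimes> u [^] Suc k) = b \<otimes> (b [^] k \<otimes> D) \<oplus> b \<otimes> E \<otimes> u"
      using c D E by (simp add: r_distr m_assoc uD)
    also have "b \<otimes> E \<otimes> u = [k] \<cdot> (b [^] k \<otimes> D \<otimes> u)"
      using Suc c D add_pow_ldistr [of "b [^] k \<otimes> D" u k] by (simp add: E_def)
    also have "b [^] k \<otimes> D \<otimes> u = b [^] Suc k \<otimes> D"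
      using c D bD_comm Db by (simp add: m_assoc)
    also have "b \<otimes> (b [^] k \<otimes> D) = b [^] Suc k \<otimes> D"
      using c D pow_commute [OF c(1) c(1) refl, of k] by (simp add: m_assoc [symmetric])
    finally show ?case
      using c D by (simp add: a_comm)
  qed
qed

end

section \<open>Nakayama's lemma and the Frobenius map modulo the maximal ideal\<close>

lemma (in cring) ideal_mult_right:
  assumes "ideal I R" "b \<in> carrier R"
  shows "ideal ((\<lambda>x. x \<otimes> b) ` I) R"
proof -
  interpret I: ideal I R by fact
  show ?thesis
  proof (rule idealI [OF ring_axioms])
    show "subgroup ((\<lambda>x. x \<otimes> b) ` I) (add_monoid R)"
    proof (rule add.subgroupI)
      show "(\<lambda>x. x \<otimes> b) ` I \<noteq> {}"
        using I.zero_closed by blast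
    next
      fix y assume "y \<in> (\<lambda>x. x \<otimes> b) ` I"
      then obtain x where x: "x \<in> I" "y = x \<otimes> b" by blast
      then have "\<ominus> y = (\<ominus> x) \<otimes> b"
        using assms by (simp add: l_minus)
      then show "\<ominus> y \<in> (\<lambda>x. x \<otimes> b) ` I"
        using x by blast
      fix y' assume "y' \<in> (\<lambda>x. x \<otimes> b) ` I"
      then obtain x' where x': "x' \<in> I" "y' = x' \<otimes> b" by blast
      then have "y \<oplus> y' = (x \<oplus> x') \<otimes> b"
        using assms x by (simp add: l_distr)
      then show "y \<oplus> y' \<in> (\<lambda>x. x \<otimes> b) ` I"
        using x x' by blast
    qed (use assms in auto)
  next
    fix a x assume "a \<in> (\<lambda>x. x \<otimes> b) ` I" and x: "x \<in> carrier R"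
    then obtain y where y: "y \<in> I" "a = y \<otimes> b" by blast
    then have "x \<otimes> a = (x \<otimes> y) \<otimes> b"
      using assms x by (simp add: m_assoc)
    then show xa: "x \<otimes> a \<in> (\<lambda>x. x \<otimes> b) ` I"
      using I.I_l_closed [OF y(1) x] by blast
    have "a \<otimes> x = x \<otimes> a"
      using y assms x by (simp add: m_comm)
    then show "a \<otimes> x \<in> (\<lambda>x. x \<otimes> b) ` I"
      using xa by simp
  qed
qed

text \<open>Nakayama's lemma: the hypothesis says that \<open>B\<close> vanishes modulo \<open>L\<close> plus the products
  \<open>M B\<close>. It is phrased with an arbitrary ideal \<open>K\<close> in place of that sum.\<close>

lemma (in local_ring) nakayama:
  assumes "finite B" "B \<subseteq> carrier R" "ideal L R"
    and "\<And>K. ideal K R \<Longrightarrow> L \<subseteq> K \<Longrightarrow> (\<And>x b. x \<in> M \<Longrightarrow> b \<in> B \<Longrightarrow> x \<otimes> b \<in> K) \<Longrightarrow> B \<subseteq> K"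
  shows "B \<subseteq> L"
  using assms
proof (induction B arbitrary: L rule: finite_induct)
  case (insert b B)
  interpret L: ideal L R by fact
  have b: "b \<in> carrier R" using insert.prems by auto
  \<comment> \<open>The generator b is absorbed into the ideal: over L' = L + R b the remaining B
    inherits the hypothesis, so induction puts B inside L'.\<close>
  define L' where "L' = L <+>\<^bsub>R\<^esub> (\<lambda>x. x \<otimes> b) ` carrier R"
  have L': "ideal L' R"
    unfolding L'_def by (intro add_ideals insert.prems ideal_mult_right oneideal b)
  have L'_iff: "y \<in> L' \<longleftrightarrow> (\<exists>l\<in>L. \<exists>r\<in>carrier R. y = l \<oplus> r \<otimes> b)" for y
    by (auto simp: L'_def set_add_def')
  have LL': "L \<subseteq> L'"
  proof
    fix l assume l: "l \<in> L"
    then have "l = l \<oplus> \<zero> \<otimes> b"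
      using b by (simp add: L.a_Hcarr)
    then show "l \<in> L'"
      using l unfolding L'_iff by blast
  qed
  have bL': "b \<in> L'"
  proof -
    have "b = \<zero> \<oplus> \<one> \<otimes> b" using b by simp
    then show ?thesis
      using L.zero_closed unfolding L'_iff by blast
  qed
  have B: "B \<subseteq> L'"
  proof (rule insert.IH [OF _ L'])
    show "B \<subseteq> carrier R"
      using insert.prems by simp
    fix K assume K: "ideal K R" "L' \<subseteq> K" and MB: "\<And>x b. x \<in> M \<Longrightarrow> b \<in> B \<Longrightarrow> x \<otimes> b \<in> K"
    have "insert b B \<subseteq> K"
    proof (rule insert.prems(3) [OF K(1)])
      show "L \<subseteq> K" using LL' K by simp
      fix x c assume x: "x \<in> M" and "c \<in> insert b B"
      then show "x \<otimes> c \<in> K"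
        using MB ideal.I_l_closed [OF K(1), of b x] bL' K(2) by auto
    qed
    then show "B \<subseteq> K" by simp
  qed
  \<comment> \<open>The hypothesis for K = L + M b yields b = l + x b with x in \<open>M\<close>;
    then (1 - x) b = l with 1 - x invertible, so b lies in L and L' collapses to L.\<close>
  define K where "K = L <+>\<^bsub>R\<^esub> (\<lambda>x. x \<otimes> b) ` M"
  have K: "ideal K R"
    unfolding K_def by (intro add_ideals insert.prems ideal_mult_right nonunits b)
  have K_iff: "y \<in> K \<longleftrightarrow> (\<exists>l\<in>L. \<exists>r\<in>M. y = l \<oplus> r \<otimes> b)" for y
    by (auto simp: K_def set_add_def')
  have "insert b B \<subseteq> K"
  proof (rule insert.prems(3) [OF K])
    show "L \<subseteq> K"
    proof
      fix l assume l: "l \<in> L"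
      then have "l = l \<oplus> \<zero> \<otimes> b"
        using b by (simp add: L.a_Hcarr)
      then show "l \<in> K"
        using l M.zero_closed unfolding K_iff by blast
    qed
    fix x c assume x: "x \<in> M" and "c \<in> insert b B"
    then have "c \<in> L'" using B bL' by auto
    then obtain l r where lr: "l \<in> L" "r \<in> carrier R" "c = l \<oplus> r \<otimes> b"
      unfolding L'_iff by blast
    have xc: "x \<in> carrier R" using x by simp
    have "x \<otimes> c = x \<otimes> l \<oplus> (x \<otimes> r) \<otimes> b"
      using lr xc b L.a_Hcarr [OF lr(1)] by (simp add: r_distr m_assoc)
    then show "x \<otimes> c \<in> K"
      unfolding K_iff using L.I_l_closed [OF lr(1) xc] M.I_r_closed [OF x lr(2)] by blast
  qed
  then have "b \<in> K" by simp
  then obtain l x where lx: "l \<in> L" "x \<in> M" "b = l \<oplus> x \<otimes> b"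
    unfolding K_iff by blast
  have xc: "x \<in> carrier R" and lc: "l \<in> carrier R"
    using lx(1,2) L.a_Hcarr by auto
  have u: "\<one> \<ominus> x \<in> Units R"
    using one_minus_unit lx(2) by simp
  have "(\<one> \<ominus> x) \<otimes> b = b \<ominus> x \<otimes> b"
    using xc b by (simp add: minus_eq l_distr l_minus)
  also have "\<dots> = (l \<oplus> x \<otimes> b) \<ominus> x \<otimes> b"
    by (rule arg_cong [OF lx(3)])
  also have "\<dots> = l"
    using lc xc b by (simp add: minus_eq a_assoc r_neg)
  finally have "inv (\<one> \<ominus> x) \<otimes> ((\<one> \<ominus> x) \<otimes> b) \<in> L"
    using lx(1) u by (simp add: L.I_l_closed)
  then have bL: "b \<in> L"
    using u b xc by (simp add: m_assoc [symmetric])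
  have "L' \<subseteq> L"
  proof
    fix y assume "y \<in> L'"
    then obtain l r where lr: "l \<in> L" "r \<in> carrier R" "y = l \<oplus> r \<otimes> b"
      unfolding L'_iff by blast
    show "y \<in> L"
      unfolding lr(3) by (intro L.a_closed lr(1) L.I_l_closed [OF bL lr(2)])
  qed
  then show ?case
    using B bL by auto
qed simp

context cring
begin

lemma one_plus_pow_binomial:
  assumes z: "z \<in> carrier R"
  shows "(\<one> \<oplus> z) [^] (k::nat) = (\<Oplus>i\<in>{..k}. [(k choose i)] \<cdot>\<^bsub>R\<^esub> (z [^] i))"
proof (induction k)
  case 0
  then show ?case by simp
next
  case (Suc k)
  define f where "f i = [(k choose i)] \<cdot>\<^bsub>R\<^esub> (z [^] i)" for i
  define g where "g i = [(k choose i)] \<cdot>\<^bsub>R\<^esub> (z [^] Suc i)" for i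
  have f: "f i \<in> carrier R" and g: "g i \<in> carrier R" for i
    using z by (simp_all add: f_def g_def)
  \<comment> \<open>The extra index k + 1 contributes nothing, since k choose k + 1 is 0; this
    aligns the two sums for Pascal's rule.\<close>
  have "(\<Oplus>i\<in>{..k}. f (Suc i)) \<oplus> f 0 = (\<Oplus>i\<in>{..Suc k}. f i)"
    using f by (intro finsum_Suc2 [symmetric]) auto
  also have "\<dots> = f (Suc k) \<oplus> (\<Oplus>i\<in>{..k}. f i)"
    using f by (intro finsum_Suc) auto
  also have "\<dots> = (\<Oplus>i\<in>{..k}. f i)"
    using f by (simp add: f_def binomial_eq_0)
  finally have shift: "(\<Oplus>i\<in>{..k}. f (Suc i)) \<oplus> f 0 = (\<Oplus>i\<in>{..k}. f i)" .
  have fz: "(\<Oplus>i\<in>{..k}. f i) \<otimes> z = (\<Oplus>i\<in>{..k}. g i)"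
  proof -
    have "(\<Oplus>i\<in>{..k}. f i) \<otimes> z = (\<Oplus>i\<in>{..k}. f i \<otimes> z)"
      using f z by (intro finsum_ldistr) auto
    also have "\<dots> = (\<Oplus>i\<in>{..k}. g i)"
      using f g z by (intro finsum_cong') (auto simp: f_def g_def add_pow_ldistr)
    finally show ?thesis .
  qed
  have "(\<Oplus>i\<in>{..Suc k}. [(Suc k choose i)] \<cdot>\<^bsub>R\<^esub> (z [^] i))
      = (\<Oplus>i\<in>{..k}. [(Suc k choose Suc i)] \<cdot>\<^bsub>R\<^esub> (z [^] Suc i)) \<oplus> [(Suc k choose 0)] \<cdot>\<^bsub>R\<^esub> (z [^] (0::nat))"
    using z by (intro finsum_Suc2) auto
  also have "(\<Oplus>i\<in>{..k}. [(Suc k choose Suc i)] \<cdot>\<^bsub>R\<^esub> (z [^] Suc i)) = (\<Oplus>i\<in>{..k}. g i \<oplus> f (Suc i))"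
    using z f g by (intro finsum_cong') (auto simp: f_def g_def add.nat_pow_mult)
  also have "\<dots> = (\<Oplus>i\<in>{..k}. g i) \<oplus> (\<Oplus>i\<in>{..k}. f (Suc i))"
    using f g by (intro finsum_addf) auto
  also have "[(Suc k choose 0)] \<cdot>\<^bsub>R\<^esub> (z [^] (0::nat)) = f 0"
    by (simp add: f_def)
  also have "(\<Oplus>i\<in>{..k}. g i) \<oplus> (\<Oplus>i\<in>{..k}. f (Suc i)) \<oplus> f 0 = (\<Oplus>i\<in>{..k}. g i) \<oplus> (\<Oplus>i\<in>{..k}. f i)"
    using f g by (simp add: shift [symmetric] a_assoc)
  also have "\<dots> = (\<Oplus>i\<in>{..k}. f i) \<otimes> (\<one> \<oplus> z)"
    using f g z by (simp add: r_distr fz a_comm)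
  finally show ?case
    using Suc z by (simp add: f_def)
qed

lemma one_plus_pow_prime:
  assumes z: "z \<in> carrier R" and p: "Factorial_Ring.prime p" "[(p::nat)] \<cdot> \<one> = \<zero>"
  shows "(\<one> \<oplus> z) [^] p = \<one> \<oplus> z [^] p"
proof -
  have zero: "[(p choose i)] \<cdot>\<^bsub>R\<^esub> (z [^] i) = \<zero>" if i: "0 < i" "i < p" for i
  proof -
    obtain c where c: "p choose i = p * c"
      using dvd_choose_prime [of i p] i p by (auto elim: dvdE)
    have "[(p choose i)] \<cdot>\<^bsub>R\<^esub> (z [^] i) = [c] \<cdot> ([p] \<cdot> (z [^] i))"
      using z by (simp add: c add.nat_pow_pow)
    also have "[p] \<cdot> (z [^] i) = ([p] \<cdot> \<one>) \<otimes> z [^] i"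
      using z add_pow_ldistr [of \<one> "z [^] i" p] by simp
    finally show ?thesis
      using z p by simp
  qed
  obtain k where k: "p = Suc k"
    using p prime_gt_0_nat [of p] by (cases p) auto
  have "(\<Oplus>i\<in>{..p}. [(p choose i)] \<cdot>\<^bsub>R\<^esub> (z [^] i)) = [(p choose p)] \<cdot>\<^bsub>R\<^esub> (z [^] p) \<oplus> (\<Oplus>i\<in>{..k}. [(p choose i)] \<cdot>\<^bsub>R\<^esub> (z [^] i))"
    unfolding k using z by (intro finsum_Suc) auto
  also have "(\<Oplus>i\<in>{..k}. [(p choose i)] \<cdot>\<^bsub>R\<^esub> (z [^] i)) = [(p choose 0)] \<cdot>\<^bsub>R\<^esub> (z [^] (0::nat))"
    using z zero k by (intro finsum_delta) auto
  finally show ?thesis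
    using one_plus_pow_binomial [OF z] z by (simp add: a_comm)
qed

end

text \<open>The Frobenius map is injective on the residue field: (y - 1)^p = y^p - 1, and an element
  whose p-th power lies in \<open>M\<close> is itself a nonunit.\<close>

lemma (in local_ring) frobenius_cong_one:
  assumes p: "Factorial_Ring.prime p" "[(p::nat)] \<cdot> \<one> = \<zero>" and y: "y \<in> carrier R"
    and cong: "y [^] (p ^ s) \<ominus> \<one> \<in> M"
  shows "y \<ominus> \<one> \<in> M"
  using y cong
proof (induction s arbitrary: y)
  case (Suc s)
  have "(y [^] p) [^] (p ^ s) \<ominus> \<one> \<in> M"
    using Suc.prems by (simp add: nat_pow_pow)
  then have yp: "y [^] p \<ominus> \<one> \<in> M"
    using Suc by simp
  define z where "z = y \<ominus> \<one>"
  have z: "z \<in> carrier R" "y = \<one> \<oplus> z"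
    using Suc.prems by (simp_all add: z_def minus_eq a_lcomm r_neg)
  have "y [^] p \<ominus> \<one> = z [^] p"
    unfolding z(2) one_plus_pow_prime [OF z(1) p] using z(1)
    by (simp add: minus_eq a_comm [of \<one>] a_assoc r_neg)
  then have "z [^] p \<in> M"
    using yp by simp
  then have "z \<notin> Units R"
    using Units_pow_closed [of z p] by blast
  then have "z \<in> M"
    using z(1) by blast
  then show ?case
    unfolding z_def .
qed simp

section \<open>Locality and torsion lifts from the fine property\<close>

context ring
begin

text \<open>u + q = u (1 - x q) with x = - u^(-1), which commutes with q because u does.\<close>

lemma unit_plus_quasinilpotent:
  assumes u: "u \<in> Units R" and q: "q \<in> quasinilpotents R" and comm: "u \<otimes> q = q \<otimes> u"
  shows "u \<oplus> q \<in> Units R"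
proof -
  have c: "u \<in> carrier R" "inv u \<in> carrier R" "q \<in> carrier R"
    using u q by (auto simp: quasinilpotents_def)
  have "q \<otimes> inv u = inv u \<otimes> q"
    using Units_inv_commute [OF u c(3)] comm by simp
  then have "(\<ominus> (inv u)) \<otimes> q = q \<otimes> (\<ominus> (inv u))"
    using c by (simp add: l_minus r_minus)
  then have "\<one> \<ominus> (\<ominus> (inv u)) \<otimes> q \<in> Units R"
    using q c unfolding quasinilpotents_def by blast
  then have "u \<otimes> (\<one> \<ominus> (\<ominus> (inv u)) \<otimes> q) \<in> Units R"
    using u by simp
  also have "u \<otimes> (\<one> \<ominus> (\<ominus> (inv u)) \<otimes> q) = u \<oplus> q"
    using u c by (simp add: minus_eq l_minus r_distr m_assoc [symmetric])
  finally show ?thesis .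
qed

lemma one_mem_torsion_plus_quasinilpotents: "\<one> \<in> torsion_units R <+>\<^bsub>R\<^esub> quasinilpotents R"
proof -
  have "\<one> \<in> torsion_units R"
    by (auto simp: torsion_units_def)
  moreover have "\<zero> \<in> quasinilpotents R"
    by (auto simp: quasinilpotents_def minus_eq)
  moreover have "\<one> = \<one> \<oplus> \<zero>"
    by simp
  ultimately show ?thesis
    unfolding set_add_def' by blast
qed

lemma jacobson_radical_add:
  assumes "x \<in> jacobson_radical R" "y \<in> jacobson_radical R"
  shows "x \<oplus> y \<in> jacobson_radical R"
proof -
  have "x \<oplus> y \<in> I" if "maximal_left_ideal I R" for I
  proof -
    have "additive_subgroup I R" "x \<in> I" "y \<in> I"
      using assms that by (auto simp: jacobson_radical_def maximal_left_ideal_def left_ideal_def)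
    then show ?thesis by (rule additive_subgroup.a_closed)
  qed
  then show ?thesis
    using assms by (auto simp: jacobson_radical_def)
qed

lemma jacobson_radical_mult:
  assumes "r \<in> carrier R" "x \<in> jacobson_radical R"
  shows "r \<otimes> x \<in> jacobson_radical R"
  using assms by (auto simp: jacobson_radical_def maximal_left_ideal_def left_ideal_def)

lemma zero_mem_jacobson_radical: "\<zero> \<in> jacobson_radical R"
  using additive_subgroup.zero_closed
  by (auto simp: jacobson_radical_def maximal_left_ideal_def left_ideal_def)

text \<open>A unit in the radical would put 1 there, but 1 = 1 + 0 is a torsion unit plus a
  quasinilpotent element. Fineness thus replaces an appeal to the existence of maximal left ideals,
  and it rules out the zero ring.\<close>

lemma unit_not_mem_jacobson_radical:
  assumes "generalized_quasi_t_fine R" "u \<in> Units R"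
  shows "u \<notin> jacobson_radical R"
proof
  assume "u \<in> jacobson_radical R"
  then have "inv u \<otimes> u \<in> jacobson_radical R"
    using assms(2) by (intro jacobson_radical_mult) auto
  then show False
    using assms one_mem_torsion_plus_quasinilpotents by (simp add: generalized_quasi_t_fine_def [symmetric])
      (auto simp: generalized_quasi_t_fine_def)
qed

end

context cring
begin

text \<open>In a commutative ring a factor of a unit is a unit, so nonunits absorb multiplication
  and only closure under addition is at stake.\<close>

lemma local_ringI:
  assumes one: "\<one> \<noteq> \<zero>"
    and add: "\<And>x y. x \<in> carrier R \<Longrightarrow> y \<in> carrier R \<Longrightarrow> x \<notin> Units R \<Longrightarrow> y \<notin> Units R \<Longrightarrow> x \<oplus> y \<notin> Units R"
  shows "local_ring R"
proof -
  have mult: "r \<otimes> x \<notin> Units R" if "r \<in> carrier R" "x \<in> carrier R" "x \<notin> Units R" for r x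
    using unit_factor [of x r] that by (auto simp: m_comm)
  have mult': "x \<otimes> r \<notin> Units R" if "r \<in> carrier R" "x \<in> carrier R" "x \<notin> Units R" for r x
    using mult [OF that] that by (simp add: m_comm)
  have zero: "\<zero> \<notin> Units R"
    using one by (metis Units_inv_closed Units_l_inv r_null)
  have "ideal (carrier R - Units R) R"
  proof (rule idealI [OF ring_axioms])
    show "subgroup (carrier R - Units R) (add_monoid R)"
    proof (rule add.subgroupI)
      show "carrier R - Units R \<noteq> {}"
        using zero by blast
    next
      fix x assume "x \<in> carrier R - Units R"
      then show "\<ominus> x \<in> carrier R - Units R"
        using mult [of "\<ominus> \<one>" x] by (auto simp: l_minus)
    next
      fix x y assume "x \<in> carrier R - Units R" "y \<in> carrier R - Units R"
      then show "x \<oplus> y \<in> carrier R - Units R"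
        using add by auto
    qed auto
  qed (use mult mult' in auto)
  then show ?thesis
    by (intro local_ring.intro local_ring_axioms.intro cring_axioms)
qed

text \<open>By commutativity every torsion unit plus a quasinilpotent element is a unit, so fineness
  identifies the nonunits with the radical, which is closed under addition. In u = t + q the summand
  q is no unit, which makes t the lift.\<close>

lemma generalized_quasi_t_fine_imp_local:
  assumes fine: "generalized_quasi_t_fine R"
  shows "local_ring R"
    and "u \<in> Units R \<Longrightarrow> \<exists>t\<in>torsion_units R. u \<ominus> t \<in> carrier R - Units R"
proof -
  have fine': "carrier R - jacobson_radical R = torsion_units R <+>\<^bsub>R\<^esub> quasinilpotents R"
    using fine by (simp add: generalized_quasi_t_fine_def)
  have one: "\<one> \<noteq> \<zero>"
    using unit_not_mem_jacobson_radical [OF fine, of \<one>] zero_mem_jacobson_radical by auto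
  have unit_iff: "x \<in> Units R \<longleftrightarrow> x \<notin> jacobson_radical R" if x: "x \<in> carrier R" for x
  proof
    assume "x \<notin> jacobson_radical R"
    then have "x \<in> torsion_units R <+>\<^bsub>R\<^esub> quasinilpotents R"
      using x fine' by blast
    then obtain t q where "t \<in> torsion_units R" "q \<in> quasinilpotents R" "x = t \<oplus> q"
      by (auto simp: set_add_def')
    then show "x \<in> Units R"
      by (auto simp: torsion_units_def quasinilpotents_def m_comm Units_closed intro!: unit_plus_quasinilpotent)
  qed (use unit_not_mem_jacobson_radical [OF fine] in blast)
  show "local_ring R"
    using jacobson_radical_add one by (intro local_ringI) (auto simp: unit_iff)
  assume u: "u \<in> Units R"
  then have "u \<in> torsion_units R <+>\<^bsub>R\<^esub> quasinilpotents R"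
    using fine' unit_not_mem_jacobson_radical [OF fine u] by auto
  then obtain t q where tq: "t \<in> torsion_units R" "q \<in> quasinilpotents R" "u = t \<oplus> q"
    by (auto simp: set_add_def')
  have c: "t \<in> carrier R" "q \<in> carrier R"
    using tq by (auto simp: torsion_units_def quasinilpotents_def)
  have "u \<ominus> t = q"
    unfolding tq(3) using c by (simp add: minus_eq a_assoc a_comm [of q] r_neg2)
  then show "\<exists>t\<in>torsion_units R. u \<ominus> t \<in> carrier R - Units R"
    using tq c one quasinilpotent_not_unit by (intro bexI [of _ t]) auto
qed

end

lemma (in local_ring) generalized_quasi_t_fineI:
  assumes lift: "\<And>u. u \<in> Units R \<Longrightarrow> \<exists>t\<in>torsion_units R. u \<ominus> t \<in> M"
  shows "generalized_quasi_t_fine R"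
  unfolding generalized_quasi_t_fine_def jacobson_radical_eq
proof (intro equalityI subsetI)
  fix u assume u: "u \<in> carrier R - M"
  then obtain t where t: "t \<in> torsion_units R" "u \<ominus> t \<in> M"
    using lift by auto
  have c: "t \<in> carrier R" "u \<in> carrier R"
    using t u by (auto simp: torsion_units_def)
  have "u \<ominus> t \<in> quasinilpotents R"
    using t(2) c by (intro quasinilpotentI [OF one_minus_unit nonunits, of _ 1]) simp_all
  moreover have "u = t \<oplus> (u \<ominus> t)"
    using c by (simp add: minus_eq a_lcomm [of t u] r_neg)
  ultimately show "u \<in> torsion_units R <+>\<^bsub>R\<^esub> quasinilpotents R"
    using t unfolding set_add_def' by blast
next
  fix u assume "u \<in> torsion_units R <+>\<^bsub>R\<^esub> quasinilpotents R"
  then obtain t q where tq: "t \<in> torsion_units R" "q \<in> quasinilpotents R" "u = t \<oplus> q"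
    by (auto simp: set_add_def')
  then have "t \<in> Units R" "t \<otimes> q = q \<otimes> t"
    by (auto simp: torsion_units_def quasinilpotents_def intro: m_comm)
  then have "u \<in> Units R"
    unfolding tq(3) using tq(2) by (intro unit_plus_quasinilpotent)
  then show "u \<in> carrier R - M" by auto
qed

text \<open>The nonunits of \<open>R\<close> are the \<open>a\<close> whose scalar matrix lies in the Jacobson radical, and
  these are closed under addition.\<close>

lemma (in comm_matrices) generalized_quasi_t_fine_mat_imp_local:
  assumes n: "n > 0" and fine: "generalized_quasi_t_fine S"
  shows "local_ring R"
proof (rule local_ringI)
  have fine': "carrier S - jacobson_radical S = torsion_units S <+>\<^bsub>S\<^esub> quasinilpotents S"
    using fine by (simp add: generalized_quasi_t_fine_def)
  have unit_iff: "x \<in> Units R \<longleftrightarrow> scal x \<notin> jacobson_radical S" if x: "x \<in> carrier R" for x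
  proof
    assume "x \<in> Units R"
    then show "scal x \<notin> jacobson_radical S"
      by (intro mat.unit_not_mem_jacobson_radical fine scal_unit)
  next
    assume "scal x \<notin> jacobson_radical S"
    then have "scal x \<in> torsion_units S <+>\<^bsub>S\<^esub> quasinilpotents S"
      using x fine' scal_closed by blast
    then obtain U N where UN: "U \<in> torsion_units S" "N \<in> quasinilpotents S" "scal x = U \<oplus>\<^bsub>S\<^esub> N"
      by (auto simp: set_add_def')
    have c: "U \<in> carrier S" "N \<in> carrier S" and U: "U \<in> Units S"
      using UN by (auto simp: torsion_units_def quasinilpotents_def)
    \<comment> \<open>Scalar matrices are central, so N = scal x - U commutes with U and their sum
      is a unit.\<close>
    have "N = scal x \<ominus>\<^bsub>S\<^esub> U"
      unfolding UN(3) using c by (simp add: mat.minus_eq mat.a_assoc mat.a_comm [of N] mat.r_neg2)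
    then have "U \<otimes>\<^bsub>S\<^esub> N = N \<otimes>\<^bsub>S\<^esub> U"
      using c(1) x scal_comm [OF x c(1)]
      by (simp add: mat.minus_eq mat.l_distr mat.r_distr mat.l_minus mat.r_minus)
    then have "scal x \<in> Units S"
      unfolding UN(3) using U UN(2) by (intro mat.unit_plus_quasinilpotent)
    then obtain V where V: "V \<in> carrier S" "scal x \<otimes>\<^bsub>S\<^esub> V = \<one>\<^bsub>S\<^esub>"
      using mat.Units_r_inv mat.Units_inv_closed by blast
    then have "x \<otimes> V $$ (0, 0) = \<one>"
      using scal_mult_entry [OF x V(1) n n] n by simp
    then show "x \<in> Units R"
      using x V n by (intro UnitsI [of x "V $$ (0, 0)"]) (auto simp: m_comm)
  qed
  show "\<one> \<noteq> \<zero>"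
    using unit_iff [of \<zero>] mat.zero_mem_jacobson_radical Units_one_closed scal_zero by force
  fix x y assume "x \<in> carrier R" "y \<in> carrier R" "x \<notin> Units R" "y \<notin> Units R"
  then show "x \<oplus> y \<notin> Units R"
    using mat.jacobson_radical_add [of "scal x" "scal y"] unit_iff [of x] unit_iff [of y]
      unit_iff [of "x \<oplus> y"] scal_add [of x y] by auto
qed

section \<open>Torsion matrices congruent to scalars, and torsion lifts of units\<close>

context local_matrices
begin

text \<open>Modulo an ideal K that contains the products of \<open>M\<close> with the entries of D =
  [U, V], the matrix b - U annihilates D on both sides. So \<open>commutator_pow\<close> applies in
  the quotient ring, and U^m = 1 leaves m b^m D = 0 there with m b^m a unit. Nakayama's lemma turns
  this into D = 0.\<close>

lemma commute_of_torsion_cong: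
  assumes b: "b \<in> Units R" and U: "U \<in> carrier S" and cong: "scal b \<ominus>\<^bsub>S\<^esub> U \<in> matset M"
    and m: "U [^]\<^bsub>S\<^esub> (m::nat) = \<one>\<^bsub>S\<^esub>" "[m] \<cdot> \<one> \<in> Units R" and V: "V \<in> carrier S"
  shows "U \<otimes>\<^bsub>S\<^esub> V = V \<otimes>\<^bsub>S\<^esub> U"
proof -
  have bc: "b \<in> carrier R" using b by auto
  define D where "D = U \<otimes>\<^bsub>S\<^esub> V \<ominus>\<^bsub>S\<^esub> V \<otimes>\<^bsub>S\<^esub> U"
  define Z where "Z = scal b \<ominus>\<^bsub>S\<^esub> U"
  define B where "B = (\<lambda>(i, j). D $$ (i, j)) ` ({..<n} \<times> {..<n})"
  have D: "D \<in> carrier S" and Z: "Z \<in> carrier S"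
    using U V bc by (simp_all add: D_def Z_def)
  have ZM: "Z $$ (i, j) \<in> M" if "i < n" "j < n" for i j
    using cong that unfolding Z_def matset_iff by blast
  have B_iff: "y \<in> B \<longleftrightarrow> (\<exists>i<n. \<exists>j<n. y = D $$ (i, j))" for y
    by (auto simp: B_def)
  have "B \<subseteq> {\<zero>}"
  proof (rule nakayama)
    show "finite B" by (simp add: B_def)
    show "B \<subseteq> carrier R"
      using D by (auto simp: B_iff)
    show "ideal {\<zero>} R" by (rule zeroideal)
    fix K assume K: "ideal K R" and MB: "\<And>x b. x \<in> M \<Longrightarrow> b \<in> B \<Longrightarrow> x \<otimes> b \<in> K"
    interpret K: ideal K R by fact
    interpret I: ideal "matset K" S by (rule matset_ideal [OF K])
    define T where "T = S Quot matset K"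
    define h where "h = (+>\<^bsub>S\<^esub>) (matset K)"
    interpret h: ring_hom_ring S T h
      unfolding T_def h_def by (rule I.rcos_ring_hom_ring)
    have h_eq: "h x = h y \<longleftrightarrow> x \<ominus>\<^bsub>S\<^esub> y \<in> matset K" if "x \<in> carrier S" "y \<in> carrier S" for x y
      unfolding h_def using mat.quotient_eq_iff_same_a_r_cos [OF I.ideal_axioms that] by simp
    have MD: "x \<otimes> D $$ (i, j) \<in> K" if "x \<in> M" "i < n" "j < n" for x i j
      using that by (intro MB) (auto simp: B_iff)
    have DM: "D $$ (i, j) \<otimes> x \<in> K" if "x \<in> M" "i < n" "j < n" for x i j
      using MD [OF that] m_comm [of "D $$ (i, j)" x] that D by auto
    have "Z \<otimes>\<^bsub>S\<^esub> D \<in> matset K" "D \<otimes>\<^bsub>S\<^esub> Z \<in> matset K"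
      unfolding matset_iff using Z D ZM by (auto simp: mult_entry intro!: K.finsum_mem MD DM)
    moreover have "Z \<otimes>\<^bsub>S\<^esub> D = scal b \<otimes>\<^bsub>S\<^esub> D \<ominus>\<^bsub>S\<^esub> U \<otimes>\<^bsub>S\<^esub> D" "D \<otimes>\<^bsub>S\<^esub> Z = D \<otimes>\<^bsub>S\<^esub> scal b \<ominus>\<^bsub>S\<^esub> D \<otimes>\<^bsub>S\<^esub> U"
      unfolding Z_def using bc U D
      by (simp_all add: mat.minus_eq mat.l_distr mat.r_distr mat.l_minus mat.r_minus)
    ultimately have hD: "h (scal b) \<otimes>\<^bsub>T\<^esub> h D = h U \<otimes>\<^bsub>T\<^esub> h D" "h D \<otimes>\<^bsub>T\<^esub> h (scal b) = h D \<otimes>\<^bsub>T\<^esub> h U"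
      using h_eq [of "scal b \<otimes>\<^bsub>S\<^esub> D" "U \<otimes>\<^bsub>S\<^esub> D"] h_eq [of "D \<otimes>\<^bsub>S\<^esub> scal b" "D \<otimes>\<^bsub>S\<^esub> U"] bc U D
      by (simp_all only: h.hom_mult scal_closed mat.m_closed)
    have hc: "h (scal b) \<in> carrier T" "h U \<in> carrier T" "h V \<in> carrier T" "h D \<in> carrier T"
      using bc U V D by simp_all
    have hbU: "h (scal b) \<otimes>\<^bsub>T\<^esub> h U = h U \<otimes>\<^bsub>T\<^esub> h (scal b)" "h (scal b) \<otimes>\<^bsub>T\<^esub> h V = h V \<otimes>\<^bsub>T\<^esub> h (scal b)"
      using bc U V scal_comm [OF bc U] scal_comm [OF bc V] by (metis h.hom_mult scal_closed)+
    have hDdef: "h D = h U \<otimes>\<^bsub>T\<^esub> h V \<ominus>\<^bsub>T\<^esub> h V \<otimes>\<^bsub>T\<^esub> h U"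
      unfolding D_def using U V by (simp add: mat.minus_eq h.S.minus_eq)
    have "h (scal b) \<otimes>\<^bsub>T\<^esub> (h U [^]\<^bsub>T\<^esub> m \<otimes>\<^bsub>T\<^esub> h V \<ominus>\<^bsub>T\<^esub> h V \<otimes>\<^bsub>T\<^esub> h U [^]\<^bsub>T\<^esub> m)
        = [m] \<cdot>\<^bsub>T\<^esub> (h (scal b) [^]\<^bsub>T\<^esub> m \<otimes>\<^bsub>T\<^esub> h D)"
      by (rule h.S.commutator_pow [OF hc(1-3) hbU hDdef hD])
    moreover have "h U [^]\<^bsub>T\<^esub> m = \<one>\<^bsub>T\<^esub>"
      using h.hom_nat_pow [OF U, of m] m by simp
    ultimately have "[m] \<cdot>\<^bsub>T\<^esub> (h (scal b) [^]\<^bsub>T\<^esub> m \<otimes>\<^bsub>T\<^esub> h D) = \<zero>\<^bsub>T\<^esub>"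
      using hc by (simp add: h.S.minus_eq h.S.r_neg)
    moreover have h_add_pow: "h ([k] \<cdot>\<^bsub>S\<^esub> x) = [k] \<cdot>\<^bsub>T\<^esub> h x" if "x \<in> carrier S" for x and k :: nat
      using that by (induction k) simp_all
    moreover define e where "e = [m] \<cdot> (b [^] m)"
    have "e = ([m] \<cdot> \<one>) \<otimes> b [^] m"
      using bc add_pow_ldistr [of \<one> "b [^] m" m] by (simp add: e_def)
    then have e: "e \<in> Units R"
      using m b by (auto intro!: Units_m_closed Units_pow_closed)
    then have ec: "e \<in> carrier R" by auto
    have "scal e \<otimes>\<^bsub>S\<^esub> D = [m] \<cdot>\<^bsub>S\<^esub> (scal b [^]\<^bsub>S\<^esub> m \<otimes>\<^bsub>S\<^esub> D)"
      using bc D mat.add_pow_ldistr [of "scal b [^]\<^bsub>S\<^esub> m" D m] by (simp add: e_def scal_add_pow scal_pow)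
    then have "h (scal e \<otimes>\<^bsub>S\<^esub> D) = [m] \<cdot>\<^bsub>T\<^esub> (h (scal b) [^]\<^bsub>T\<^esub> m \<otimes>\<^bsub>T\<^esub> h D)"
      using bc D h.hom_nat_pow [of "scal b" m] h_add_pow [of "scal b [^]\<^bsub>S\<^esub> m \<otimes>\<^bsub>S\<^esub> D" m] by simp
    ultimately have "h (scal e \<otimes>\<^bsub>S\<^esub> D) = h \<zero>\<^bsub>S\<^esub>"
      by simp
    then have "scal e \<otimes>\<^bsub>S\<^esub> D \<in> matset K"
      using h_eq [of "scal e \<otimes>\<^bsub>S\<^esub> D" "\<zero>\<^bsub>S\<^esub>"] ec D by (simp add: mat.minus_eq)
    then have eD: "e \<otimes> D $$ (i, j) \<in> K" if "i < n" "j < n" for i j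
      using that \<open>scal e \<otimes>\<^bsub>S\<^esub> D \<in> matset K\<close> scal_mult_entry [OF ec D that] unfolding matset_iff by metis
    show "B \<subseteq> K"
    proof
      fix y assume "y \<in> B"
      then obtain i j where ij: "i < n" "j < n" "y = D $$ (i, j)" by (auto simp: B_iff)
      have "inv e \<otimes> (e \<otimes> y) \<in> K"
        unfolding ij(3) using e by (intro K.I_l_closed eD ij) auto
      moreover have "y \<in> carrier R" using ij D by simp
      ultimately show "y \<in> K"
        using e ec by (simp add: m_assoc [symmetric])
    qed
  qed
  then have D0: "D $$ (i, j) = \<zero>" if "i < n" "j < n" for i j
    using that B_iff by blast
  show ?thesis
  proof (rule mat_eqI)
    fix i j assume ij: "i < n" "j < n"
    have "(U \<otimes>\<^bsub>S\<^esub> V) $$ (i, j) \<ominus> (V \<otimes>\<^bsub>S\<^esub> U) $$ (i, j) = \<zero>"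
      using D0 [OF ij] U V ij by (simp add: D_def)
    then show "(U \<otimes>\<^bsub>S\<^esub> V) $$ (i, j) = (V \<otimes>\<^bsub>S\<^esub> U) $$ (i, j)"
      using U V ij r_right_minus_eq by simp
  qed (use U V in auto)
qed

lemma scalar_of_commute:
  assumes n: "n > 0" and U: "U \<in> carrier S"
    and comm: "\<And>V. V \<in> carrier S \<Longrightarrow> U \<otimes>\<^bsub>S\<^esub> V = V \<otimes>\<^bsub>S\<^esub> U"
  shows "U = scal (U $$ (0, 0))"
proof (rule mat_eqI [OF U])
  show "scal (U $$ (0, 0)) \<in> carrier S"
    using U n by simp
  have entry: "(U \<otimes>\<^bsub>S\<^esub> elem k l \<one>) $$ (i, j) = (elem k l \<one> \<otimes>\<^bsub>S\<^esub> U) $$ (i, j)" for i j k l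
    using comm by simp
  fix i j assume ij: "i < n" "j < n"
  show "U $$ (i, j) = scal (U $$ (0, 0)) $$ (i, j)"
  \<comment> \<open>Commuting with E_i0 compares U_ii with U_00 at position (i, 0); commuting with
    E_jj forces U_ij = 0 at position (i, j).\<close>
  proof (cases "i = j")
    case True
    then show ?thesis
      using entry [of i 0 i 0] U n ij by simp
  next
    case False
    then show ?thesis
      using entry [of j j i j] U n ij by simp
  qed
qed

lemma pow_cong_M:
  assumes "x \<in> carrier R" "y \<in> carrier R" "x \<ominus> y \<in> M"
  shows "x [^] (k::nat) \<ominus> y [^] k \<in> M"
  using pow_diff_factor [of x y k] assms M.I_r_closed m_comm by metis

lemma torsion_lift:
  assumes n: "n > 0" and fine: "generalized_quasi_t_fine S"
    and p: "Factorial_Ring.prime p" "[(p::nat)] \<cdot> \<one> = \<zero>" and a: "a \<in> Units R"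
  shows "\<exists>t\<in>torsion_units R. a \<ominus> t \<in> M"
proof -
  have ac: "a \<in> carrier R" using a by auto
  have one: "\<one>\<^bsub>S\<^esub> \<noteq> \<zero>\<^bsub>S\<^esub>"
  proof
    assume "\<one>\<^bsub>S\<^esub> = \<zero>\<^bsub>S\<^esub>"
    then have "\<one>\<^bsub>S\<^esub> $$ (0, 0) = \<zero>\<^bsub>S\<^esub> $$ (0, 0)" by simp
    then have "\<one> \<in> M" using n M.zero_closed by simp
    then show False by simp
  qed
  have "scal a \<in> carrier S - jacobson_radical S"
    using mat.unit_not_mem_jacobson_radical [OF fine scal_unit [OF a]] ac by simp
  then obtain U N where UN: "U \<in> torsion_units S" "N \<in> quasinilpotents S" "scal a = U \<oplus>\<^bsub>S\<^esub> N"
  proof -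
    have "scal a \<in> torsion_units S <+>\<^bsub>S\<^esub> quasinilpotents S"
      using fine \<open>scal a \<in> carrier S - jacobson_radical S\<close> unfolding generalized_quasi_t_fine_def by blast
    then show ?thesis
      using that by (auto simp: set_add_def')
  qed
  obtain m0 :: nat where m0: "m0 \<ge> 1" "U [^]\<^bsub>S\<^esub> m0 = \<one>\<^bsub>S\<^esub>" and U: "U \<in> carrier S"
    using UN by (auto simp: torsion_units_def)
  have N: "N \<in> carrier S"
    using UN by (simp add: quasinilpotents_def)
  have "scal a \<ominus>\<^bsub>S\<^esub> U = N"
    unfolding UN(3) using U N by (simp add: mat.minus_eq mat.a_assoc mat.a_comm [of N] mat.r_neg2)
  then have quasi: "scal a \<ominus>\<^bsub>S\<^esub> U \<in> quasinilpotents S"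
    using UN by simp
  \<comment> \<open>Splitting off the p-part p^s of the order leaves m prime to p, so that m times 1
    is invertible by a Bezout relation m x = p y + 1.\<close>
  define s where "s = multiplicity p m0"
  obtain m where m: "m0 = p ^ s * m" "\<not> p dvd m"
  proof -
    have "m0 \<noteq> 0" "\<not> is_unit p"
      using m0 p not_prime_unit by auto
    then show ?thesis
      using that unfolding s_def by (rule multiplicity_decompose')
  qed
  define q where "q = p ^ s"
  have m_pos: "m > 0" and q_pos: "q \<noteq> 0"
    using m m0 p by (auto simp: q_def intro: Nat.gr0I)
  have "coprime p m"
    using p m by (simp add: prime_imp_coprime)
  then have cop: "coprime q m"
    by (simp add: q_def)
  have m_unit: "[m] \<cdot> \<one> \<in> Units R"
  proof -
    obtain x y where "m * x = p * y + gcd m p"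
      using bezout_nat [of m p] m_pos by auto
    then have xy: "m * x = p * y + 1"
      using \<open>coprime p m\<close> by (simp add: gcd.commute [of m])
    have mult: "[(i * j)] \<cdot> \<one> = ([i] \<cdot> \<one>) \<otimes> ([j] \<cdot> \<one>)" for i j :: nat
      using add_pow_rdistr [of "[i] \<cdot> \<one>" \<one> j] by (simp add: add.nat_pow_pow)
    have "([m] \<cdot> \<one>) \<otimes> ([x] \<cdot> \<one>) = [(p * y + 1)] \<cdot> \<one>"
      by (simp only: mult [symmetric] xy)
    also have "\<dots> = ([p] \<cdot> \<one>) \<otimes> ([y] \<cdot> \<one>) \<oplus> \<one>"
      by (simp add: mult [symmetric])
    also have "\<dots> = \<one>"
      using p by simp
    finally show ?thesis
      by (intro UnitsI [of _ "[x] \<cdot> \<one>"]) (auto simp: m_comm)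
  qed
  then have m_unit_S: "[m] \<cdot>\<^bsub>S\<^esub> \<one>\<^bsub>S\<^esub> \<in> Units S"
    using scal_unit [of "[m] \<cdot> \<one>"] by (simp add: scal_add_pow scal_one)
  note diff = mat.quasinilpotent_pow_diff [OF scal_unit [OF a] U scal_comm [OF ac U] quasi m_pos m_unit_S, of q]
  define b where "b = a [^] q"
  have b: "b \<in> Units R" "b \<in> carrier R"
    using a ac by (auto simp: b_def intro: Units_pow_closed)
  define U' where "U' = U [^]\<^bsub>S\<^esub> q"
  have U': "U' \<in> carrier S" "U' [^]\<^bsub>S\<^esub> m = \<one>\<^bsub>S\<^esub>"
    using U m0 m by (auto simp: U'_def q_def mat.nat_pow_pow)
  \<comment> \<open>Since U^(q m) = 1, the (q m)-th powers of scal a and U differ by a scalar matrix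
    again, and by \<open>diff\<close> this is scal b - U' times a unit.\<close>
  define c where "c = a [^] (q * m) \<ominus> \<one>"
  have c: "c \<in> carrier R" using ac by (simp add: c_def)
  have "scal a [^]\<^bsub>S\<^esub> (q * m) \<ominus>\<^bsub>S\<^esub> U [^]\<^bsub>S\<^esub> (q * m) = scal c"
    using ac m m0 by (simp add: c_def scal_minus scal_pow scal_one q_def)
  then obtain W where W: "W \<in> Units S" "(scal b \<ominus>\<^bsub>S\<^esub> U') \<otimes>\<^bsub>S\<^esub> W = scal c"
    using diff(1) ac by (auto simp: b_def U'_def scal_pow)
  have Wc: "W \<in> carrier S" "inv\<^bsub>S\<^esub> W \<in> carrier S"
    using W by auto
  have N': "scal b \<ominus>\<^bsub>S\<^esub> U' = scal c \<otimes>\<^bsub>S\<^esub> inv\<^bsub>S\<^esub> W"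
    unfolding W(2) [symmetric] using W(1) Wc b U' by (simp add: mat.m_assoc)
  \<comment> \<open>A unit c would make scal b - U' a unit, which \<open>diff\<close> excludes. So
    one scalar condition controls every entry of scal b - U'.\<close>
  have cM: "c \<in> M"
  proof (rule ccontr)
    assume "c \<notin> M"
    then have "scal c \<otimes>\<^bsub>S\<^esub> inv\<^bsub>S\<^esub> W \<in> Units S"
      using c W by (intro mat.Units_m_closed scal_unit mat.Units_inv_Units) auto
    then show False
      using diff(2) one ac unfolding N' [symmetric] by (simp add: b_def U'_def scal_pow)
  qed
  have cong: "scal b \<ominus>\<^bsub>S\<^esub> U' \<in> matset M"
  proof -
    have "scal c \<in> matset M"
      unfolding matset_iff using cM c M.zero_closed scal_entry scal_closed by metis
    then show ?thesis
      unfolding N' using Wc(2) by (rule MS.I_r_closed)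
  qed
  define \<beta> where "\<beta> = U' $$ (0, 0)"
  have \<beta>c: "\<beta> \<in> carrier R"
    using U' n by (simp add: \<beta>_def)
  have U'_eq: "U' = scal \<beta>"
    unfolding \<beta>_def using commute_of_torsion_cong [OF b(1) U'(1) cong U'(2) m_unit]
    by (intro scalar_of_commute n U') auto
  have \<beta>m: "\<beta> [^] m = \<one>"
  proof (rule scal_inj [OF n])
    show "scal (\<beta> [^] m) = scal \<one>"
      using U'(2) \<beta>c by (simp add: U'_eq scal_pow scal_one)
  qed
  have b\<beta>: "b \<ominus> \<beta> \<in> M"
  proof -
    have "(scal b \<ominus>\<^bsub>S\<^esub> U') $$ (0, 0) \<in> M"
      using cong n unfolding matset_iff by blast
    then show ?thesis
      using n b \<beta>c by (simp add: U'_eq)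
  qed
  \<comment> \<open>That c lies in \<open>M\<close> means a^(q m) = 1 modulo \<open>M\<close>;
    injectivity of the Frobenius map strips the factor q = p^s.\<close>
  have am: "a [^] m \<ominus> \<one> \<in> M"
  proof (rule frobenius_cong_one [OF p])
    show "(a [^] m) [^] (p ^ s) \<ominus> \<one> \<in> M"
      using cM ac by (simp add: c_def nat_pow_pow q_def mult.commute)
  qed (use ac in simp)
  \<comment> \<open>The exponent l inverts q modulo m: modulo \<open>M\<close>, t = \<beta>^l equals
    b^l = a^(q l) = a (a^m)^r, which is a.\<close>
  obtain l r where "q * l = m * r + gcd q m"
    using bezout_nat [OF q_pos, of m] by auto
  then have lr: "q * l = m * r + 1"
    using cop by simp
  define t where "t = \<beta> [^] l"
  have tc: "t \<in> carrier R" using \<beta>c by (simp add: t_def)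
  have tm: "t [^] m = \<one>"
  proof -
    have "t [^] m = (\<beta> [^] m) [^] l"
      using \<beta>c by (simp add: t_def nat_pow_pow mult.commute)
    then show ?thesis by (simp add: \<beta>m)
  qed
  obtain m' where m': "m = Suc m'"
    using m_pos by (cases m) auto
  have "t \<in> Units R"
    using tm tc by (intro UnitsI [of t "t [^] m'"]) (auto simp: m' m_comm)
  then have "t \<in> torsion_units R"
    using tm m_pos unfolding torsion_units_def by (intro CollectI conjI exI [of _ m]) auto
  moreover have "a \<ominus> t \<in> M"
  proof -
    have 1: "b [^] l \<ominus> t \<in> M"
      unfolding t_def using b(2) \<beta>c b\<beta> by (rule pow_cong_M)
    have "(a [^] m) [^] r \<ominus> \<one> [^] r \<in> M"
      using ac am by (intro pow_cong_M) auto
    then have 2: "a \<otimes> ((a [^] m) [^] r \<ominus> \<one>) \<in> M"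
      using ac by (intro M.I_l_closed) auto
    have "b [^] l = a \<otimes> (a [^] m) [^] r"
    proof -
      have "b [^] l = a [^] (m * r + 1)"
        using ac by (simp add: b_def nat_pow_pow lr)
      then show ?thesis
        using ac by (simp add: nat_pow_pow m_comm)
    qed
    then have "b [^] l \<ominus> a \<in> M"
      using 2 ac by (simp add: minus_eq r_distr r_minus)
    with 1 have "(b [^] l \<ominus> t) \<oplus> \<ominus> (b [^] l \<ominus> a) \<in> M"
      by (intro M.a_closed M.a_inv_closed)
    moreover have "(b [^] l \<ominus> t) \<oplus> \<ominus> (b [^] l \<ominus> a) = a \<ominus> t"
    proof -
      define y where "y = b [^] l"
      have "y \<in> carrier R" using b by (simp add: y_def)
      then have "(y \<ominus> t) \<oplus> \<ominus> (y \<ominus> a) = a \<ominus> t"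
        using tc ac by algebra
      then show ?thesis by (simp add: y_def)
    qed
    ultimately show ?thesis by simp
  qed
  ultimately show ?thesis by blast
qed

end

text \<open>Descent on m: if m = p k annihilates 1, then p or the smaller k does, as a field has no
  zero divisors.\<close>

lemma (in field) exists_prime_characteristic:
  assumes "m > 0" "[(m::nat)] \<cdot> \<one> = \<zero>"
  shows "\<exists>p::nat. Factorial_Ring.prime p \<and> [p] \<cdot> \<one> = \<zero>"
  using assms
proof (induction m rule: less_induct)
  case (less m)
  have "m \<noteq> 1"
    using less.prems by auto
  then obtain p where p: "Factorial_Ring.prime p" "p dvd m"
    using prime_factor_nat by blast
  then obtain k where k: "m = p * k" by (auto elim: dvdE)
  have "([p] \<cdot> \<one>) \<otimes> ([k] \<cdot> \<one>) = [m] \<cdot> \<one>"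
    using add_pow_rdistr [of "[p] \<cdot> \<one>" \<one> k] by (simp add: add.nat_pow_pow k)
  then have "[p] \<cdot> \<one> = \<zero> \<or> [k] \<cdot> \<one> = \<zero>"
    using less.prems by (intro integral) auto
  moreover have "0 < k" "k < m"
    using k p less.prems prime_gt_1_nat [of p] by auto
  ultimately show ?case
    using p less.IH by blast
qed

theorem proposition3p8:
  fixes F :: "('a, 'm) ring_scheme"
    and R :: "('a, 'b, 'k) module_scheme"
    and n :: nat
  assumes "field F"
    and "\<exists>p::nat. p > 0 \<and> [p] \<cdot>\<^bsub>F\<^esub> \<one>\<^bsub>F\<^esub> = \<zero>\<^bsub>F\<^esub>"
    and "infinite (carrier F) \<or> card (carrier F) \<ge> 3"
    and "algebra F R"
    and "n > 0"
  shows "generalized_quasi_t_fine (matrix_ring n R) \<longleftrightarrow> generalized_quasi_t_fine R"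
proof -
  interpret F: field F by fact
  interpret R: cring R
    using assms(4) by (rule algebra.axioms(2))
  interpret alg: algebra F R by fact
  interpret comm_matrices R n
    by (intro comm_matrices.intro matrices.intro R.cring_axioms R.ring_axioms)
  \<comment> \<open>The structure map x -> x 1 carries the characteristic from F to R.\<close>
  have char: "[k] \<cdot>\<^bsub>F\<^esub> \<one>\<^bsub>F\<^esub> \<odot>\<^bsub>R\<^esub> \<one>\<^bsub>R\<^esub> = [k] \<cdot>\<^bsub>R\<^esub> \<one>\<^bsub>R\<^esub>" for k :: nat
    by (induction k) (simp_all add: alg.smult_l_distr)
  obtain p :: nat where p: "Factorial_Ring.prime p" "[p] \<cdot>\<^bsub>F\<^esub> \<one>\<^bsub>F\<^esub> = \<zero>\<^bsub>F\<^esub>"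
    using assms(2) F.exists_prime_characteristic by blast
  have pR: "p > 0" "[p] \<cdot>\<^bsub>R\<^esub> \<one>\<^bsub>R\<^esub> = \<zero>\<^bsub>R\<^esub>"
    using char [of p] p by (simp_all add: prime_gt_0_nat)
  have unit: "x \<odot>\<^bsub>R\<^esub> \<one>\<^bsub>R\<^esub> \<in> Units R" if "x \<in> carrier F" "x \<noteq> \<zero>\<^bsub>F\<^esub>" for x
  proof -
    have x: "x \<in> Units F"
      using that by (simp add: F.field_Units)
    have mult: "(y \<odot>\<^bsub>R\<^esub> \<one>\<^bsub>R\<^esub>) \<otimes>\<^bsub>R\<^esub> (z \<odot>\<^bsub>R\<^esub> \<one>\<^bsub>R\<^esub>) = (y \<otimes>\<^bsub>F\<^esub> z) \<odot>\<^bsub>R\<^esub> \<one>\<^bsub>R\<^esub>"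
      if "y \<in> carrier F" "z \<in> carrier F" for y z
      using that by (simp add: alg.smult_assoc2 alg.smult_assoc1)
    show ?thesis
      using x mult [of x "inv\<^bsub>F\<^esub> x"] mult [of "inv\<^bsub>F\<^esub> x" x] that(1)
      by (intro R.UnitsI [of _ "inv\<^bsub>F\<^esub> x \<odot>\<^bsub>R\<^esub> \<one>\<^bsub>R\<^esub>"]) simp_all
  qed
  \<comment> \<open>An element x other than 0 and 1 makes both l and l - 1 units of R, being images
    of nonzero field elements.\<close>
  have "\<not> carrier F \<subseteq> {\<zero>\<^bsub>F\<^esub>, \<one>\<^bsub>F\<^esub>}"
  proof
    assume sub: "carrier F \<subseteq> {\<zero>\<^bsub>F\<^esub>, \<one>\<^bsub>F\<^esub>}"
    then have "card (carrier F) \<le> card {\<zero>\<^bsub>F\<^esub>, \<one>\<^bsub>F\<^esub>}"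
      by (intro card_mono) auto
    also have "\<dots> \<le> 2"
      by (simp add: card_insert_if)
    finally show False
      using assms(3) finite_subset [OF sub] by simp
  qed
  then obtain x where x: "x \<in> carrier F" "x \<noteq> \<zero>\<^bsub>F\<^esub>" "x \<noteq> \<one>\<^bsub>F\<^esub>"
    by blast
  define l where "l = x \<odot>\<^bsub>R\<^esub> \<one>\<^bsub>R\<^esub>"
  have l: "l \<in> Units R"
    unfolding l_def using x by (intro unit)
  have "(x \<ominus>\<^bsub>F\<^esub> \<one>\<^bsub>F\<^esub>) \<odot>\<^bsub>R\<^esub> \<one>\<^bsub>R\<^esub> \<in> Units R"
    using x by (intro unit) simp_all
  also have "(x \<ominus>\<^bsub>F\<^esub> \<one>\<^bsub>F\<^esub>) \<odot>\<^bsub>R\<^esub> \<one>\<^bsub>R\<^esub> = l \<ominus>\<^bsub>R\<^esub> \<one>\<^bsub>R\<^esub>"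
    using x by (simp add: l_def F.minus_eq R.minus_eq alg.smult_l_distr alg.smult_l_minus)
  finally have l1: "l \<ominus>\<^bsub>R\<^esub> \<one>\<^bsub>R\<^esub> \<in> Units R" .
  show ?thesis
  proof
    assume fine: "generalized_quasi_t_fine (matrix_ring n R)"
    have loc: "local_ring R"
      using assms(5) fine by (rule generalized_quasi_t_fine_mat_imp_local)
    interpret loc: local_matrices R n
      by (intro local_matrices.intro loc comm_matrices_axioms)
    show "generalized_quasi_t_fine R"
      using loc.torsion_lift [OF assms(5) fine p(1) pR(2)] by (intro loc.generalized_quasi_t_fineI)
  next
    assume fine: "generalized_quasi_t_fine R"
    interpret loc: local_matrices R n
      by (intro local_matrices.intro R.generalized_quasi_t_fine_imp_local(1) fine comm_matrices_axioms)
    show "generalized_quasi_t_fine (matrix_ring n R)"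
      using R.generalized_quasi_t_fine_imp_local(2) [OF fine]
      by (intro loc.generalized_quasi_t_fine_mat [OF assms(5) pR _ l l1])
  qed
qed

end
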